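(* Let $\Omega\subset\mathbb{C}$ be a bounded convex domain with smooth boundary, let $H$ be a complex Hilbert space, and let $A$ be a bounded linear operator on $H$ with $\overline{W(A)}\subset\Omega$. Let $\Sigma\subset\mathbb{C}$ be a sector with vertex at the origin and angle $\pi/2$, i.e. $\Sigma=\{re^{i(\theta+t)} : r\ge 0,\ |t|\le\pi/4\}$ for some $\theta\in\mathbb{R}$. Then $$\|f(A)\|\le 2\,\|f\|_\infty\qquad\text{for all } f\in\mathcal{A}(\Omega)\text{ with } f(\Omega)\subset\Sigma.$$
   Context: For a bounded linear operator $A$ on a complex Hilbert space $(H,\langle\cdot,\cdot\rangle)$, the numerical range is $W(A)=\{\langle Av,v\rangle : v\in H,\ \|v\|=1\}$. $\mathcal{A}(\Omega)$ is the algebra of functions holomorphic in $\Omega$ and continuous on $\overline\Omega$, with norm $\|f\|_\infty=\max\{|f(z)| : z\in\overline\Omega\}$. Since the spectrum of $A$ is contained in $\overline{W(A)}\subset\Omega$, $f(A)$ is defined by the holomorphic functional calculus. *)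

theory Defs
  imports "HOL-Complex_Analysis.Complex_Analysis"
begin

section \<open>Complex Hilbert spaces\<close>

text \<open>The inner product is linear in the first argument and conjugate linear in the
  second, so that the numerical range of \<open>\<lambda>I\<close> is \<open>{\<lambda>}\<close>. The real scalar multiplication
  and the norm of the underlying real normed space are those induced by \<open>scaleC\<close> and
  \<open>cinner\<close>.\<close>

class complex_inner = real_normed_vector +
  fixes scaleC :: "complex \<Rightarrow> 'a \<Rightarrow> 'a" (infixr "*\<^sub>C" 75)
    and cinner :: "'a \<Rightarrow> 'a \<Rightarrow> complex"
  assumes scaleC_add_right: "c *\<^sub>C (x + y) = c *\<^sub>C x + c *\<^sub>C y"
    and scaleC_add_left: "(c + d) *\<^sub>C x = c *\<^sub>C x + d *\<^sub>C x"
    and scaleC_scaleC: "c *\<^sub>C d *\<^sub>C x = (c * d) *\<^sub>C x"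
    and scaleC_of_real: "complex_of_real r *\<^sub>C x = r *\<^sub>R x"
    and cinner_commute: "cinner x y = cnj (cinner y x)"
    and cinner_add_left: "cinner (x + y) z = cinner x z + cinner y z"
    and cinner_scaleC_left: "cinner (c *\<^sub>C x) y = c * cinner x y"
    and cinner_self: "cinner x x = complex_of_real ((norm x)\<^sup>2)"

class chilbert_space = complex_inner + banach

lemma norm_scaleC: "norm (c *\<^sub>C x) = norm c * norm (x :: 'a :: complex_inner)"
proof -
  have "cinner (c *\<^sub>C x) (c *\<^sub>C x) = c * cnj (c * cinner x x)"
    by (metis cinner_commute cinner_scaleC_left)
  also have "\<dots> = complex_of_real ((norm c * norm x)\<^sup>2)"
    using complex_norm_square[of c] by (simp add: cinner_self power_mult_distrib)
  finally have "(norm (c *\<^sub>C x))\<^sup>2 = (norm c * norm x)\<^sup>2"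
    by (simp only: cinner_self of_real_eq_iff)
  then show ?thesis
    by (simp add: power2_eq_iff_nonneg)
qed

lemma bounded_linear_scaleC: "bounded_linear (\<lambda>x :: 'a :: complex_inner. c *\<^sub>C x)"
proof (rule bounded_linear_intro[where K = "norm c"])
  show "c *\<^sub>C (r *\<^sub>R x) = r *\<^sub>R (c *\<^sub>C x)" for r and x :: 'a
    by (simp add: scaleC_scaleC mult.commute flip: scaleC_of_real)
qed (simp_all add: scaleC_add_right norm_scaleC mult.commute)


section \<open>Bounded operators and the holomorphic functional calculus\<close>

text \<open>The bounded complex-linear operators on \<open>'a\<close> are the elements of
  \<open>'a \<Rightarrow>\<^sub>L 'a\<close> (bounded real-linear maps) satisfying \<open>clinear_op\<close>;
  the operator norm is that of the library.\<close>

definition clinear_op :: "('a :: complex_inner \<Rightarrow>\<^sub>L 'a) \<Rightarrow> bool" where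
  "clinear_op A \<longleftrightarrow> (\<forall>c x. A (c *\<^sub>C x) = c *\<^sub>C A x)"

lift_definition scaleC_op :: "complex \<Rightarrow> ('a :: complex_inner \<Rightarrow>\<^sub>L 'a) \<Rightarrow> ('a \<Rightarrow>\<^sub>L 'a)"
  is "\<lambda>c T x. c *\<^sub>C T x"
  by (rule bounded_linear_compose[OF bounded_linear_scaleC])

definition numerical_range :: "('a :: complex_inner \<Rightarrow>\<^sub>L 'a) \<Rightarrow> complex set" where
  "numerical_range A = {cinner (A v) v | v. norm v = 1}"

definition is_inverse_op :: "('a :: real_normed_vector \<Rightarrow>\<^sub>L 'a) \<Rightarrow> ('a \<Rightarrow>\<^sub>L 'a) \<Rightarrow> bool" where
  "is_inverse_op T S \<longleftrightarrow> S o\<^sub>L T = id_blinfun \<and> T o\<^sub>L S = id_blinfun"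

text \<open>The inverse of a complex-linear operator is automatically complex linear.\<close>

definition spectrum :: "('a :: complex_inner \<Rightarrow>\<^sub>L 'a) \<Rightarrow> complex set" where
  "spectrum A = {z. \<nexists>S. is_inverse_op (scaleC_op z id_blinfun - A) S}"

definition resolvent :: "('a :: complex_inner \<Rightarrow>\<^sub>L 'a) \<Rightarrow> complex \<Rightarrow> ('a \<Rightarrow>\<^sub>L 'a)" where
  "resolvent A z = (THE S. is_inverse_op (scaleC_op z id_blinfun - A) S)"

text \<open>Operator-valued contour integral, parametrised as in the definition of
  \<^const>\<open>contour_integral\<close>.\<close>

definition op_contour_integral ::
    "(real \<Rightarrow> complex) \<Rightarrow> (complex \<Rightarrow> ('a :: complex_inner \<Rightarrow>\<^sub>L 'a)) \<Rightarrow> ('a \<Rightarrow>\<^sub>L 'a)" where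
  "op_contour_integral \<gamma> F =
     integral {0..1} (\<lambda>t. scaleC_op (vector_derivative \<gamma> (at t within {0..1})) (F (\<gamma> t)))"

definition surrounds_in :: "(real \<Rightarrow> complex) \<Rightarrow> complex set \<Rightarrow> complex set \<Rightarrow> bool" where
  "surrounds_in \<gamma> K \<Omega> \<longleftrightarrow>
     valid_path \<gamma> \<and> pathfinish \<gamma> = pathstart \<gamma> \<and> path_image \<gamma> \<subseteq> \<Omega> - K \<and>
     (\<forall>z\<in>K. winding_number \<gamma> z = 1) \<and> (\<forall>z. z \<notin> \<Omega> \<longrightarrow> winding_number \<gamma> z = 0)"

text \<open>\<open>f(A) = (2\<pi>i)\<^sup>-\<^sup>1 \<integral>\<^sub>\<gamma> f(z) (z - A)\<^sup>-\<^sup>1 dz\<close> for \<open>f\<close> holomorphic on \<open>\<Omega>\<close>, where \<open>\<gamma>\<close> is a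
  contour in \<open>\<Omega>\<close> around the spectrum of \<open>A\<close>; by Cauchy's theorem the choice of \<open>\<gamma>\<close> is
  irrelevant. A single closed contour exists whenever \<open>\<Omega>\<close> is a simply connected domain
  containing the spectrum; for general \<open>\<Omega>\<close> one would need cycles.\<close>

definition hol_calculus ::
    "complex set \<Rightarrow> (complex \<Rightarrow> complex) \<Rightarrow> ('a :: complex_inner \<Rightarrow>\<^sub>L 'a) \<Rightarrow> ('a \<Rightarrow>\<^sub>L 'a)" where
  "hol_calculus \<Omega> f A =
     (let \<gamma> = SOME \<gamma>. surrounds_in \<gamma> (spectrum A) \<Omega>
      in scaleC_op (1 / (2 * of_real pi * \<i>))
           (op_contour_integral \<gamma> (\<lambda>z. scaleC_op (f z) (resolvent A z))))"


section \<open>Plane domains and their function algebras\<close>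

text \<open>\<open>C\<^sup>\<infinity>\<close> curves: all iterated derivatives exist.\<close>

definition smooth_curve :: "(real \<Rightarrow> complex) \<Rightarrow> bool" where
  "smooth_curve c \<longleftrightarrow>
     (\<forall>n. ((\<lambda>g t. vector_derivative g (at t)) ^^ n) c differentiable_on UNIV)"

text \<open>The boundary of a bounded convex domain is a Jordan curve with the domain on one
  side, so it is smooth iff it has a regular \<open>C\<^sup>\<infinity>\<close> parametrisation as a simple closed
  curve (here a 1-periodic one, so that smoothness also holds at the closing point).\<close>

definition smooth_boundary :: "complex set \<Rightarrow> bool" where
  "smooth_boundary \<Omega> \<longleftrightarrow>
     (\<exists>c. smooth_curve c \<and> (\<forall>t. c (t + 1) = c t) \<and> inj_on c {0..<1} \<and>
          (\<forall>t. vector_derivative c (at t) \<noteq> 0) \<and> c ` {0..<1} = frontier \<Omega>)"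

definition hol_algebra :: "complex set \<Rightarrow> (complex \<Rightarrow> complex) set" where
  "hol_algebra \<Omega> = {f. f holomorphic_on \<Omega> \<and> continuous_on (closure \<Omega>) f}"

text \<open>For bounded nonempty \<open>\<Omega>\<close> and \<open>f \<in> hol_algebra \<Omega>\<close> the supremum is a maximum.\<close>

definition sup_norm_on :: "complex set \<Rightarrow> (complex \<Rightarrow> complex) \<Rightarrow> real" where
  "sup_norm_on \<Omega> f = (SUP z\<in>closure \<Omega>. norm (f z))"

definition right_angle_sector :: "real \<Rightarrow> complex set" where
  "right_angle_sector \<theta> = {of_real r * exp (\<i> * of_real (\<theta> + t)) | r t. 0 \<le> r \<and> \<bar>t\<bar> \<le> pi / 4}"

end

theory Submission
  imports Defs
begin

text \<open>
  Rotate and scale \<open>f\<close> so that it takes values in the first quadrant \<open>Q\<close> and \<open>|f| \<le> 1\<close>.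
  Put \<open>g(z) = (2\<pi>i)\<^sup>-\<^sup>1 \<integral> cnj (f(w)) (w - z)\<^sup>-\<^sup>1 dw\<close>, the integral being over the boundary of \<open>\<Omega>\<close>, and
  write \<open>F = f(A)\<close>, \<open>G = g(A)\<close>. Two facts about \<open>g\<close> are due to the convexity of \<open>\<Omega>\<close>.

  First, \<open>F + G\<^sup>*\<close> is the integral of \<open>f\<close> against a positive operator-valued measure of total mass
  \<open>2\<close> on the boundary, because \<open>\<Omega>\<close>, and with it the numerical range, lies on one side of each
  tangent. Hence \<open>\<parallel>F + G\<^sup>*\<parallel> \<le> 2\<close>. The Hilbert space adjoint is avoided by working with the
  sesquilinear form \<open>\<langle>Fx, y\<rangle> + \<langle>x, Gy\<rangle>\<close> (\<open>calc_pair_bound\<close>).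

  Second, \<open>cnj g + f\<close> is, in the same way, the integral of \<open>f\<close> against a positive scalar measure
  of mass \<open>2\<close>, of which mass at least \<open>1 - o(1)\<close> sits near a boundary point that \<open>z\<close>
  approaches. So all boundary limit points of \<open>cnj g\<close> lie in \<open>Q\<close>, and by the maximum principle
  \<open>cnj g\<close> takes its values in \<open>Q\<close> throughout \<open>\<Omega>\<close> (\<open>conj_transform_half_plane\<close>).

  This is where the angle \<open>\<pi>/2\<close> enters: \<open>f g\<close> has nonnegative real part, and for every \<open>e \<ge> 0\<close> the
  function \<open>f / (1 + e f g)\<close>, which is \<open>1 / (1/f + e g)\<close> away from the zeros of \<open>f\<close>, is again bounded
  by \<open>1\<close> and \<open>Q\<close>-valued (\<open>quarter_flow\<close>). Its value at \<open>A\<close> is \<open>F - e F G F + O(e\<^sup>2)\<close>. Since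
  \<open>F F\<^sup>* F = F (F + G\<^sup>*)\<^sup>* F - F G F\<close>, the first fact bounds the norm of this operator
  from below by \<open>k + e k\<^sup>2 (k - 2) - O(e\<^sup>2)\<close>, where \<open>k = \<parallel>F\<parallel>\<close> (\<open>norm_perturbed_lower_bound\<close>).
  If the supremum \<open>K\<close> of \<open>\<parallel>f(A)\<parallel>\<close> over the class of all such \<open>f\<close> were larger than \<open>2\<close>, a function
  with \<open>\<parallel>f(A)\<parallel>\<close> close to \<open>K\<close> would be moved by this flow to one with \<open>\<parallel>f(A)\<parallel> > K\<close>
  (\<open>quarter_class_norm_le_2\<close>).

  The argument needs the calculus \<open>f \<mapsto> f(A)\<close> to be multiplicative and bounded, and it needs \<open>g(A)\<close> as
  an integral over the boundary. All of this comes from a single computation with the resolvent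
  identity and Fubini (\<open>cauchy_transform_swap\<close>), once \<open>\<integral> (z - A)\<^sup>-\<^sup>1 dz = 2\<pi>i\<close> is known for every
  contour around the spectrum (\<open>resolvent_loop_integral\<close>).
\<close>


section \<open>Complex inner products and positive forms\<close>

lemma cinner_add_right: "cinner x (y + z) = cinner x y + cinner x (z :: 'a :: complex_inner)"
  by (metis cinner_add_left cinner_commute complex_cnj_add)

lemma cinner_scaleC_right: "cinner x (c *\<^sub>C y) = cnj c * cinner x (y :: 'a :: complex_inner)"
  by (metis cinner_commute cinner_scaleC_left complex_cnj_mult)

lemma scaleC_one [simp]: "1 *\<^sub>C (x :: 'a :: complex_inner) = x"
  using scaleC_of_real[of 1 x] by simp

lemma scaleC_minus_one: "(- 1) *\<^sub>C (x :: 'a :: complex_inner) = - x"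
  using scaleC_of_real[of "-1" x] by simp

lemma scaleC_zero_left [simp]: "0 *\<^sub>C (x :: 'a :: complex_inner) = 0"
  using scaleC_of_real[of 0 x] by simp

lemma scaleC_zero_right [simp]: "c *\<^sub>C (0 :: 'a :: complex_inner) = 0"
  using norm_scaleC[of c "0 :: 'a"] by simp

lemma scaleC_minus_left: "(- c) *\<^sub>C (x :: 'a :: complex_inner) = - (c *\<^sub>C x)"
  by (metis scaleC_minus_one scaleC_scaleC mult_minus1)

lemma scaleC_minus_right: "c *\<^sub>C (- x) = - (c *\<^sub>C (x :: 'a :: complex_inner))"
  by (metis scaleC_minus_one scaleC_scaleC mult.commute)

lemma scaleC_diff_left: "(c - d) *\<^sub>C (x :: 'a :: complex_inner) = c *\<^sub>C x - d *\<^sub>C x"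
  by (metis scaleC_add_left scaleC_minus_left diff_conv_add_uminus)

lemma scaleC_diff_right: "c *\<^sub>C (x - y) = c *\<^sub>C x - c *\<^sub>C (y :: 'a :: complex_inner)"
  by (metis scaleC_add_right scaleC_minus_right diff_conv_add_uminus)

lemma cinner_zero_left [simp]: "cinner 0 (x :: 'a :: complex_inner) = 0"
  using cinner_scaleC_left[of 0 x x] by simp

lemma cinner_zero_right [simp]: "cinner (x :: 'a :: complex_inner) 0 = 0"
  using cinner_scaleC_right[of x 0 x] by simp

lemma cinner_minus_left: "cinner (- x) y = - cinner x (y :: 'a :: complex_inner)"
  using cinner_scaleC_left[of "-1" x y] by (simp add: scaleC_minus_one)

lemma cinner_minus_right: "cinner x (- y) = - cinner x (y :: 'a :: complex_inner)"
  using cinner_scaleC_right[of x "-1" y] by (simp add: scaleC_minus_one)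

lemma cinner_diff_left: "cinner (x - y) z = cinner x z - cinner y (z :: 'a :: complex_inner)"
  by (metis cinner_add_left cinner_minus_left diff_conv_add_uminus)

lemma cinner_diff_right: "cinner x (y - z) = cinner x y - cinner x (z :: 'a :: complex_inner)"
  by (metis cinner_add_right cinner_minus_right diff_conv_add_uminus)

lemma cinner_scaleR_left: "cinner (r *\<^sub>R x) y = r *\<^sub>R cinner x (y :: 'a :: complex_inner)"
  by (metis cinner_scaleC_left scaleC_of_real scaleR_conv_of_real)

lemmas cinner_simps = cinner_add_left cinner_add_right cinner_diff_left cinner_diff_right
  cinner_scaleC_left cinner_scaleC_right cinner_minus_left cinner_minus_right

text \<open>Positive semidefinite Hermitian forms. The Cauchy-Schwarz inequality is needed for the inner
  product itself, for the boundary density of the operator-valued double layer potential, and for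
  \<open>k\<^sup>2 \<langle>u, v\<rangle> - \<langle>Fu, Fv\<rangle>\<close> with \<open>k = \<parallel>F\<parallel>\<close>.\<close>

definition positive_form :: "('a :: complex_inner \<Rightarrow> 'a \<Rightarrow> complex) \<Rightarrow> bool" where
  "positive_form Q \<longleftrightarrow> (\<forall>x y z. Q (x + y) z = Q x z + Q y z) \<and>
     (\<forall>c x y. Q (c *\<^sub>C x) y = c * Q x y) \<and> (\<forall>x y. Q y x = cnj (Q x y)) \<and> (\<forall>x. 0 \<le> Re (Q x x))"

lemma positive_form_cauchy_schwarz:
  fixes Q :: "'a :: complex_inner \<Rightarrow> 'a \<Rightarrow> complex"
  assumes "positive_form Q"
  shows "(norm (Q x y))\<^sup>2 \<le> Re (Q x x) * Re (Q y y)"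
proof -
  have add: "Q (x + y) z = Q x z + Q y z" and scl: "Q (c *\<^sub>C x) y = c * Q x y"
    and sym: "Q x y = cnj (Q y x)" and pos: "0 \<le> Re (Q x x)" for x y z c
    using assms unfolding positive_form_def by blast+
  have addr: "Q z (x + y) = Q z x + Q z y" for x y z
    by (subst (1 2 3) sym[where x = z]) (simp add: add)
  have sclr: "Q x (c *\<^sub>C y) = cnj c * Q x y" for x y c
    by (subst (1 2) sym[where x = x]) (simp add: scl)
  define q where "q = Q x y"
  define a where "a = Re (Q x x)"
  define b where "b = Re (Q y y)"
  have exp: "0 \<le> a - 2 * t * (norm q)\<^sup>2 + t\<^sup>2 * (norm q)\<^sup>2 * b" for t :: real
  proof -
    define l where "l = - (of_real t * q)"
    have yx: "Q y x = cnj q" by (simp add: q_def sym[where x = y])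
    have "Im (Q y y) = 0" using arg_cong[OF sym[where x = y and y = y], of Im] by simp
    then have yy: "Q y y = of_real b" by (simp add: b_def complex_eq_iff)
    have "Q (x + l *\<^sub>C y) (x + l *\<^sub>C y) = Q x x + cnj l * q + l * cnj q + l * cnj l * of_real b"
      by (simp add: add addr scl sclr yy yx q_def algebra_simps)
    also have "Re \<dots> = a - 2 * t * (norm q)\<^sup>2 + t\<^sup>2 * (norm q)\<^sup>2 * b"
      unfolding cmod_power2 by (simp add: l_def a_def power2_eq_square algebra_simps)
    finally show ?thesis using pos[of "x + l *\<^sub>C y"] by simp
  qed
  have ab: "0 \<le> a" "0 \<le> b" using pos by (simp_all add: a_def b_def)
  have "(norm q)\<^sup>2 \<le> a * b"
  proof (cases "b = 0")
    case True
    show ?thesis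
    proof (rule ccontr)
      assume "\<not> ?thesis"
      then have "(norm q)\<^sup>2 > 0" using True by simp
      then have "a - 2 * ((a + 1) / (norm q)\<^sup>2) * (norm q)\<^sup>2 = - a - 2" by (simp add: field_simps)
      with exp[of "(a + 1) / (norm q)\<^sup>2"] True ab show False by simp
    qed
  next
    case False
    with ab have "b > 0" by simp
    then have "a - 2 * (1 / b) * (norm q)\<^sup>2 + (1 / b)\<^sup>2 * (norm q)\<^sup>2 * b = a - (norm q)\<^sup>2 / b"
      by (simp add: field_simps power2_eq_square)
    with exp[of "1 / b"] have "(norm q)\<^sup>2 / b \<le> a" by simp
    then show ?thesis using \<open>b > 0\<close> by (simp add: field_simps)
  qed
  then show ?thesis by (simp add: q_def a_def b_def)
qed

text \<open>The arithmetic mean can be integrated over the boundary, which the geometric mean of the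
  Cauchy-Schwarz inequality cannot.\<close>

lemma positive_form_norm_le:
  fixes Q :: "'a :: complex_inner \<Rightarrow> 'a \<Rightarrow> complex"
  assumes "positive_form Q"
  shows "norm (Q x y) \<le> (Re (Q x x) + Re (Q y y)) / 2"
proof -
  have nn: "0 \<le> Re (Q x x)" "0 \<le> Re (Q y y)" using assms unfolding positive_form_def by blast+
  have "(norm (Q x y))\<^sup>2 \<le> Re (Q x x) * Re (Q y y)"
    by (rule positive_form_cauchy_schwarz[OF assms])
  also have "\<dots> \<le> ((Re (Q x x) + Re (Q y y)) / 2)\<^sup>2"
    using zero_le_power2[of "Re (Q x x) - Re (Q y y)"] by (simp add: power2_eq_square algebra_simps)
  finally show ?thesis by (rule power2_le_imp_le) (use nn in simp)
qed

lemma norm_cinner_le: "norm (cinner x y) \<le> norm x * norm (y :: 'a :: complex_inner)"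
proof -
  have "positive_form (cinner :: 'a \<Rightarrow> 'a \<Rightarrow> complex)"
    unfolding positive_form_def
    by (intro conjI allI cinner_commute) (simp_all add: cinner_simps cinner_self)
  from positive_form_cauchy_schwarz[OF this, of x y]
  have "(norm (cinner x y))\<^sup>2 \<le> (norm x * norm y)\<^sup>2"
    by (simp add: cinner_self power_mult_distrib)
  then show ?thesis by (rule power2_le_imp_le) simp
qed

lemma bounded_linear_cinner_left: "bounded_linear (\<lambda>x :: 'a :: complex_inner. cinner x y)"
  by (rule bounded_linear_intro[where K = "norm y"])
    (simp_all add: cinner_simps cinner_scaleR_left norm_cinner_le)

lemma cinner_eqI: "(\<And>y. cinner x y = cinner x' y) \<Longrightarrow> x = (x' :: 'a :: complex_inner)"
proof -
  assume "\<And>y. cinner x y = cinner x' y"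
  then have "cinner (x - x') (x - x') = 0" by (simp add: cinner_simps)
  then show ?thesis by (simp add: cinner_self)
qed


section \<open>Operators and their matrix elements\<close>

lemma scaleC_op_apply [simp]: "blinfun_apply (scaleC_op c T) x = c *\<^sub>C T x"
  by (simp add: scaleC_op.rep_eq)

lemma op_eqI:
  fixes S T :: "'a :: complex_inner \<Rightarrow>\<^sub>L 'a"
  shows "(\<And>x y. cinner (S x) y = cinner (T x) y) \<Longrightarrow> S = T"
  by (intro blinfun_eqI cinner_eqI)

lemma op_norm_bound:
  fixes T :: "'a :: complex_inner \<Rightarrow>\<^sub>L 'a"
  assumes "0 \<le> C" and "\<And>x y. norm (cinner (T x) y) \<le> C * norm x * norm y"
  shows "norm T \<le> C"
proof (rule norm_blinfun_bound[OF \<open>0 \<le> C\<close>])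
  fix x
  have "(norm (T x))\<^sup>2 \<le> C * norm x * norm (T x)"
    using assms(2)[of x "T x"] by (simp add: cinner_self norm_power)
  then show "norm (T x) \<le> C * norm x"
    by (cases "T x = 0") (use \<open>0 \<le> C\<close> in \<open>auto simp: power2_eq_square\<close>)
qed

lemma norm_matrix_element_le:
  fixes T :: "'a :: complex_inner \<Rightarrow>\<^sub>L 'a"
  shows "norm (cinner (T x) y) \<le> norm T * norm x * norm y"
  by (meson norm_blinfun norm_cinner_le mult_right_mono norm_ge_zero order_trans)

lemma norm_scaleC_op:
  fixes T :: "'a :: complex_inner \<Rightarrow>\<^sub>L 'a"
  shows "norm (scaleC_op c T) \<le> norm c * norm T"
  by (rule norm_blinfun_bound)
    (auto simp: norm_scaleC mult.assoc intro: mult_left_mono norm_blinfun)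

lemma bounded_bilinear_scaleC_op:
  "bounded_bilinear (scaleC_op :: complex \<Rightarrow> ('a :: complex_inner \<Rightarrow>\<^sub>L 'a) \<Rightarrow> _)"
proof
  show "\<exists>K. \<forall>c (T :: 'a \<Rightarrow>\<^sub>L 'a). norm (scaleC_op c T) \<le> norm c * norm T * K"
    by (rule exI[of _ 1]) (simp add: norm_scaleC_op)
next
  fix r c and T :: "'a \<Rightarrow>\<^sub>L 'a"
  show "scaleC_op c (r *\<^sub>R T) = r *\<^sub>R scaleC_op c T"
    by (rule blinfun_eqI)
      (simp add: blinfun.scaleR_left scaleC_scaleC mult.commute flip: scaleC_of_real)
  show "scaleC_op (r *\<^sub>R c) T = r *\<^sub>R scaleC_op c T"
    by (rule blinfun_eqI)
      (simp add: blinfun.scaleR_left scaleC_scaleC scaleR_conv_of_real flip: scaleC_of_real)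
qed (auto intro!: blinfun_eqI simp: blinfun.add_left scaleC_add_left scaleC_add_right)

lemma bounded_linear_matrix_element:
  "bounded_linear (\<lambda>T :: 'a :: complex_inner \<Rightarrow>\<^sub>L 'a. cinner (T x) y)"
  using bounded_linear_compose[OF bounded_linear_cinner_left blinfun.bounded_linear_left] .

section \<open>Invertibility and the resolvent\<close>

lemma is_inverse_op_apply:
  assumes "is_inverse_op T S"
  shows "S (T x) = x" and "T (S x) = x"
  using assms unfolding is_inverse_op_def
  by (metis blinfun_apply_blinfun_compose blinfun_apply_id_blinfun)+

lemma is_inverse_opI:
  "(\<And>x. blinfun_apply S (blinfun_apply T x) = x) \<Longrightarrow> (\<And>x. blinfun_apply T (blinfun_apply S x) = x) \<Longrightarrow> is_inverse_op T S"
  by (auto simp: is_inverse_op_def intro!: blinfun_eqI)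

lemma is_inverse_op_unique: "is_inverse_op T S \<Longrightarrow> is_inverse_op T S' \<Longrightarrow> S = S'"
  by (metis blinfun_eqI is_inverse_op_apply)

text \<open>A right inverse of \<open>T + D\<close> is a fixed point of the contraction \<open>X \<mapsto> S - S D X\<close>, a left inverse
  one of \<open>Y \<mapsto> S - Y D S\<close>.\<close>

lemma perturbed_inverse_exists:
  fixes T S D :: "'a :: banach \<Rightarrow>\<^sub>L 'a"
  assumes "is_inverse_op T S" and small: "norm S * norm D < 1"
  shows "\<exists>S'. is_inverse_op (T + D) S'"
proof -
  note inv = is_inverse_op_apply[OF assms(1)]
  define q where "q = norm S * norm D"
  have q: "0 \<le> q" "q < 1" using small by (auto simp: q_def)
  have "\<exists>!X. S - (S o\<^sub>L D o\<^sub>L X) = X"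
  proof (rule banach_fix_type[OF q], intro allI)
    fix X Y
    have "(S - (S o\<^sub>L D o\<^sub>L X)) - (S - (S o\<^sub>L D o\<^sub>L Y)) = S o\<^sub>L D o\<^sub>L (Y - X)"
      by (rule blinfun_eqI) (simp add: blinfun.diff_left blinfun.diff_right)
    then have "dist (S - (S o\<^sub>L D o\<^sub>L X)) (S - (S o\<^sub>L D o\<^sub>L Y)) \<le> norm (S o\<^sub>L D) * norm (Y - X)"
      by (simp add: dist_norm norm_blinfun_compose)
    also have "\<dots> \<le> q * norm (Y - X)"
      unfolding q_def by (intro mult_right_mono norm_blinfun_compose) simp
    finally show "dist (S - (S o\<^sub>L D o\<^sub>L X)) (S - (S o\<^sub>L D o\<^sub>L Y)) \<le> q * dist X Y"
      by (simp add: dist_norm norm_minus_commute)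
  qed
  then obtain X where X: "S - (S o\<^sub>L D o\<^sub>L X) = X" by blast
  have "\<exists>!Y. S - (Y o\<^sub>L D o\<^sub>L S) = Y"
  proof (rule banach_fix_type[OF q], intro allI)
    fix X Y
    have "(S - (X o\<^sub>L D o\<^sub>L S)) - (S - (Y o\<^sub>L D o\<^sub>L S)) = (Y - X) o\<^sub>L (D o\<^sub>L S)"
      by (rule blinfun_eqI) (simp add: blinfun.diff_left blinfun.diff_right)
    then have "dist (S - (X o\<^sub>L D o\<^sub>L S)) (S - (Y o\<^sub>L D o\<^sub>L S)) \<le> norm (Y - X) * norm (D o\<^sub>L S)"
      by (simp add: dist_norm norm_blinfun_compose)
    also have "\<dots> \<le> norm (Y - X) * (norm D * norm S)"
      by (intro mult_left_mono norm_blinfun_compose) simp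
    finally show "dist (S - (X o\<^sub>L D o\<^sub>L S)) (S - (Y o\<^sub>L D o\<^sub>L S)) \<le> q * dist X Y"
      by (simp add: dist_norm norm_minus_commute q_def mult_ac)
  qed
  then obtain Y where Y: "S - (Y o\<^sub>L D o\<^sub>L S) = Y" by blast
  have right: "(T + D) (X x) = x" for x
  proof -
    have "X x = S x - S (D (X x))"
      by (subst X[symmetric]) (simp add: blinfun.diff_left)
    then have "T (X x) = T (S x - S (D (X x)))" by (rule arg_cong)
    then have "T (X x) = x - D (X x)"
      unfolding blinfun.diff_right inv .
    then show ?thesis by (simp add: blinfun.add_left)
  qed
  have left: "Y ((T + D) x) = x" for x
  proof -
    have "Y (T x) = S (T x) - Y (D (S (T x)))"
      by (subst Y[symmetric]) (simp add: blinfun.diff_left)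
    then show ?thesis by (simp add: blinfun.add_left blinfun.add_right inv)
  qed
  have "Y x = X x" for x using left[of "X x"] right[of x] by simp
  then have "Y = X" by (rule blinfun_eqI)
  with left right show ?thesis by (auto intro: is_inverse_opI)
qed

lemma inverse_norm_bound:
  fixes T S :: "'a :: real_normed_vector \<Rightarrow>\<^sub>L 'a"
  assumes "is_inverse_op T S" "0 < d" and "\<And>x. d * norm x \<le> norm (T x)"
  shows "norm S \<le> 1 / d"
proof (rule norm_blinfun_bound)
  fix x
  have "d * norm (S x) \<le> norm x" using assms(3)[of "S x"] is_inverse_op_apply[OF assms(1)] by simp
  then show "norm (S x) \<le> 1 / d * norm x" using \<open>0 < d\<close> by (simp add: field_simps)
qed (use \<open>0 < d\<close> in simp)

lemma resolvent_inverse: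
  "z \<notin> spectrum A \<Longrightarrow> is_inverse_op (scaleC_op z id_blinfun - A) (resolvent A z)"
  unfolding spectrum_def resolvent_def
  by (rule theI') (auto intro: is_inverse_op_unique)

lemma resolvent_apply:
  assumes "z \<notin> spectrum A"
  shows "z *\<^sub>C resolvent A z x - A (resolvent A z x) = x"
    and "resolvent A z (z *\<^sub>C x - A x) = x"
  using is_inverse_op_apply[OF resolvent_inverse[OF assms]] by (simp_all add: blinfun.diff_left)

lemma not_in_spectrumI: "is_inverse_op (scaleC_op z id_blinfun - A) S \<Longrightarrow> z \<notin> spectrum A"
  by (auto simp: spectrum_def)

lemma clinear_resolvent:
  assumes "clinear_op A" "z \<notin> spectrum A"
  shows "clinear_op (resolvent A z)"
  unfolding clinear_op_def
proof (intro allI)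
  fix c x
  let ?R = "resolvent A z"
  have "z *\<^sub>C (c *\<^sub>C ?R x) - A (c *\<^sub>C ?R x) = c *\<^sub>C (z *\<^sub>C ?R x - A (?R x))"
    using assms(1) by (simp add: clinear_op_def scaleC_diff_right scaleC_scaleC mult.commute)
  then have "z *\<^sub>C (c *\<^sub>C ?R x) - A (c *\<^sub>C ?R x) = c *\<^sub>C x"
    using resolvent_apply(1)[OF assms(2)] by simp
  then show "?R (c *\<^sub>C x) = c *\<^sub>C ?R x"
    using resolvent_apply(2)[OF assms(2), of "c *\<^sub>C ?R x"] by simp
qed

lemma resolvent_identity:
  assumes "clinear_op A" "z \<notin> spectrum A" "w \<notin> spectrum A"
  shows "resolvent A z x - resolvent A w x = (w - z) *\<^sub>C resolvent A z (resolvent A w x)"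
proof -
  let ?y = "resolvent A w x"
  have "z *\<^sub>C ?y - A ?y = (w *\<^sub>C ?y - A ?y) - (w - z) *\<^sub>C ?y"
    by (simp add: scaleC_diff_left)
  then have "?y = resolvent A z (x - (w - z) *\<^sub>C ?y)"
    using resolvent_apply(2)[OF assms(2), of ?y] resolvent_apply(1)[OF assms(3), of x] by simp
  also have "\<dots> = resolvent A z x - (w - z) *\<^sub>C resolvent A z ?y"
    using clinear_resolvent[OF assms(1,2)] by (simp add: blinfun.diff_right clinear_op_def)
  finally show ?thesis by (simp add: algebra_simps)
qed

lemma spectrum_perturbation:
  fixes A :: "'a :: chilbert_space \<Rightarrow>\<^sub>L 'a"
  assumes "w \<notin> spectrum A" "norm (resolvent A w) * norm (z - w) < 1"
  shows "z \<notin> spectrum A"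
proof -
  let ?D = "scaleC_op (z - w) id_blinfun :: 'a \<Rightarrow>\<^sub>L 'a"
  have "norm ?D \<le> norm (z - w)"
    using norm_scaleC_op[of "z - w" "id_blinfun :: 'a \<Rightarrow>\<^sub>L 'a"] norm_blinfun_id_le[where 'a = 'a]
    by (meson mult_left_le norm_ge_zero order_trans)
  then have "norm (resolvent A w) * norm ?D < 1"
    using assms(2) by (meson mult_left_mono norm_ge_zero order_le_less_trans)
  from perturbed_inverse_exists[OF resolvent_inverse[OF assms(1)] this]
  obtain S where "is_inverse_op (scaleC_op w id_blinfun - A + ?D) S" ..
  moreover have "scaleC_op w id_blinfun - A + ?D = scaleC_op z id_blinfun - A"
    by (rule blinfun_eqI) (simp add: blinfun.diff_left blinfun.add_left scaleC_diff_left)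
  ultimately show ?thesis by (metis not_in_spectrumI)
qed

lemma open_resolvent_set:
  fixes A :: "'a :: chilbert_space \<Rightarrow>\<^sub>L 'a"
  shows "open (- spectrum A)"
  unfolding open_dist
proof (intro ballI)
  fix w assume w: "w \<in> - spectrum A"
  define e where "e = 1 / (norm (resolvent A w) + 1)"
  have n: "0 < norm (resolvent A w) + 1" by (simp add: add_nonneg_pos)
  then have "e > 0" by (simp add: e_def)
  moreover have "z \<in> - spectrum A" if "dist z w < e" for z
  proof -
    have "(norm (resolvent A w) + 1) * norm (z - w) < 1"
      using that n by (simp add: e_def dist_norm field_simps)
    moreover have "norm (resolvent A w) * norm (z - w) \<le> (norm (resolvent A w) + 1) * norm (z - w)"
      by (intro mult_right_mono) auto
    ultimately show ?thesis using spectrum_perturbation[of w A z] w by simp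
  qed
  ultimately show "\<exists>e>0. \<forall>z. dist z w < e \<longrightarrow> z \<in> - spectrum A" by blast
qed

lemma large_not_in_spectrum:
  fixes A :: "'a :: chilbert_space \<Rightarrow>\<^sub>L 'a"
  assumes "norm A < norm z"
  shows "z \<notin> spectrum A"
proof -
  let ?T = "scaleC_op z id_blinfun :: 'a \<Rightarrow>\<^sub>L 'a"
  let ?S = "scaleC_op (1 / z) id_blinfun :: 'a \<Rightarrow>\<^sub>L 'a"
  have z: "z \<noteq> 0" using assms by (metis norm_ge_zero norm_zero not_le)
  have inv: "is_inverse_op ?T ?S" by (rule is_inverse_opI) (simp_all add: z scaleC_scaleC)
  have "norm ?S \<le> 1 / norm z"
    by (rule inverse_norm_bound[OF inv]) (use z in \<open>simp_all add: norm_scaleC\<close>)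
  then have "norm ?S * norm (- A) \<le> 1 / norm z * norm A"
    unfolding norm_minus_cancel by (rule mult_right_mono) simp
  also have "\<dots> < 1" using assms z by (simp add: field_simps)
  finally obtain S where "is_inverse_op (?T + - A) S"
    using perturbed_inverse_exists[OF inv] by blast
  then have "is_inverse_op (?T - A) S" by simp
  then show ?thesis by (rule not_in_spectrumI)
qed

lemma norm_resolvent_le_half_plane:
  fixes A :: "'a :: chilbert_space \<Rightarrow>\<^sub>L 'a"
  assumes "clinear_op A" "norm u = 1" and hp: "\<And>w. w \<in> numerical_range A \<Longrightarrow> Re (cnj u * w) \<le> b"
    and "b + d \<le> Re (cnj u * z)" "0 < d" and z: "z \<notin> spectrum A"
  shows "norm (resolvent A z) \<le> 1 / d"
proof (rule inverse_norm_bound[OF resolvent_inverse[OF z] \<open>0 < d\<close>])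
  fix x
  show "d * norm x \<le> norm ((scaleC_op z id_blinfun - A) x)"
  proof (cases "x = 0")
    case False
    define v where "v = (1 / norm x) *\<^sub>R x"
    have v: "norm v = 1" using False by (simp add: v_def)
    have x: "x = norm x *\<^sub>R v" using False by (simp add: v_def)
    have "Re (cnj u * cinner (A v) v) \<le> b" using hp v by (auto simp: numerical_range_def)
    moreover have e: "cinner (z *\<^sub>C v - A v) v = z - cinner (A v) v"
      using v by (simp add: cinner_simps cinner_self)
    ultimately have "d \<le> Re (cnj u * cinner (z *\<^sub>C v - A v) v)"
      using assms(4) unfolding e by (simp only: right_diff_distrib minus_complex.sel)
    also have "\<dots> \<le> norm (cnj u * cinner (z *\<^sub>C v - A v) v)" by (rule complex_Re_le_cmod)
    also have "\<dots> \<le> norm (z *\<^sub>C v - A v)"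
      using norm_cinner_le[of "z *\<^sub>C v - A v" v] v assms(2) by (simp add: norm_mult)
    finally have "norm x * d \<le> norm x * norm (z *\<^sub>C v - A v)" by (rule mult_left_mono) simp
    also have "\<dots> = norm (norm x *\<^sub>R ((scaleC_op z id_blinfun - A) v))"
      by (simp add: blinfun.diff_left)
    also have "norm x *\<^sub>R ((scaleC_op z id_blinfun - A) v) = (scaleC_op z id_blinfun - A) x"
      by (simp only: blinfun.scaleR_right[symmetric] x[symmetric])
    finally show ?thesis by (simp add: mult.commute)
  qed simp
qed

text \<open>From a point far out on the ray \<open>z + s u\<close> one returns to \<open>z\<close> in steps of length \<open>d/2\<close>: on the
  whole ray the resolvent is bounded by \<open>1/d\<close> wherever it exists, so the perturbation lemma applies
  at each step. This replaces the usual argument through the adjoint.\<close>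

lemma not_in_spectrum_half_plane:
  fixes A :: "'a :: chilbert_space \<Rightarrow>\<^sub>L 'a"
  assumes cl: "clinear_op A" and u: "norm u = 1"
    and hp: "\<And>w. w \<in> numerical_range A \<Longrightarrow> Re (cnj u * w) \<le> b"
    and z: "b < Re (cnj u * z)"
  shows "z \<notin> spectrum A"
proof -
  define d where "d = Re (cnj u * z) - b"
  have d: "d > 0" using z by (simp add: d_def)
  define p where "p n = z + of_real (real n * (d / 2)) * u" for n
  have uu: "cnj u * u = 1" using u by (metis complex_norm_square mult.commute of_real_1 power_one)
  have "Re (cnj u * p n) = Re (cnj u * z) + real n * (d / 2)" for n
  proof -
    have "cnj u * p n = cnj u * z + of_real (real n * (d / 2)) * (cnj u * u)"
      by (simp add: p_def algebra_simps)
    then show ?thesis by (simp add: uu)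
  qed
  then have far: "b + d \<le> Re (cnj u * p n)" for n using d by (simp add: d_def)
  have step: "p n \<notin> spectrum A" if "p (Suc n) \<notin> spectrum A" for n
  proof (rule spectrum_perturbation[OF that])
    have "p n - p (Suc n) = - (of_real (d / 2) * u)"
      by (simp add: p_def algebra_simps add_divide_distrib)
    then have "norm (p n - p (Suc n)) = d / 2"
      using d u by (simp add: norm_mult)
    moreover have "norm (resolvent A (p (Suc n))) \<le> 1 / d"
      by (rule norm_resolvent_le_half_plane[OF cl u hp far d that])
    ultimately have "norm (resolvent A (p (Suc n))) * norm (p n - p (Suc n)) \<le> 1 / d * (d / 2)"
      using d by (intro mult_mono) auto
    then show "norm (resolvent A (p (Suc n))) * norm (p n - p (Suc n)) < 1" using d by simp
  qed
  have "\<forall>y. \<exists>n. y < real n * (d / 2)" by (rule reals_Archimedean3) (use d in simp)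
  then obtain n where n: "norm A + norm z < real n * (d / 2)" by blast
  have "norm (of_real (real n * (d / 2)) * u) = real n * (d / 2)" using u d by (simp add: norm_mult)
  then have "norm A < norm (p n)"
    using n norm_diff_ineq[of "of_real (real n * (d / 2)) * u" z] by (simp add: p_def add.commute)
  then have "p n \<notin> spectrum A" by (rule large_not_in_spectrum)
  then have "p 0 \<notin> spectrum A" by (induction n) (auto dest: step)
  then show ?thesis by (simp add: p_def)
qed

lemma spectrum_subset_closed_convex:
  fixes A :: "'a :: chilbert_space \<Rightarrow>\<^sub>L 'a"
  assumes "clinear_op A" and C: "convex C" "closed C" "C \<noteq> {}" "numerical_range A \<subseteq> C"
  shows "spectrum A \<subseteq> C"
proof
  fix z assume z: "z \<in> spectrum A"
  show "z \<in> C"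
  proof (rule ccontr)
    assume "z \<notin> C"
    then obtain a b where a: "a \<in> C" "(a - z) \<bullet> z < b" "\<And>x. x \<in> C \<Longrightarrow> b < (a - z) \<bullet> x"
      using separating_hyperplane_closed_point_inset[OF C(1-3)] by metis
    have nz: "norm (z - a) > 0" using a \<open>z \<notin> C\<close> by auto
    define u where "u = (z - a) /\<^sub>R norm (z - a)"
    have u: "norm u = 1" using nz by (simp add: u_def)
    have in_eq: "Re (cnj u * w) = - ((a - z) \<bullet> w) / norm (z - a)" for w
      by (simp add: u_def inner_complex_def divide_simps algebra_simps)
    have "z \<notin> spectrum A"
    proof (rule not_in_spectrum_half_plane[OF assms(1) u])
      show "Re (cnj u * w) \<le> - b / norm (z - a)" if "w \<in> numerical_range A" for w
        using a(3)[of w] that C(4) nz unfolding in_eq by (auto simp: divide_simps)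
      show "- b / norm (z - a) < Re (cnj u * z)"
        using a(2) nz unfolding in_eq by (intro divide_strict_right_mono) auto
    qed
    with z show False by simp
  qed
qed

lemma continuous_on_resolvent:
  fixes A :: "'a :: chilbert_space \<Rightarrow>\<^sub>L 'a"
  assumes "clinear_op A"
  shows "continuous_on (- spectrum A) (resolvent A)"
proof (rule continuous_at_imp_continuous_on, intro ballI)
  fix w assume w: "w \<in> - spectrum A"
  let ?r = "norm (resolvent A w)"
  have diff: "norm (resolvent A z - resolvent A w) \<le> norm (z - w) * norm (resolvent A z) * ?r"
    if "z \<notin> spectrum A" for z
  proof (rule norm_blinfun_bound)
    fix x
    have "norm ((resolvent A z - resolvent A w) x) = norm (w - z) * norm (resolvent A z (resolvent A w x))"
      using resolvent_identity[OF assms that, of w x] w by (simp add: blinfun.diff_left norm_scaleC)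
    also have "\<dots> \<le> norm (w - z) * (norm (resolvent A z) * (?r * norm x))"
      by (intro mult_left_mono order_trans[OF norm_blinfun] norm_blinfun) auto
    finally show "norm ((resolvent A z - resolvent A w) x) \<le> norm (z - w) * norm (resolvent A z) * ?r * norm x"
      by (simp add: norm_minus_commute mult_ac)
  qed auto
  have ev: "eventually (\<lambda>z. z \<notin> spectrum A \<and> norm (z - w) * ?r < 1 / 2) (at w)"
  proof (intro eventually_conj)
    show "eventually (\<lambda>z. z \<notin> spectrum A) (at w)"
      using eventually_at_in_open'[OF open_resolvent_set w] by simp
    have "((\<lambda>z. norm (z - w) * ?r) \<longlongrightarrow> norm (w - w) * ?r) (at w)"
      by (intro tendsto_intros)
    then show "eventually (\<lambda>z. norm (z - w) * ?r < 1 / 2) (at w)"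
      by (rule order_tendstoD) simp
  qed
  have "((\<lambda>z. resolvent A z - resolvent A w) \<longlongrightarrow> 0) (at w)"
  proof (rule Lim_null_comparison)
    show "eventually (\<lambda>z. norm (resolvent A z - resolvent A w) \<le> norm (z - w) * (2 * ?r) * ?r) (at w)"
      using ev
    proof eventually_elim
      case (elim z)
      then have d: "norm (resolvent A z - resolvent A w) \<le> norm (z - w) * norm (resolvent A z) * ?r"
        using diff by simp
      have "norm (resolvent A z) \<le> norm (resolvent A z - resolvent A w) + ?r"
        by (metis diff_add_cancel norm_triangle_ineq)
      also have "norm (resolvent A z - resolvent A w) \<le> (norm (z - w) * ?r) * norm (resolvent A z)"
        using d by (simp add: mult_ac)
      also have "\<dots> \<le> 1 / 2 * norm (resolvent A z)"
        using elim by (intro mult_right_mono) auto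
      finally have "norm (resolvent A z) \<le> 2 * ?r" by simp
      then have "norm (z - w) * norm (resolvent A z) * ?r \<le> norm (z - w) * (2 * ?r) * ?r"
        by (intro mult_right_mono mult_left_mono) auto
      with d show ?case by simp
    qed
    have "((\<lambda>z. norm (z - w) * (2 * ?r) * ?r) \<longlongrightarrow> norm (w - w) * (2 * ?r) * ?r) (at w)"
      by (intro tendsto_intros)
    then show "((\<lambda>z. norm (z - w) * (2 * ?r) * ?r) \<longlongrightarrow> 0) (at w)" by simp
  qed
  then show "isCont (resolvent A) w" unfolding isCont_def by (simp add: LIM_zero_cancel)
qed

lemma resolvent_matrix_element_derivative:
  fixes A :: "'a :: chilbert_space \<Rightarrow>\<^sub>L 'a"
  assumes "clinear_op A" and w: "w \<notin> spectrum A"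
  shows "((\<lambda>z. cinner (resolvent A z x) y) has_field_derivative
           - cinner (resolvent A w (resolvent A w x)) y) (at w)"
  unfolding has_field_derivative_iff
proof -
  have "isCont (resolvent A) w"
    using continuous_on_resolvent[OF assms(1)] w
    by (simp add: continuous_on_eq_continuous_at[OF open_resolvent_set])
  then have "(resolvent A \<longlongrightarrow> resolvent A w) (at w)" by (simp add: isCont_def)
  then have "((\<lambda>z. - cinner (resolvent A z (resolvent A w x)) y) \<longlongrightarrow>
               - cinner (resolvent A w (resolvent A w x)) y) (at w)"
    by (intro tendsto_minus bounded_linear.tendsto[OF bounded_linear_matrix_element])
  moreover have "eventually (\<lambda>z. - cinner (resolvent A z (resolvent A w x)) y =
      (cinner (resolvent A z x) y - cinner (resolvent A w x) y) / (z - w)) (at w)"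
  proof -
    have "eventually (\<lambda>z. z \<in> - spectrum A \<and> z \<noteq> w) (at w)"
      using eventually_at_in_open[OF open_resolvent_set, of w A] w by (auto elim: eventually_mono)
    then show ?thesis
    proof eventually_elim
      case (elim z)
      have "cinner (resolvent A z x) y - cinner (resolvent A w x) y =
          (w - z) * cinner (resolvent A z (resolvent A w x)) y"
        using resolvent_identity[OF assms(1) _ w, of z x] elim by (simp flip: cinner_diff_left cinner_scaleC_left)
      then show ?case using elim by (simp add: field_simps)
    qed
  qed
  ultimately show "((\<lambda>z. (cinner (resolvent A z x) y - cinner (resolvent A w x) y) / (z - w)) \<longlongrightarrow>
      - cinner (resolvent A w (resolvent A w x)) y) (at w)"
    by (rule Lim_transform_eventually)
qed

lemma resolvent_matrix_element_holomorphic: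
  fixes A :: "'a :: chilbert_space \<Rightarrow>\<^sub>L 'a"
  assumes "clinear_op A"
  shows "(\<lambda>z. cinner (resolvent A z x) y) holomorphic_on - spectrum A"
  unfolding holomorphic_on_open[OF open_resolvent_set]
  using resolvent_matrix_element_derivative[OF assms] by blast

lemma norm_resolvent_le_large:
  fixes A :: "'a :: chilbert_space \<Rightarrow>\<^sub>L 'a"
  assumes "norm A < norm z"
  shows "norm (resolvent A z) \<le> 1 / (norm z - norm A)"
proof (rule inverse_norm_bound[OF resolvent_inverse[OF large_not_in_spectrum[OF assms]]])
  fix x
  have "(norm z - norm A) * norm x \<le> norm (z *\<^sub>C x) - norm (A x)"
    using norm_blinfun[of A x] by (simp add: norm_scaleC algebra_simps)
  also have "\<dots> \<le> norm (z *\<^sub>C x - A x)" by (rule norm_triangle_ineq2)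
  finally show "(norm z - norm A) * norm x \<le> norm ((scaleC_op z id_blinfun - A) x)"
    by (simp add: blinfun.diff_left)
qed (use assms in simp)

text \<open>Otherwise the resolvent would be entire and vanish at infinity.\<close>

lemma spectrum_nonempty:
  fixes A :: "'a :: chilbert_space \<Rightarrow>\<^sub>L 'a"
  assumes cl: "clinear_op A" and x0: "(x :: 'a) \<noteq> 0"
  shows "spectrum A \<noteq> {}"
proof
  assume empty: "spectrum A = {}"
  have "cinner (resolvent A z x) y = 0" for z y
  proof (rule Liouville_weak_0[where f = "\<lambda>z. cinner (resolvent A z x) y"])
    show "(\<lambda>z. cinner (resolvent A z x) y) holomorphic_on UNIV"
      using resolvent_matrix_element_holomorphic[OF cl, of x y] by (simp add: empty)
    have bound: "norm (cinner (resolvent A z x) y) \<le> 1 / (norm z - norm A) * norm x * norm y"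
      if "norm A < norm z" for z
      by (intro order_trans[OF norm_matrix_element_le] mult_right_mono norm_resolvent_le_large)
        (use that in auto)
    show "((\<lambda>z. cinner (resolvent A z x) y) \<longlongrightarrow> 0) at_infinity"
    proof (rule Lim_null_comparison)
      show "eventually (\<lambda>z. norm (cinner (resolvent A z x) y) \<le>
          1 / (norm z - norm A) * norm x * norm y) at_infinity"
        unfolding eventually_at_infinity
        by (rule exI[of _ "norm A + 1"], intro allI impI bound) linarith
      have "filterlim (\<lambda>z :: complex. - norm A + norm z) at_top at_infinity"
        by (intro filterlim_tendsto_add_at_top[OF tendsto_const] filterlim_norm_at_top)
      then have "((\<lambda>z :: complex. inverse (- norm A + norm z)) \<longlongrightarrow> 0) at_infinity"
        by (rule tendsto_inverse_0_at_top)
      then have "((\<lambda>z :: complex. inverse (- norm A + norm z) * norm x * norm y) \<longlongrightarrow> 0 * norm x * norm y) at_infinity"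
        by (intro tendsto_intros)
      then show "((\<lambda>z :: complex. 1 / (norm z - norm A) * norm x * norm y) \<longlongrightarrow> 0) at_infinity"
        by (simp add: inverse_eq_divide)
    qed
  qed
  then have "resolvent A 0 x = 0" by (intro cinner_eqI) simp
  then show False using resolvent_apply(1)[of 0 A x] x0 empty by simp
qed

section \<open>Operator-valued contour integrals\<close>

text \<open>Weak holomorphy together with norm continuity is all that contour integration requires, and it
  gives access to the scalar Cauchy theorem.\<close>

definition op_holomorphic :: "(complex \<Rightarrow> ('a :: complex_inner \<Rightarrow>\<^sub>L 'a)) \<Rightarrow> complex set \<Rightarrow> bool" where
  "op_holomorphic h S \<longleftrightarrow>
     continuous_on S h \<and> (\<forall>x y. (\<lambda>z. cinner (h z x) y) holomorphic_on S)"

lemma op_holomorphic_subset: "op_holomorphic h S \<Longrightarrow> T \<subseteq> S \<Longrightarrow> op_holomorphic h T"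
  by (meson op_holomorphic_def continuous_on_subset holomorphic_on_subset)

lemma op_holomorphic_scaleC:
  assumes "f holomorphic_on S" "op_holomorphic h S"
  shows "op_holomorphic (\<lambda>z. scaleC_op (f z) (h z)) S"
  using assms unfolding op_holomorphic_def
  by (auto intro!: bounded_bilinear.continuous_on[OF bounded_bilinear_scaleC_op] holomorphic_intros
      holomorphic_on_imp_continuous_on simp: cinner_scaleC_left)

lemma op_holomorphic_resolvent:
  fixes A :: "'a :: chilbert_space \<Rightarrow>\<^sub>L 'a"
  shows "clinear_op A \<Longrightarrow> op_holomorphic (resolvent A) (- spectrum A)"
  by (simp add: op_holomorphic_def continuous_on_resolvent resolvent_matrix_element_holomorphic)

text \<open>The primitive is the integral over segments from a fixed point; its additivity over triangles
  can be tested on matrix elements, which have scalar primitives.\<close>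

lemma op_local_primitive:
  fixes h :: "complex \<Rightarrow> ('a :: chilbert_space \<Rightarrow>\<^sub>L 'a)"
  assumes S: "convex S" "open S" and h: "op_holomorphic h S"
  obtains P where "\<And>z. z \<in> S \<Longrightarrow> (P has_derivative (\<lambda>k. scaleC_op k (h z))) (at z)"
proof -
  have cont: "continuous_on S h" and hol: "\<And>x y. (\<lambda>z. cinner (h z x) y) holomorphic_on S"
    using h by (auto simp: op_holomorphic_def)
  define G where "G a b = integral {0..1} (\<lambda>t. scaleC_op (b - a) (h (linepath a b t)))" for a b
  have seg: "linepath a b ` {0..1} \<subseteq> S" if "a \<in> S" "b \<in> S" for a b
    using that S(1) by (metis closed_segment_subset path_image_def path_image_linepath)
  have cseg: "continuous_on {0..1} (\<lambda>t. scaleC_op (b - a) (h (linepath a b t)))"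
    if "a \<in> S" "b \<in> S" for a b
    by (intro bounded_bilinear.continuous_on[OF bounded_bilinear_scaleC_op] continuous_intros
        continuous_on_compose2[OF cont _ seg[OF that]] continuous_on_linepath)
  have int: "((\<lambda>t. scaleC_op (b - a) (h (linepath a b t))) has_integral G a b) {0..1}"
    if "a \<in> S" "b \<in> S" for a b
    unfolding G_def using integrable_continuous_interval[OF cseg[OF that]] by (rule integrable_integral)
  have elem: "((\<lambda>z. cinner (h z x) y) has_contour_integral cinner (G a b x) y) (linepath a b)"
    if "a \<in> S" "b \<in> S" for a b x y
    using has_integral_linear[OF int[OF that] bounded_linear_matrix_element[of x y]]
    by (simp add: has_contour_integral_linepath o_def cinner_scaleC_left mult.commute)
  have G_diff: "G a b - G a c = G c b" if abc: "a \<in> S" "b \<in> S" "c \<in> S" for a b c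
  proof (rule op_eqI)
    fix x y
    obtain p where p: "\<And>z. z \<in> S \<Longrightarrow> (p has_field_derivative cinner (h z x) y) (at z within S)"
      using holomorphic_convex_primitive'[OF S hol[of x y]] by metis
    have ev: "cinner (G a b x) y = p b - p a" if "a \<in> S" "b \<in> S" for a b
      using contour_integral_primitive[OF p valid_path_linepath, of a b] elem[OF that, of x y] seg[OF that]
      by (auto simp: path_image_def dest: has_contour_integral_unique)
    show "cinner ((G a b - G a c) x) y = cinner (G c b x) y"
      using abc by (simp add: blinfun.diff_left cinner_diff_left ev)
  qed
  show thesis
  proof (cases "S = {}")
    case False
    then obtain a where a: "a \<in> S" by blast
    show thesis
    proof (rule that[of "G a"])
      fix z assume z: "z \<in> S"
      show "(G a has_derivative (\<lambda>k. scaleC_op k (h z))) (at z)"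
        unfolding has_derivative_at_alt
      proof (intro conjI allI impI)
        show "bounded_linear (\<lambda>k. scaleC_op k (h z))"
          by (rule bounded_bilinear.bounded_linear_left[OF bounded_bilinear_scaleC_op])
        fix e :: real assume e: "e > 0"
        obtain d1 where d1: "d1 > 0" "ball z d1 \<subseteq> S" using S(2) z openE by blast
        obtain d2 where d2: "d2 > 0" "\<And>w. w \<in> S \<Longrightarrow> dist w z < d2 \<Longrightarrow> dist (h w) (h z) < e"
          using cont z e unfolding continuous_on_iff by meson
        show "\<exists>d>0. \<forall>w. norm (w - z) < d \<longrightarrow>
            norm (G a w - G a z - scaleC_op (w - z) (h z)) \<le> e * norm (w - z)"
        proof (intro exI conjI allI impI)
          show "0 < min d1 d2" using d1 d2 by simp
          fix w assume w: "norm (w - z) < min d1 d2"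
          then have wS: "w \<in> S" using d1 by (auto simp: dist_norm norm_minus_commute)
          have I: "((\<lambda>t. scaleC_op (w - z) (h (linepath z w t)) - scaleC_op (w - z) (h z)) has_integral
              (G z w - scaleC_op (w - z) (h z))) (cbox 0 1)"
            using has_integral_diff[OF int[OF z wS] has_integral_const_real[of "scaleC_op (w - z) (h z)" 0 1]]
            by simp
          have "norm (G z w - scaleC_op (w - z) (h z)) \<le> (e * norm (w - z)) * measure lborel (cbox 0 (1::real))"
          proof (rule has_integral_bound[OF _ I])
            fix t :: real assume t: "t \<in> cbox 0 1"
            have mem: "linepath z w t \<in> S" using seg[OF z wS] t by auto
            have "linepath z w t - z = of_real t * (w - z)"
              by (simp add: linepath_def scaleR_conv_of_real algebra_simps)
            then have "dist (linepath z w t) z \<le> norm (w - z)"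
              using t by (simp add: dist_norm norm_mult mult_left_le_one_le)
            then have "dist (h (linepath z w t)) (h z) < e" using d2 mem w by simp
            then have "norm (w - z) * norm (h (linepath z w t) - h z) \<le> norm (w - z) * e"
              by (intro mult_left_mono) (simp_all add: dist_norm)
            then show "norm (scaleC_op (w - z) (h (linepath z w t)) - scaleC_op (w - z) (h z)) \<le> e * norm (w - z)"
              using norm_scaleC_op[of "w - z" "h (linepath z w t) - h z"]
              by (simp add: bounded_bilinear.diff_right[OF bounded_bilinear_scaleC_op] mult.commute)
          qed (use e in simp)
          then show "norm (G a w - G a z - scaleC_op (w - z) (h z)) \<le> e * norm (w - z)"
            using G_diff[OF a wS z] by simp
        qed
      qed
    qed
  qed (use that in auto)
qed

text \<open>The derivative of a piecewise \<open>C\<^sup>1\<close> path may be unbounded near the exceptional parameters, so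
  continuity of the integrand does not settle integrability. As for scalar functions, it follows
  locally from the fundamental theorem of calculus applied to a primitive.\<close>

lemma op_contour_integrable:
  fixes h :: "complex \<Rightarrow> ('a :: chilbert_space \<Rightarrow>\<^sub>L 'a)"
  assumes "open S" and h: "op_holomorphic h S" and g: "valid_path \<gamma>" "path_image \<gamma> \<subseteq> S"
  shows "(\<lambda>t. scaleC_op (vector_derivative \<gamma> (at t within {0..1})) (h (\<gamma> t))) integrable_on {0..1}"
proof -
  let ?F = "\<lambda>t. scaleC_op (vector_derivative \<gamma> (at t within {0..1})) (h (\<gamma> t))"
  obtain X where cg: "continuous_on {0..1} \<gamma>" and X: "finite X" "\<gamma> C1_differentiable_on ({0..1} - X)"
    using g(1) by (auto simp: valid_path_def piecewise_C1_differentiable_on_def)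
  have "?F integrable_on cbox 0 1"
  proof (rule integrable_on_little_subintervals, intro ballI)
    fix t :: real assume t: "t \<in> cbox 0 1"
    then have "\<gamma> t \<in> S" using g(2) by (auto simp: path_image_def)
    then obtain e where e: "e > 0" "ball (\<gamma> t) e \<subseteq> S" using \<open>open S\<close> openE by blast
    obtain P where P: "\<And>z. z \<in> ball (\<gamma> t) e \<Longrightarrow> (P has_derivative (\<lambda>k. scaleC_op k (h z))) (at z)"
      using op_local_primitive[OF convex_ball open_ball op_holomorphic_subset[OF h e(2)]] by metis
    obtain d where d: "d > 0" "\<And>s. s \<in> {0..1} \<Longrightarrow> dist s t < d \<Longrightarrow> dist (\<gamma> s) (\<gamma> t) < e"
      using cg t e(1) unfolding continuous_on_iff by (metis box_real(2))
    show "\<exists>d>0. \<forall>u v. t \<in> cbox u v \<and> cbox u v \<subseteq> ball t d \<and> cbox u v \<subseteq> cbox 0 1 \<longrightarrow> ?F integrable_on cbox u v"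
    proof (intro exI conjI allI impI)
      show "d > 0" by fact
      fix u v assume uv: "t \<in> cbox u v \<and> cbox u v \<subseteq> ball t d \<and> cbox u v \<subseteq> cbox 0 1"
      then have "u \<le> v" by auto
      have mem: "\<gamma> s \<in> ball (\<gamma> t) e" if "s \<in> {u..v}" for s
        using d(2)[of s] uv that by (force simp: dist_commute)
      have sub: "{u..v} \<subseteq> {0..1}" using uv by auto
      have "(?F has_integral (P (\<gamma> v) - P (\<gamma> u))) {u..v}"
      proof (rule fundamental_theorem_of_calculus_interior_strong[OF X(1) \<open>u \<le> v\<close>, of "\<lambda>s. P (\<gamma> s)"])
        fix s assume s: "s \<in> {u<..<v} - X"
        then have s01: "0 < s" "s < 1" using sub \<open>u \<le> v\<close> by auto
        have "\<gamma> differentiable at s"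
          using X(2) s s01 by (auto simp: C1_differentiable_on_eq)
        then have vd: "(\<gamma> has_vector_derivative vector_derivative \<gamma> (at s)) (at s)"
          by (simp add: vector_derivative_works)
        then have eq: "vector_derivative \<gamma> (at s within {0..1}) = vector_derivative \<gamma> (at s)"
          using s01 by (intro vector_derivative_at_within_ivl) auto
        have "((\<lambda>s. P (\<gamma> s)) has_derivative (\<lambda>k. scaleC_op (k *\<^sub>R vector_derivative \<gamma> (at s)) (h (\<gamma> s)))) (at s)"
          using diff_chain_at[OF vd[unfolded has_vector_derivative_def] P[OF mem[of s]]] s
          by (simp add: o_def)
        then show "((\<lambda>s. P (\<gamma> s)) has_vector_derivative ?F s) (at s)"
          unfolding has_vector_derivative_def eq
          by (simp add: bounded_bilinear.scaleR_left[OF bounded_bilinear_scaleC_op])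
      next
        have "continuous_on (ball (\<gamma> t) e) P"
          by (meson P has_derivative_continuous continuous_at_imp_continuous_on)
        then show "continuous_on {u..v} (\<lambda>s. P (\<gamma> s))"
          by (rule continuous_on_compose2) (use mem cg sub in \<open>auto intro: continuous_on_subset\<close>)
      qed
      then show "?F integrable_on cbox u v" by auto
    qed
  qed
  then show ?thesis by simp
qed

lemma has_contour_integral_op:
  fixes h :: "complex \<Rightarrow> ('a :: chilbert_space \<Rightarrow>\<^sub>L 'a)"
  assumes "open S" "op_holomorphic h S" "valid_path \<gamma>" "path_image \<gamma> \<subseteq> S"
    and L: "bounded_linear L" "\<And>c T. L (scaleC_op c T) = c * L T"
  shows "((\<lambda>z. L (h z)) has_contour_integral L (op_contour_integral \<gamma> h)) \<gamma>"
  using has_integral_linear[OF integrable_integral[OF op_contour_integrable[OF assms(1-4)]] L(1)]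
  by (simp add: has_contour_integral_def op_contour_integral_def o_def L(2) mult.commute)

lemma op_contour_integral_element:
  fixes h :: "complex \<Rightarrow> ('a :: chilbert_space \<Rightarrow>\<^sub>L 'a)"
  assumes "open S" "op_holomorphic h S" "valid_path \<gamma>" "path_image \<gamma> \<subseteq> S"
  shows "cinner (op_contour_integral \<gamma> h x) y = contour_integral \<gamma> (\<lambda>z. cinner (h z x) y)"
  by (rule contour_integral_unique[symmetric],
      rule has_contour_integral_op[OF assms bounded_linear_matrix_element])
    (simp add: cinner_scaleC_left)

section \<open>Loops around the spectrum\<close>

definition C1_loop :: "(real \<Rightarrow> complex) \<Rightarrow> bool" where
  "C1_loop \<gamma> \<longleftrightarrow> (\<forall>t. \<gamma> differentiable at t) \<and>
     continuous_on UNIV (\<lambda>t. vector_derivative \<gamma> (at t)) \<and> pathfinish \<gamma> = pathstart \<gamma>"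

lemma C1_loop_valid:
  assumes "C1_loop \<gamma>"
  shows "valid_path \<gamma>" "pathfinish \<gamma> = pathstart \<gamma>" "path \<gamma>"
    "continuous_on {0..1} (\<lambda>t. vector_derivative \<gamma> (at t))" "continuous_on S \<gamma>"
proof -
  have "\<gamma> C1_differentiable_on {0..1}"
    using assms by (auto simp: C1_loop_def C1_differentiable_on_eq intro: continuous_on_subset)
  then show "valid_path \<gamma>" by (simp add: valid_path_def C1_differentiable_imp_piecewise)
  then show "path \<gamma>" by (rule valid_path_imp_path)
  show "pathfinish \<gamma> = pathstart \<gamma>" "continuous_on {0..1} (\<lambda>t. vector_derivative \<gamma> (at t))"
    using assms by (auto simp: C1_loop_def intro: continuous_on_subset)
  show "continuous_on S \<gamma>"
    using assms by (auto simp: C1_loop_def intro!: continuous_at_imp_continuous_on differentiable_imp_continuous_within)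
qed

lemma C1_loop_contour_integrable:
  assumes "C1_loop \<gamma>" "continuous_on (path_image \<gamma>) f"
  shows "f contour_integrable_on \<gamma>"
  unfolding contour_integrable_on
  by (intro integrable_continuous_interval continuous_intros C1_loop_valid[OF assms(1)]
      continuous_on_compose2[OF assms(2)]) (auto simp: path_image_def)

text \<open>Exchanging two contour integrals requires continuously differentiable paths, whereas the contour
  in the definition of the functional calculus is an arbitrary valid path.\<close>

lemma C1_approximation:
  assumes "open S" "valid_path \<gamma>" "pathfinish \<gamma> = pathstart \<gamma>" "path_image \<gamma> \<subseteq> S"
  obtains p where "C1_loop p" "path_image p \<subseteq> S"
    "\<And>f. f holomorphic_on S \<Longrightarrow> contour_integral p f = contour_integral \<gamma> f"
proof -
  have \<gamma>: "path \<gamma>" using assms by (simp add: valid_path_imp_path)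
  obtain d where "d > 0"
    and d: "\<And>g h. valid_path g \<and> valid_path h \<and> (\<forall>t\<in>{0..1}. norm (g t - \<gamma> t) < d \<and> norm (h t - \<gamma> t) < d) \<and>
             pathstart h = pathstart g \<and> pathfinish h = pathfinish g \<Longrightarrow>
             path_image g \<subseteq> S \<and> path_image h \<subseteq> S \<and>
             (\<forall>f. f holomorphic_on S \<longrightarrow> contour_integral h f = contour_integral g f)"
    using contour_integral_nearby_ends[OF assms(1) \<gamma> assms(4)] by metis
  obtain p where p: "polynomial_function p" "pathstart p = pathstart \<gamma>" "pathfinish p = pathfinish \<gamma>"
    "\<And>t. t \<in> {0..1} \<Longrightarrow> norm (p t - \<gamma> t) < d"
    using path_approx_polynomial_function[OF \<gamma> \<open>d > 0\<close>] by metis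
  obtain p' where p': "polynomial_function p'" "\<And>t. (p has_vector_derivative p' t) (at t)"
    using has_vector_derivative_polynomial_function[OF p(1)] by metis
  have "(\<lambda>t. vector_derivative p (at t)) = p'"
    using p'(2) by (auto intro: vector_derivative_at)
  then have "C1_loop p"
    using p p' assms(3) unfolding C1_loop_def
    by (metis continuous_on_polymonial_function differentiableI_vector)
  moreover have "path_image p \<subseteq> S \<and> (\<forall>f. f holomorphic_on S \<longrightarrow> contour_integral p f = contour_integral \<gamma> f)"
    using d[of \<gamma> p] p assms(2) \<open>d > 0\<close> valid_path_polynomial_function by auto
  ultimately show thesis using that by blast
qed

text \<open>For \<open>a\<close> in the spectrum, \<open>(z - A)\<^sup>-\<^sup>1 - (z - a)\<^sup>-\<^sup>1\<close> decays like \<open>z\<^sup>-\<^sup>2\<close>. Under the inversion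
  \<open>w = 1 / (z - a)\<close> its integral becomes that of a function \<open>g\<close> holomorphic also at \<open>w = 0\<close>, and the
  image of the contour has winding number \<open>1 - 1 = 0\<close> around each inverted point of the spectrum.
  The global Cauchy theorem then gives \<open>0\<close>.\<close>

lemma resolvent_loop_integral:
  fixes A :: "'a :: chilbert_space \<Rightarrow>\<^sub>L 'a"
  assumes cl: "clinear_op A" and ne: "spectrum A \<noteq> {}"
    and \<gamma>: "valid_path \<gamma>" "pathfinish \<gamma> = pathstart \<gamma>" "path_image \<gamma> \<inter> spectrum A = {}"
    and wn: "\<And>s. s \<in> spectrum A \<Longrightarrow> winding_number \<gamma> s = 1"
  shows "contour_integral \<gamma> (\<lambda>z. cinner (resolvent A z x) y) = 2 * of_real pi * \<i> * cinner x y"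
proof -
  obtain a where a: "a \<in> spectrum A" using ne by blast
  define b where "b = A x - a *\<^sub>C x"
  have a\<gamma>: "a \<notin> path_image \<gamma>" using a \<gamma>(3) by auto
  define U where "U = {w. w = 0 \<or> a + 1 / w \<notin> spectrum A}"
  define r where "r = 1 / (2 * (norm a + norm A) + 1)"
  have r: "r > 0" by (simp add: r_def add_nonneg_pos)
  have small: "norm A < norm (a + 1 / w) \<and> norm (1 / w) \<le> 2 * (norm (a + 1 / w) - norm A)"
    if "w \<noteq> 0" "norm w < r" for w
  proof -
    have "2 * (norm a + norm A) + 1 < 1 / norm w"
      using that r unfolding r_def by (simp add: field_simps)
    moreover have "norm (1 / w) - norm a \<le> norm (a + 1 / w)"
      using norm_diff_ineq[of "1 / w" a] by (simp add: add.commute)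
    moreover have "norm (1 / w) = 1 / norm w" by (simp add: norm_divide)
    ultimately show ?thesis by (smt (verit) norm_ge_zero)
  qed
  (* the point w = 0, which stands for z = infinity, is interior to U *)
  have U_eq: "U = ball 0 r \<union> {w \<in> - {0}. a + 1 / w \<in> - spectrum A}"
  proof -
    have "a + 1 / w \<notin> spectrum A" if "w \<noteq> 0" "norm w < r" for w
      using large_not_in_spectrum small[OF that] by blast
    then show ?thesis using r by (auto simp: U_def)
  qed
  have "continuous_on (- {0}) (\<lambda>w. a + 1 / w)" by (intro continuous_intros) auto
  then have "open {w \<in> - {0}. a + 1 / w \<in> - spectrum A}"
    using continuous_open_preimage[OF _ _ open_resolvent_set[of A], of "- {0}" "\<lambda>w. a + 1 / w"]
    by (simp add: vimage_def Int_def open_Compl)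
  then have openU: "open U" by (auto simp: U_eq)
  have U0: "0 \<in> U" by (simp add: U_def)
  have "(\<lambda>w. cinner (resolvent A (a + 1 / w) b) y / w) holomorphic_on U - {0}"
  proof (intro holomorphic_intros)
    have "((\<lambda>z. cinner (resolvent A z b) y) \<circ> (\<lambda>w. a + 1 / w)) holomorphic_on U - {0}"
      by (rule holomorphic_on_compose_gen[OF _ resolvent_matrix_element_holomorphic[OF cl]])
        (auto intro!: holomorphic_intros simp: U_def)
    then show "(\<lambda>w. cinner (resolvent A (a + 1 / w) b) y) holomorphic_on U - {0}" by (simp add: o_def)
  qed auto
  moreover have "\<exists>B. eventually (\<lambda>w. norm (cinner (resolvent A (a + 1 / w) b) y / w) \<le> B) (at 0)"
  proof (intro exI)
    have "norm (cinner (resolvent A (a + 1 / w) b) y / w) \<le> 2 * norm b * norm y"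
      if w: "w \<noteq> 0" "norm w < r" for w
    proof -
      define D where "D = norm (a + 1 / w) - norm A"
      have D: "D > 0" "norm (1 / w) \<le> 2 * D" using small[OF w] by (auto simp: D_def)
      have "norm (cinner (resolvent A (a + 1 / w) b) y) \<le> (1 / D) * norm b * norm y"
        unfolding D_def using small[OF w]
        by (intro order_trans[OF norm_matrix_element_le] mult_right_mono norm_resolvent_le_large) auto
      then have "norm (cinner (resolvent A (a + 1 / w) b) y) * norm (1 / w) \<le>
          ((1 / D) * norm b * norm y) * (2 * D)"
        using D by (intro mult_mono) auto
      also have "\<dots> = 2 * norm b * norm y" using D by simp
      finally show ?thesis by (simp add: norm_divide)
    qed
    then show "eventually (\<lambda>w. norm (cinner (resolvent A (a + 1 / w) b) y / w) \<le> 2 * norm b * norm y) (at 0)"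
      unfolding eventually_at by (intro exI[of _ r]) (use r in auto)
  qed
  ultimately obtain g where g: "g holomorphic_on U"
    "\<And>w. w \<in> U - {0} \<Longrightarrow> g w = cinner (resolvent A (a + 1 / w) b) y / w"
    using holomorphic_on_extend_bounded[of "\<lambda>w. cinner (resolvent A (a + 1 / w) b) y / w" U 0]
      openU U0 by (auto simp: interior_open)
  define \<phi> where "\<phi> = (\<lambda>z. 1 / (z - a))"
  have hol\<phi>: "\<phi> holomorphic_on - {a}" unfolding \<phi>_def by (intro holomorphic_intros) auto
  have im: "path_image \<gamma> \<subseteq> - {a}" using a\<gamma> by auto
  have deriv: "deriv \<phi> z = - (1 / (z - a)\<^sup>2)" if "z \<noteq> a" for z
  proof (rule DERIV_imp_deriv)
    show "(\<phi> has_field_derivative - (1 / (z - a)\<^sup>2)) (at z)"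
      unfolding \<phi>_def by (rule derivative_eq_intros refl | use that in \<open>simp add: power2_eq_square\<close>)+
  qed
  have subst: "contour_integral (\<phi> \<circ> \<gamma>) q = contour_integral \<gamma> (\<lambda>z. - (1 / (z - a)\<^sup>2) * q (\<phi> z))" for q
  proof -
    have "contour_integral (\<phi> \<circ> \<gamma>) q = contour_integral \<gamma> (\<lambda>z. deriv \<phi> z * q (\<phi> z))"
      by (rule contour_integral_comp_analyticW[OF _ \<gamma>(1) im])
        (use hol\<phi> in \<open>simp add: analytic_on_open open_Compl\<close>)
    also have "\<dots> = contour_integral \<gamma> (\<lambda>z. - (1 / (z - a)\<^sup>2) * q (\<phi> z))"
    proof (rule contour_integral_cong[OF refl])
      fix z assume "z \<in> path_image \<gamma>"
      then have "z \<noteq> a" using a\<gamma> by auto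
      from deriv[OF this] show "deriv \<phi> z * q (\<phi> z) = - (1 / (z - a)\<^sup>2) * q (\<phi> z)"
        by (simp only:)
    qed
    finally show ?thesis .
  qed
  have valid: "valid_path (\<phi> \<circ> \<gamma>)"
    by (rule valid_path_compose_holomorphic[OF \<gamma>(1) hol\<phi> _ im]) auto
  have pim: "path_image (\<phi> \<circ> \<gamma>) \<subseteq> U - {0}"
    using \<gamma>(3) a\<gamma> by (auto simp: path_image_def \<phi>_def U_def)
  have inv: "(\<lambda>z. 1 / (z - s)) contour_integrable_on \<gamma>" if "s \<in> spectrum A" for s
    using that \<gamma>(3) by (intro contour_integrable_inversediff[OF \<gamma>(1)]) auto
  have wnint: "contour_integral \<gamma> (\<lambda>z. 1 / (z - s)) = 2 * of_real pi * \<i>" if "s \<in> spectrum A" for s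
    using wn[OF that] winding_number_valid_path[OF \<gamma>(1), of s] that \<gamma>(3) by (auto simp: field_simps)
  have "(g has_contour_integral 0) (\<phi> \<circ> \<gamma>)"
  proof (rule Cauchy_theorem_global[OF openU g(1) valid])
    show "pathfinish (\<phi> \<circ> \<gamma>) = pathstart (\<phi> \<circ> \<gamma>)"
      using \<gamma>(2) by (simp add: pathfinish_compose pathstart_compose)
    show "path_image (\<phi> \<circ> \<gamma>) \<subseteq> U" using pim by auto
    fix w assume w: "w \<notin> U"
    define s where "s = a + 1 / w"
    have s: "w \<noteq> 0" "s \<in> spectrum A" using w by (auto simp: U_def s_def)
    have "contour_integral (\<phi> \<circ> \<gamma>) (\<lambda>v. 1 / (v - w)) =
        contour_integral \<gamma> (\<lambda>z. - (1 / (z - a)\<^sup>2) * (1 / (\<phi> z - w)))"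
      by (rule subst)
    also have "\<dots> = contour_integral \<gamma> (\<lambda>z. 1 / (z - s) - 1 / (z - a))"
    proof (rule contour_integral_cong[OF refl])
      fix z assume "z \<in> path_image \<gamma>"
      then have z: "z \<noteq> a" "z \<noteq> s" using a\<gamma> s \<gamma>(3) by auto
      have w_eq: "w = 1 / (s - a)" using s by (simp add: s_def)
      have sa: "s \<noteq> a" using s by (simp add: s_def)
      have "\<phi> z - w = (s - z) / ((z - a) * (s - a))"
        unfolding \<phi>_def w_eq using z sa by (simp add: divide_simps)
      then have "- (1 / (z - a)\<^sup>2) * (1 / (\<phi> z - w)) = - ((s - a) / ((z - a) * (s - z)))"
        using z sa by (simp add: power2_eq_square)
      also have "\<dots> = 1 / (z - s) - 1 / (z - a)"
        using z sa by (simp add: divide_simps) (simp add: algebra_simps)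
      finally show "- (1 / (z - a)\<^sup>2) * (1 / (\<phi> z - w)) = 1 / (z - s) - 1 / (z - a)" .
    qed
    also have "\<dots> = 0"
      using contour_integral_diff[OF inv[OF s(2)] inv[OF a]] wnint[OF s(2)] wnint[OF a] by simp
    finally show "winding_number (\<phi> \<circ> \<gamma>) w = 0"
      using winding_number_valid_path[OF valid, of w] pim w by auto
  qed
  then have zero: "contour_integral \<gamma> (\<lambda>z. - (1 / (z - a)\<^sup>2) * g (\<phi> z)) = 0"
    using subst[of g] by (simp add: contour_integral_unique)
  have "contour_integral \<gamma> (\<lambda>z. cinner (resolvent A z x) y) =
      contour_integral \<gamma> (\<lambda>z. cinner x y * (1 / (z - a)) - (- (1 / (z - a)\<^sup>2) * g (\<phi> z)))"
  proof (rule contour_integral_cong[OF refl])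
    fix z assume z: "z \<in> path_image \<gamma>"
    then have za: "z \<noteq> a" "z \<notin> spectrum A" using a\<gamma> \<gamma>(3) by auto
    have "\<phi> z \<in> U - {0}" using pim z by (auto simp: path_image_def)
    then have gz: "g (\<phi> z) = cinner (resolvent A z b) y * (z - a)"
      using g(2)[of "\<phi> z"] za by (simp add: \<phi>_def)
    have "resolvent A z b = resolvent A z ((z - a) *\<^sub>C x - (z *\<^sub>C x - A x))"
      by (simp add: b_def scaleC_diff_left)
    also have "\<dots> = (z - a) *\<^sub>C resolvent A z x - x"
      using clinear_resolvent[OF cl za(2)] resolvent_apply(2)[OF za(2), of x]
      unfolding blinfun.diff_right by (simp add: clinear_op_def blinfun.diff_right)
    finally have "cinner (resolvent A z b) y = (z - a) * cinner (resolvent A z x) y - cinner x y"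
      by (simp add: cinner_simps)
    then show "cinner (resolvent A z x) y = cinner x y * (1 / (z - a)) - (- (1 / (z - a)\<^sup>2) * g (\<phi> z))"
      using za by (simp add: gz divide_simps power2_eq_square)
  qed
  also have "\<dots> = cinner x y * (2 * of_real pi * \<i>) - 0"
  proof (subst contour_integral_diff)
    show "(\<lambda>z. cinner x y * (1 / (z - a))) contour_integrable_on \<gamma>"
      by (rule contour_integrable_lmul[OF inv[OF a]])
    show "(\<lambda>z. - (1 / (z - a)\<^sup>2) * g (\<phi> z)) contour_integrable_on \<gamma>"
    proof (rule contour_integrable_holomorphic_simple[OF _ _ \<gamma>(1)])
      show "open (- spectrum A \<inter> - {a})" by (intro open_Int open_resolvent_set) auto
      show "path_image \<gamma> \<subseteq> - spectrum A \<inter> - {a}" using a\<gamma> \<gamma>(3) by auto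
      have "(g \<circ> \<phi>) holomorphic_on (- spectrum A \<inter> - {a})"
        by (rule holomorphic_on_compose_gen[OF holomorphic_on_subset[OF hol\<phi>] g(1)])
          (auto simp: \<phi>_def U_def)
      then show "(\<lambda>z. - (1 / (z - a)\<^sup>2) * g (\<phi> z)) holomorphic_on (- spectrum A \<inter> - {a})"
        by (intro holomorphic_intros) (auto simp: o_def)
    qed
  qed (simp only: contour_integral_lmul[OF inv[OF a]] wnint[OF a] zero)
  finally show ?thesis by simp
qed

text \<open>After exchanging the integrals, \<open>(z - A)\<^sup>-\<^sup>1 / (w - z)\<close> is split by the resolvent identity into
  \<open>(w - A)\<^sup>-\<^sup>1 / (w - z) + (w - A)\<^sup>-\<^sup>1 (z - A)\<^sup>-\<^sup>1\<close>. With \<open>\<psi> = 1\<close> this evaluates the calculus on Cauchy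
  transforms and shows that it does not depend on the contour; with general \<open>\<psi>\<close> it gives
  multiplicativity.\<close>

lemma cauchy_transform_swap:
  fixes A :: "'a :: chilbert_space \<Rightarrow>\<^sub>L 'a"
  assumes cl: "clinear_op A" and \<gamma>: "C1_loop \<gamma>" and c: "C1_loop c"
    and S: "path_image \<gamma> \<subseteq> S" "open S" "\<psi> holomorphic_on S" "S \<inter> spectrum A = {}"
    and cs: "path_image c \<inter> spectrum A = {}" "path_image \<gamma> \<inter> path_image c = {}"
    and \<psi>: "\<And>w. w \<in> path_image c \<Longrightarrow> contour_integral \<gamma> (\<lambda>z. \<psi> z / (w - z)) = 0"
    and \<phi>: "continuous_on (path_image c) \<phi>"
  shows "contour_integral \<gamma> (\<lambda>z. \<psi> z * contour_integral c (\<lambda>w. \<phi> w / (w - z)) * cinner (resolvent A z x) y) =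
    contour_integral c (\<lambda>w. \<phi> w * cinner (resolvent A w
      (op_contour_integral \<gamma> (\<lambda>z. scaleC_op (\<psi> z) (resolvent A z)) x)) y)"
proof -
  define J where "J = op_contour_integral \<gamma> (\<lambda>z. scaleC_op (\<psi> z) (resolvent A z))"
  note v = C1_loop_valid[OF \<gamma>] C1_loop_valid[OF c]
  have hol: "op_holomorphic (\<lambda>z. scaleC_op (\<psi> z) (resolvent A z)) S"
    using S by (intro op_holomorphic_scaleC op_holomorphic_subset[OF op_holomorphic_resolvent[OF cl]]) auto
  have cont\<psi>: "continuous_on (path_image \<gamma>) \<psi>"
    using S by (meson continuous_on_subset holomorphic_on_imp_continuous_on)
  have contR: "continuous_on (path_image \<gamma>) (\<lambda>z. cinner (resolvent A z x) y)" for x y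
    by (rule continuous_on_subset[OF holomorphic_on_imp_continuous_on[OF
          resolvent_matrix_element_holomorphic[OF cl]]]) (use S in auto)
  have ne: "z \<noteq> w" if "z \<in> path_image \<gamma>" "w \<in> path_image c" for z w
    using that cs by auto
  have "contour_integral \<gamma> (\<lambda>z. \<psi> z * contour_integral c (\<lambda>w. \<phi> w / (w - z)) * cinner (resolvent A z x) y) =
      contour_integral \<gamma> (\<lambda>z. contour_integral c (\<lambda>w. \<psi> z * cinner (resolvent A z x) y * (\<phi> w / (w - z))))"
  proof (rule contour_integral_cong[OF refl])
    fix z assume z: "z \<in> path_image \<gamma>"
    have "(\<lambda>w. \<phi> w / (w - z)) contour_integrable_on c"
      using ne[OF z] by (intro C1_loop_contour_integrable[OF c] continuous_intros \<phi>) auto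
    from contour_integral_lmul[OF this, of "\<psi> z * cinner (resolvent A z x) y"]
    show "\<psi> z * contour_integral c (\<lambda>w. \<phi> w / (w - z)) * cinner (resolvent A z x) y =
        contour_integral c (\<lambda>w. \<psi> z * cinner (resolvent A z x) y * (\<phi> w / (w - z)))"
      by (simp only: mult_ac(2,3) mult.commute[of "contour_integral c (\<lambda>w. \<phi> w / (w - z))"])
  qed
  also have "\<dots> = contour_integral c (\<lambda>w. contour_integral \<gamma>
      (\<lambda>z. \<psi> z * cinner (resolvent A z x) y * (\<phi> w / (w - z))))"
  proof (rule contour_integral_swap)
    have 1: "continuous_on (path_image \<gamma> \<times> path_image c) (\<lambda>q. h (fst q))"
      if "continuous_on (path_image \<gamma>) h" for h :: "complex \<Rightarrow> complex"
      by (rule continuous_on_compose2[OF that]) (auto intro: continuous_intros)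
    have 2: "continuous_on (path_image \<gamma> \<times> path_image c) (\<lambda>q. \<phi> (snd q))"
      by (rule continuous_on_compose2[OF \<phi>]) (auto intro: continuous_intros)
    show "continuous_on (path_image \<gamma> \<times> path_image c)
        (\<lambda>(z, w). \<psi> z * cinner (resolvent A z x) y * (\<phi> w / (w - z)))"
      unfolding case_prod_beta using ne
      by (intro continuous_intros 1[OF cont\<psi>] 1[OF contR] 2) force
  qed (use v in auto)
  also have "\<dots> = contour_integral c (\<lambda>w. \<phi> w * cinner (resolvent A w (J x)) y)"
  proof (rule contour_integral_cong[OF refl])
    fix w assume w: "w \<in> path_image c"
    then have wA: "w \<notin> spectrum A" using cs by auto
    have "contour_integral \<gamma> (\<lambda>z. \<psi> z * cinner (resolvent A z x) y * (\<phi> w / (w - z))) =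
      contour_integral \<gamma> (\<lambda>z. (\<phi> w * cinner (resolvent A w x) y) * (\<psi> z / (w - z)) +
        \<phi> w * (\<psi> z * cinner (resolvent A w (resolvent A z x)) y))"
    proof (rule contour_integral_cong[OF refl])
      fix z assume z: "z \<in> path_image \<gamma>"
      then have zA: "z \<notin> spectrum A" using S by auto
      have wz: "w - z \<noteq> 0" using ne[OF z w] by auto
      have "cinner (resolvent A w x) y - cinner (resolvent A z x) y =
          (z - w) * cinner (resolvent A w (resolvent A z x)) y"
        using resolvent_identity[OF cl wA zA, of x] by (simp flip: cinner_diff_left cinner_scaleC_left)
      then have e: "cinner (resolvent A z x) y =
          cinner (resolvent A w x) y + (w - z) * cinner (resolvent A w (resolvent A z x)) y"
        by (simp add: algebra_simps)
      then show "\<psi> z * cinner (resolvent A z x) y * (\<phi> w / (w - z)) =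
          (\<phi> w * cinner (resolvent A w x) y) * (\<psi> z / (w - z)) +
          \<phi> w * (\<psi> z * cinner (resolvent A w (resolvent A z x)) y)"
        unfolding e using wz by (simp add: field_simps)
    qed
    also have "\<dots> = \<phi> w * cinner (resolvent A w (J x)) y"
    proof -
      have clw: "clinear_op (resolvent A w)" by (rule clinear_resolvent[OF cl wA])
      have i1: "(\<lambda>z. \<psi> z / (w - z)) contour_integrable_on \<gamma>"
        using ne[OF _ w] by (intro C1_loop_contour_integrable[OF \<gamma>] continuous_intros cont\<psi>) auto
      have L: "bounded_linear (\<lambda>T :: 'a \<Rightarrow>\<^sub>L 'a. cinner (resolvent A w (T x)) y)"
        using bounded_linear_compose[OF bounded_linear_cinner_left[of y]
            bounded_linear_compose[OF blinfun.bounded_linear_right blinfun.bounded_linear_left]] .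
      have "((\<lambda>z. cinner (resolvent A w (scaleC_op (\<psi> z) (resolvent A z) x)) y) has_contour_integral
          cinner (resolvent A w (J x)) y) \<gamma>"
        unfolding J_def
        by (rule has_contour_integral_op[OF S(2) hol v(1) S(1) L])
          (use clw in \<open>simp add: clinear_op_def cinner_scaleC_left\<close>)
      then have i2: "((\<lambda>z. \<psi> z * cinner (resolvent A w (resolvent A z x)) y) has_contour_integral
          cinner (resolvent A w (J x)) y) \<gamma>"
        using clw by (simp add: clinear_op_def cinner_scaleC_left)
      have "((\<lambda>z. \<psi> z / (w - z)) has_contour_integral 0) \<gamma>"
        using has_contour_integral_integral[OF i1] \<psi>[OF w] by simp
      then show ?thesis
        using contour_integral_unique[OF has_contour_integral_add[OF has_contour_integral_lmul
            has_contour_integral_lmul[OF i2]]] by force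
    qed
    finally show "contour_integral \<gamma> (\<lambda>z. \<psi> z * cinner (resolvent A z x) y * (\<phi> w / (w - z))) =
        \<phi> w * cinner (resolvent A w (J x)) y" .
  qed
  finally show ?thesis unfolding J_def .
qed

section \<open>Cauchy transforms and the functional calculus\<close>

text \<open>For \<open>\<phi> = cnj f\<close> on the boundary of \<open>\<Omega>\<close> this is the function \<open>g\<close> of Crouzeix and Palencia.\<close>

definition cauchy_transform :: "(real \<Rightarrow> complex) \<Rightarrow> (complex \<Rightarrow> complex) \<Rightarrow> complex \<Rightarrow> complex" where
  "cauchy_transform c \<phi> z = contour_integral c (\<lambda>w. \<phi> w / (w - z)) / (2 * of_real pi * \<i>)"

lemma cauchy_transform_holomorphic:
  assumes c: "C1_loop c" and \<phi>: "continuous_on (path_image c) \<phi>"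
    and S: "open S" "S \<inter> path_image c = {}"
  shows "cauchy_transform c \<phi> holomorphic_on S"
proof -
  have "bounded ((\<lambda>t. vector_derivative c (at t)) ` {0..1})"
    by (intro compact_imp_bounded compact_continuous_image C1_loop_valid[OF c]) auto
  then obtain B where B: "\<And>t. t \<in> {0..1} \<Longrightarrow> norm (vector_derivative c (at t)) \<le> B"
    by (auto simp: bounded_iff simp del: atLeastAtMost_iff)
  have int: "((\<lambda>u. \<phi> u / (u - w) ^ 1) has_contour_integral contour_integral c (\<lambda>u. \<phi> u / (u - w))) c"
    if "w \<in> S - path_image c" for w
    using that
    by (simp, intro has_contour_integral_integral C1_loop_contour_integrable[OF c] continuous_intros \<phi>) auto
  have "(\<lambda>z. contour_integral c (\<lambda>w. \<phi> w / (w - z))) holomorphic_on S"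
    unfolding holomorphic_on_open[OF S(1)]
  proof (intro ballI exI)
    fix w assume "w \<in> S"
    then have "w \<in> S - path_image c" using S by auto
    from Cauchy_next_derivative(2)[OF \<phi> B int _ S(1) C1_loop_valid(1)[OF c] this]
    show "((\<lambda>z. contour_integral c (\<lambda>w. \<phi> w / (w - z))) has_field_derivative
        (of_nat 1 * contour_integral c (\<lambda>u. \<phi> u / (u - w) ^ Suc 1))) (at w)" by simp
  qed
  then show ?thesis
    unfolding cauchy_transform_def by (intro holomorphic_intros) auto
qed

lemma calculus_of_cauchy_transform:
  fixes A :: "'a :: chilbert_space \<Rightarrow>\<^sub>L 'a"
  assumes cl: "clinear_op A" and ne: "spectrum A \<noteq> {}" and c: "C1_loop c"
    and D: "open D" "convex D" "D \<inter> path_image c = {}" "spectrum A \<subseteq> D"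
    and \<gamma>: "valid_path \<gamma>" "pathfinish \<gamma> = pathstart \<gamma>" "path_image \<gamma> \<subseteq> D - spectrum A"
    and wn: "\<And>s. s \<in> spectrum A \<Longrightarrow> winding_number \<gamma> s = 1"
    and \<phi>: "continuous_on (path_image c) \<phi>"
  shows "contour_integral \<gamma> (\<lambda>z. cauchy_transform c \<phi> z * cinner (resolvent A z x) y) =
    contour_integral c (\<lambda>w. \<phi> w * cinner (resolvent A w x) y)"
proof -
  let ?S = "D - spectrum A"
  have openS: "open ?S"
    using open_Int[OF D(1) open_resolvent_set[of A]] by (simp add: Diff_eq)
  obtain q where q: "C1_loop q" "path_image q \<subseteq> ?S"
    "\<And>f. f holomorphic_on ?S \<Longrightarrow> contour_integral q f = contour_integral \<gamma> f"
    using C1_approximation[OF openS \<gamma>] by metis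
  note vq = C1_loop_valid[OF q(1)]
  have wnq: "winding_number q s = 1" if s: "s \<in> spectrum A" for s
  proof -
    have "(\<lambda>z. 1 / (z - s)) holomorphic_on ?S" using s by (intro holomorphic_intros) auto
    moreover have "s \<notin> path_image q" "s \<notin> path_image \<gamma>" using q \<gamma> s by auto
    ultimately show ?thesis
      using wn[OF s] by (simp add: winding_number_valid_path vq \<gamma> q(3))
  qed
  have disj: "path_image q \<inter> spectrum A = {}" "path_image q \<inter> path_image c = {}"
    "path_image c \<inter> spectrum A = {}"
    using q(2) D by auto
  have holR: "(\<lambda>z. cinner (resolvent A z x) y) holomorphic_on ?S" for x y
    by (rule holomorphic_on_subset[OF resolvent_matrix_element_holomorphic[OF cl]]) auto
  have holT: "cauchy_transform c \<phi> holomorphic_on ?S"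
    by (rule cauchy_transform_holomorphic[OF c \<phi> openS]) (use D in auto)
  define J where "J = op_contour_integral q (\<lambda>z. scaleC_op 1 (resolvent A z))"
  have one: "scaleC_op 1 T = T" for T :: "'a \<Rightarrow>\<^sub>L 'a" by (rule blinfun_eqI) simp
  have J: "J x = (2 * of_real pi * \<i>) *\<^sub>C x" for x
  proof (rule cinner_eqI)
    fix y
    have "cinner (J x) y = contour_integral q (\<lambda>z. cinner (resolvent A z x) y)"
      unfolding J_def one
      by (rule op_contour_integral_element[OF openS _ vq(1) q(2)])
        (rule op_holomorphic_subset[OF op_holomorphic_resolvent[OF cl]], auto)
    also have "\<dots> = 2 * of_real pi * \<i> * cinner x y"
      by (rule resolvent_loop_integral[OF cl ne vq(1,2) disj(1) wnq])
    finally show "cinner (J x) y = cinner ((2 * of_real pi * \<i>) *\<^sub>C x) y"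
      by (simp add: cinner_scaleC_left)
  qed
  have zero: "contour_integral q (\<lambda>z. 1 / (w - z)) = 0" if w: "w \<in> path_image c" for w
  proof -
    have "(\<lambda>z. 1 / (w - z)) holomorphic_on D" using w D(3) by (intro holomorphic_intros) auto
    from Cauchy_theorem_convex_simple[OF this D(2) vq(1) _ vq(2)] show ?thesis
      using q(2) by (auto intro: contour_integral_unique)
  qed
  have "contour_integral \<gamma> (\<lambda>z. cauchy_transform c \<phi> z * cinner (resolvent A z x) y) =
      contour_integral q (\<lambda>z. cauchy_transform c \<phi> z * cinner (resolvent A z x) y)"
    by (rule q(3)[symmetric]) (intro holomorphic_intros holT holR)
  also have "\<dots> = contour_integral q (\<lambda>z. (1 / (2 * of_real pi * \<i>)) *
      (1 * contour_integral c (\<lambda>w. \<phi> w / (w - z)) * cinner (resolvent A z x) y))"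
    by (simp add: cauchy_transform_def)
  also have "\<dots> = (1 / (2 * of_real pi * \<i>)) *
      contour_integral q (\<lambda>z. 1 * contour_integral c (\<lambda>w. \<phi> w / (w - z)) * cinner (resolvent A z x) y)"
  proof (rule contour_integral_lmul)
    have "(\<lambda>z. (2 * of_real pi * \<i>) * cauchy_transform c \<phi> z * cinner (resolvent A z x) y) contour_integrable_on q"
      by (rule contour_integrable_holomorphic_simple[OF _ openS vq(1) q(2)])
        (intro holomorphic_intros holT holR)
    then show "(\<lambda>z. 1 * contour_integral c (\<lambda>w. \<phi> w / (w - z)) * cinner (resolvent A z x) y) contour_integrable_on q"
      by (simp add: cauchy_transform_def)
  qed
  also have "contour_integral q (\<lambda>z. 1 * contour_integral c (\<lambda>w. \<phi> w / (w - z)) * cinner (resolvent A z x) y) =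
      contour_integral c (\<lambda>w. \<phi> w * cinner (resolvent A w (J x)) y)"
    unfolding J_def
    by (rule cauchy_transform_swap[OF cl q(1) c q(2) openS _ _ disj(3) disj(2) _ \<phi>])
      (use zero in auto)
  also have "\<dots> = contour_integral c (\<lambda>w. (2 * of_real pi * \<i>) * (\<phi> w * cinner (resolvent A w x) y))"
  proof (rule contour_integral_cong[OF refl])
    fix w assume "w \<in> path_image c"
    then have "clinear_op (resolvent A w)" using disj by (intro clinear_resolvent[OF cl]) auto
    then show "\<phi> w * cinner (resolvent A w (J x)) y =
        (2 * of_real pi * \<i>) * (\<phi> w * cinner (resolvent A w x) y)"
      by (simp add: J clinear_op_def cinner_scaleC_left)
  qed
  also have "\<dots> = (2 * of_real pi * \<i>) * contour_integral c (\<lambda>w. \<phi> w * cinner (resolvent A w x) y)"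
  proof (rule contour_integral_lmul[OF C1_loop_contour_integrable[OF c]])
    show "continuous_on (path_image c) (\<lambda>w. \<phi> w * cinner (resolvent A w x) y)"
      by (intro continuous_intros \<phi> continuous_on_subset[OF holomorphic_on_imp_continuous_on[OF
          resolvent_matrix_element_holomorphic[OF cl]]]) (use disj in auto)
  qed
  finally show ?thesis by simp
qed


section \<open>Convex domains bounded by a regular curve\<close>

text \<open>The last assumption says that \<open>c\<close> runs counterclockwise: each point of \<open>\<Omega>\<close> lies strictly to
  the left of each oriented tangent. Both positivity statements rest on it. The point \<open>p\<close> is a
  centre for dilations.\<close>

locale convex_boundary =
  fixes \<Omega> :: "complex set" and c :: "real \<Rightarrow> complex" and p :: complex
  assumes open_dom: "open \<Omega>" and convex_dom: "convex \<Omega>" and bounded_dom: "bounded \<Omega>"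
    and p_in: "p \<in> \<Omega>"
    and loop: "C1_loop c"
    and periodic: "c (t + 1) = c t"
    and inj: "inj_on c {0..<1}"
    and image: "path_image c = frontier \<Omega>"
    and winding: "z \<in> \<Omega> \<Longrightarrow> winding_number c z = 1"
    and turning: "z \<in> \<Omega> \<Longrightarrow> 0 < Im (vector_derivative c (at t) * cnj (c t - z))"
begin

definition dil :: "real \<Rightarrow> complex \<Rightarrow> complex" where
  "dil r z = p + of_real r * (z - p)"

definition inner_dom :: "real \<Rightarrow> complex set" where
  "inner_dom r = {z. dil (1 / r) z \<in> \<Omega>}"

lemma dil_dil: "dil r (dil s z) = dil (r * s) z"
  by (simp add: dil_def)

lemma dil_one [simp]: "dil 1 z = z"
  by (simp add: dil_def)

lemma continuous_on_dil [continuous_intros]: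
  "continuous_on S f \<Longrightarrow> continuous_on S (\<lambda>x. dil r (f x))"
  unfolding dil_def by (intro continuous_intros)

lemma dil_holomorphic: "dil r holomorphic_on S"
  unfolding dil_def by (intro holomorphic_intros)

lemma dil_closure:
  assumes "z \<in> closure \<Omega>" "0 \<le> r" "r < 1"
  shows "dil r z \<in> \<Omega>"
proof -
  have "z - (1 - r) *\<^sub>R (z - p) \<in> interior \<Omega>"
    by (rule mem_interior_closure_convex_shrink[OF convex_dom])
      (use assms p_in open_dom in \<open>auto simp: interior_open\<close>)
  then show ?thesis
    using open_dom by (simp add: interior_open dil_def scaleR_conv_of_real algebra_simps)
qed

lemma dil_mem: "z \<in> \<Omega> \<Longrightarrow> 0 \<le> r \<Longrightarrow> r \<le> 1 \<Longrightarrow> dil r z \<in> \<Omega>"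
  using dil_closure[of z r] closure_subset by (cases "r = 1") auto

lemma open_inner_dom: "open (inner_dom r)"
  using open_vimage[OF open_dom, of "dil (1 / r)"]
  by (simp add: inner_dom_def vimage_def continuous_on_dil)

lemma convex_inner_dom: "convex (inner_dom r)"
proof (rule convexI)
  fix x y :: complex and u v :: real
  assume "x \<in> inner_dom r" "y \<in> inner_dom r" and uv: "0 \<le> u" "0 \<le> v" "u + v = 1"
  then have "u *\<^sub>R dil (1 / r) x + v *\<^sub>R dil (1 / r) y \<in> \<Omega>"
    by (intro convexD[OF convex_dom]) (auto simp: inner_dom_def)
  moreover have "u *\<^sub>R dil (1 / r) x + v *\<^sub>R dil (1 / r) y =
      of_real (u + v) * (p - of_real (1 / r) * p) + of_real (1 / r) * (u *\<^sub>R x + v *\<^sub>R y)"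
    by (simp only: dil_def scaleR_conv_of_real of_real_add)
      (simp add: algebra_simps diff_divide_distrib)
  moreover have "\<dots> = dil (1 / r) (u *\<^sub>R x + v *\<^sub>R y)"
    unfolding uv by (simp add: dil_def algebra_simps)
  ultimately show "u *\<^sub>R x + v *\<^sub>R y \<in> inner_dom r" by (simp add: inner_dom_def)
qed

lemma inner_dom_subset: "0 < r \<Longrightarrow> r \<le> 1 \<Longrightarrow> inner_dom r \<subseteq> \<Omega>"
  using dil_mem[of "dil (1 / r) _" r] by (auto simp: inner_dom_def dil_dil)

lemma loop_dil:
  shows "C1_loop (dil r \<circ> c)"
    and "vector_derivative (dil r \<circ> c) (at t) = of_real r * vector_derivative c (at t)"
proof -
  have "(c has_vector_derivative vector_derivative c (at t)) (at t)" for t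
    using loop by (simp add: C1_loop_def vector_derivative_works)
  then have d: "((dil r \<circ> c) has_vector_derivative of_real r * vector_derivative c (at t)) (at t)" for t
    unfolding o_def dil_def by (auto intro!: derivative_eq_intros)
  then have eq: "vector_derivative (dil r \<circ> c) (at t) = of_real r * vector_derivative c (at t)" for t
    by (rule vector_derivative_at)
  show "vector_derivative (dil r \<circ> c) (at t) = of_real r * vector_derivative c (at t)" by (rule eq)
  show "C1_loop (dil r \<circ> c)"
    unfolding C1_loop_def eq
  proof (intro conjI allI)
    show "(dil r \<circ> c) differentiable at t" for t using d by (rule differentiableI_vector)
    show "continuous_on UNIV (\<lambda>t. of_real r * vector_derivative c (at t))"
      using loop by (intro continuous_intros) (simp add: C1_loop_def)
    show "pathfinish (dil r \<circ> c) = pathstart (dil r \<circ> c)"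
      using C1_loop_valid(2)[OF loop] by (simp add: pathfinish_compose pathstart_compose)
  qed
qed

lemma image_dil: "path_image (dil r \<circ> c) = dil r ` frontier \<Omega>"
  by (simp add: path_image_compose image)

lemma frontier_not_in: "z \<in> frontier \<Omega> \<Longrightarrow> z \<notin> \<Omega>"
  using open_dom by (simp add: frontier_def interior_open)

lemma image_dil_subset: "0 < r \<Longrightarrow> r < 1 \<Longrightarrow> path_image (dil r \<circ> c) \<subseteq> \<Omega>"
  using dil_closure by (auto simp: image_dil frontier_def)

lemma image_dil_disjoint: "0 < r \<Longrightarrow> inner_dom r \<inter> path_image (dil r \<circ> c) = {}"
  using frontier_not_in by (auto simp: image_dil inner_dom_def dil_dil)

lemma image_dil_inner: "0 < r \<Longrightarrow> r < s \<Longrightarrow> path_image (dil r \<circ> c) \<subseteq> inner_dom s"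
  using dil_closure[of _ "r / s"] by (auto simp: image_dil inner_dom_def dil_dil frontier_def)

lemma inner_dom_mono: "0 < r \<Longrightarrow> r \<le> s \<Longrightarrow> inner_dom r \<subseteq> inner_dom s"
proof
  fix z assume "0 < r" "r \<le> s" "z \<in> inner_dom r"
  then have "dil (r / s) (dil (1 / r) z) \<in> \<Omega>"
    by (rule_tac dil_mem) (auto simp: inner_dom_def divide_simps)
  then show "z \<in> inner_dom s" using \<open>0 < r\<close> by (simp add: inner_dom_def dil_dil)
qed

lemma winding_dil:
  assumes "0 < r" "z \<in> inner_dom r"
  shows "winding_number (dil r \<circ> c) z = 1"
proof -
  define u where "u = dil (1 / r) z"
  have u: "u \<in> \<Omega>" "z = dil r u" using assms by (auto simp: u_def inner_dom_def dil_dil)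
  have nz: "z \<notin> path_image (dil r \<circ> c)" using image_dil_disjoint assms by auto
  have nu: "u \<notin> path_image c" using u image frontier_not_in by auto
  have "contour_integral (dil r \<circ> c) (\<lambda>w. 1 / (w - z)) = contour_integral c (\<lambda>w. 1 / (w - u))"
    unfolding contour_integral_integral loop_dil(2)
  proof (rule integral_cong)
    fix t
    have "(dil r \<circ> c) t - z = of_real r * (c t - u)"
      by (simp add: u(2) dil_def algebra_simps)
    then show "1 / ((dil r \<circ> c) t - z) * (of_real r * vector_derivative c (at t)) =
        1 / (c t - u) * vector_derivative c (at t)"
      using assms(1) by simp
  qed
  then show ?thesis
    using winding[OF u(1)] nz nu C1_loop_valid(1)[OF loop] C1_loop_valid(1)[OF loop_dil(1)]
    by (simp add: winding_number_valid_path)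
qed

lemma compact_subset_inner:
  assumes "compact K" "K \<subseteq> \<Omega>"
  obtains r where "0 < r" "r < 1" "K \<subseteq> inner_dom r"
proof -
  obtain e where e: "e > 0" "(\<Union>x\<in>K. cball x e) \<subseteq> \<Omega>"
    using compact_subset_open_imp_cball_epsilon_subset[OF assms(1) open_dom assms(2)] by metis
  obtain B where B: "B > 0" "\<And>z. z \<in> K \<Longrightarrow> norm (z - p) \<le> B"
    using compact_imp_bounded[OF compact_translation_subtract[OF assms(1), of p]]
    by (auto simp: bounded_pos)
  define r where "r = B / (B + e)"
  have r: "0 < r" "r < 1" using B e by (auto simp: r_def)
  have "K \<subseteq> inner_dom r"
  proof
    fix z assume z: "z \<in> K"
    have "1 / r - 1 = e / B" using B e by (simp add: r_def field_simps)
    moreover have "dil (1 / r) z - z = of_real (1 / r - 1) * (z - p)"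
      by (simp add: dil_def algebra_simps)
    ultimately have "norm (dil (1 / r) z - z) = e / B * norm (z - p)"
      using e B by (simp only: norm_mult norm_of_real) simp
    also have "\<dots> \<le> e / B * B" using B z e by (intro mult_left_mono) auto
    finally have "dil (1 / r) z \<in> cball z e" using B by (simp add: dist_norm norm_minus_commute)
    then have "dil (1 / r) z \<in> \<Omega>" using e(2) z by blast
    then show "z \<in> inner_dom r" by (simp add: inner_dom_def)
  qed
  with r show thesis using that by blast
qed

lemma winding_outside:
  assumes "path_image \<gamma> \<subseteq> \<Omega>" "valid_path \<gamma>" "pathfinish \<gamma> = pathstart \<gamma>" "z \<notin> \<Omega>"
  shows "winding_number \<gamma> z = 0"
  using winding_number_zero_outside[OF valid_path_imp_path convex_dom] assms by auto

lemma cauchy_formula_inner: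
  assumes "f holomorphic_on \<Omega>" "0 < r" "r < 1" "z \<in> inner_dom r"
  shows "cauchy_transform (dil r \<circ> c) f z = f z"
proof -
  have "path_image (dil r \<circ> c) \<subseteq> \<Omega> - {z}" "z \<in> interior \<Omega>"
    using image_dil_subset[OF assms(2,3)] image_dil_disjoint[OF assms(2)] assms inner_dom_subset[of r]
      open_dom by (auto simp: interior_open)
  from Cauchy_integral_formula_convex_simple[OF convex_dom assms(1) this(2)
      C1_loop_valid(1)[OF loop_dil(1)] this(1) C1_loop_valid(2)[OF loop_dil(1)]]
  have "((\<lambda>w. f w / (w - z)) has_contour_integral
      (2 * of_real pi * \<i> * winding_number (dil r \<circ> c) z * f z)) (dil r \<circ> c)"
    by simp
  then show ?thesis
    using winding_dil[OF assms(2,4)] by (simp add: cauchy_transform_def contour_integral_unique)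
qed

lemma cauchy_formula_boundary:
  assumes "f holomorphic_on \<Omega>" "continuous_on (closure \<Omega>) f" "z \<in> \<Omega>"
  shows "cauchy_transform c f z = f z"
proof -
  have int: "interior (closure \<Omega>) = \<Omega>"
    using convex_interior_closure[OF convex_dom] open_dom by (simp add: interior_open)
  have "f field_differentiable at x" if "x \<in> interior (closure \<Omega>) - {}" for x
    using that assms(1) open_dom by (simp add: int holomorphic_on_imp_differentiable_at)
  moreover have "path_image c \<subseteq> closure \<Omega> - {z}"
    using image frontier_not_in assms(3) by (auto simp: frontier_def)
  ultimately have "((\<lambda>w. f w / (w - z)) has_contour_integral
      (2 * of_real pi * \<i> * winding_number c z * f z)) c"
    using Cauchy_integral_formula_weak[OF convex_closure[OF convex_dom] finite.emptyI assms(2), of z c]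
      assms(3) C1_loop_valid[OF loop] by (simp add: int)
  then show ?thesis
    using winding[OF assms(3)] by (simp add: cauchy_transform_def contour_integral_unique)
qed

end


section \<open>The functional calculus as an algebra homomorphism\<close>

lemma C1_loop_contour_bound:
  assumes "C1_loop \<gamma>" "continuous_on (path_image \<gamma>) f" and "0 \<le> M"
    and B: "\<And>t. t \<in> {0..1} \<Longrightarrow> norm (vector_derivative \<gamma> (at t)) \<le> B"
    and M: "\<And>z. z \<in> path_image \<gamma> \<Longrightarrow> norm (f z) \<le> M"
  shows "norm (contour_integral \<gamma> f) \<le> M * B"
proof -
  have "0 \<le> B" using order_trans[OF norm_ge_zero B[of 0]] by simp
  have "((\<lambda>t. f (\<gamma> t) * vector_derivative \<gamma> (at t)) has_integral contour_integral \<gamma> f) (cbox 0 1)"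
    using has_contour_integral_integral[OF C1_loop_contour_integrable[OF assms(1,2)]]
    by (simp add: has_contour_integral)
  then have "norm (contour_integral \<gamma> f) \<le> (M * B) * measure lborel (cbox 0 (1::real))"
  proof (rule has_integral_bound[rotated])
    fix t :: real assume "t \<in> cbox 0 1"
    then show "norm (f (\<gamma> t) * vector_derivative \<gamma> (at t)) \<le> M * B"
      unfolding norm_mult using \<open>0 \<le> M\<close> by (intro mult_mono B M) (auto simp: path_image_def)
  qed (use \<open>0 \<le> B\<close> \<open>0 \<le> M\<close> in simp)
  then show ?thesis by simp
qed

lemma compact_spectrum:
  fixes A :: "'a :: chilbert_space \<Rightarrow>\<^sub>L 'a"
  shows "compact (spectrum A)"
proof -
  have "bounded (spectrum A)"
    using large_not_in_spectrum[of A] by (intro boundedI[of _ "norm A"]) (meson not_le)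
  moreover have "closed (spectrum A)"
    using open_resolvent_set[of A] by (simp add: closed_def)
  ultimately show ?thesis by (simp add: compact_eq_bounded_closed)
qed

locale operator_in_domain = convex_boundary \<Omega> c p
  for \<Omega> c p +
  fixes A :: "'a :: chilbert_space \<Rightarrow>\<^sub>L 'a"
  assumes clinear: "clinear_op A" and spectrum_ne: "spectrum A \<noteq> {}"
    and spectrum_in: "spectrum A \<subseteq> \<Omega>" and numrange_in: "numerical_range A \<subseteq> \<Omega>"
begin

abbreviation calc :: "(complex \<Rightarrow> complex) \<Rightarrow> ('a \<Rightarrow>\<^sub>L 'a)" where
  "calc f \<equiv> hol_calculus \<Omega> f A"

definition r0 :: real where
  "r0 = (SOME r. 0 < r \<and> r < 1 \<and> spectrum A \<subseteq> inner_dom r)"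

lemma r0: "0 < r0" "r0 < 1" "spectrum A \<subseteq> inner_dom r0"
proof -
  have "\<exists>r. 0 < r \<and> r < 1 \<and> spectrum A \<subseteq> inner_dom r"
    using compact_subset_inner[OF compact_spectrum spectrum_in] by metis
  from someI_ex[OF this] show "0 < r0" "r0 < 1" "spectrum A \<subseteq> inner_dom r0"
    unfolding r0_def by blast+
qed

lemma surrounds_dil:
  assumes "r0 \<le> r" "r < 1"
  shows "surrounds_in (dil r \<circ> c) (spectrum A) \<Omega>"
proof -
  have r: "0 < r" using r0 assms by simp
  have sub: "spectrum A \<subseteq> inner_dom r" using r0 inner_dom_mono[of r0 r] assms by auto
  have im: "path_image (dil r \<circ> c) \<subseteq> \<Omega>" by (rule image_dil_subset[OF r assms(2)])
  show ?thesis
    unfolding surrounds_in_def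
  proof (intro conjI ballI allI impI)
    show "path_image (dil r \<circ> c) \<subseteq> \<Omega> - spectrum A"
      using image_dil_disjoint[OF r] sub im by auto
    show "winding_number (dil r \<circ> c) z = 1" if "z \<in> spectrum A" for z
      using winding_dil[OF r] sub that by auto
    show "winding_number (dil r \<circ> c) z = 0" if "z \<notin> \<Omega>" for z
      using winding_outside[OF im] C1_loop_valid[OF loop_dil(1)] that by auto
  qed (use C1_loop_valid[OF loop_dil(1)] in auto)
qed

lemma open_punctured: "open (\<Omega> - spectrum A)"
  using open_Int[OF open_dom open_resolvent_set[of A]] by (simp add: Diff_eq)

lemma resolvent_element_holomorphic: "(\<lambda>z. cinner (resolvent A z x) y) holomorphic_on \<Omega> - spectrum A"
  by (rule holomorphic_on_subset[OF resolvent_matrix_element_holomorphic[OF clinear]]) auto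

lemma loop_integral_eventually:
  assumes f: "f holomorphic_on \<Omega>" and \<gamma>: "surrounds_in \<gamma> (spectrum A) \<Omega>"
    and s: "r0 \<le> s" "s < 1" "path_image \<gamma> \<subseteq> inner_dom s"
  shows "contour_integral \<gamma> (\<lambda>z. f z * cinner (resolvent A z x) y) =
    contour_integral (dil s \<circ> c) (\<lambda>z. f z * cinner (resolvent A z x) y)"
proof -
  have s0: "0 < s" using r0 s by simp
  have sub: "spectrum A \<subseteq> inner_dom s" using r0 inner_dom_mono[of r0 s] s by auto
  have "contour_integral \<gamma> (\<lambda>z. cauchy_transform (dil s \<circ> c) f z * cinner (resolvent A z x) y) =
      contour_integral (dil s \<circ> c) (\<lambda>w. f w * cinner (resolvent A w x) y)"
  proof (rule calculus_of_cauchy_transform[OF clinear spectrum_ne loop_dil(1) open_inner_dom convex_inner_dom])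
    show "inner_dom s \<inter> path_image (dil s \<circ> c) = {}" by (rule image_dil_disjoint[OF s0])
    show "continuous_on (path_image (dil s \<circ> c)) f"
      by (rule continuous_on_subset[OF holomorphic_on_imp_continuous_on[OF f] image_dil_subset[OF s0 s(2)]])
  qed (use \<gamma> s sub in \<open>auto simp: surrounds_in_def\<close>)
  moreover have "contour_integral \<gamma> (\<lambda>z. cauchy_transform (dil s \<circ> c) f z * cinner (resolvent A z x) y) =
      contour_integral \<gamma> (\<lambda>z. f z * cinner (resolvent A z x) y)"
    using s cauchy_formula_inner[OF f s0 s(2)] by (intro contour_integral_cong) auto
  ultimately show ?thesis by simp
qed

text \<open>Any two contours around the spectrum lie in a common dilated copy of \<open>\<Omega>\<close>, and their integrals
  agree with the one over its boundary.\<close>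

lemma loop_integral_independent:
  assumes f: "f holomorphic_on \<Omega>"
    and \<gamma>: "surrounds_in \<gamma> (spectrum A) \<Omega>" and \<gamma>': "surrounds_in \<gamma>' (spectrum A) \<Omega>"
  shows "contour_integral \<gamma> (\<lambda>z. f z * cinner (resolvent A z x) y) =
    contour_integral \<gamma>' (\<lambda>z. f z * cinner (resolvent A z x) y)"
proof -
  have "compact (path_image \<gamma> \<union> path_image \<gamma>')" "path_image \<gamma> \<union> path_image \<gamma>' \<subseteq> \<Omega>"
    using \<gamma> \<gamma>' by (auto simp: surrounds_in_def intro: compact_valid_path_image)
  then obtain s where s: "0 < s" "s < 1" "path_image \<gamma> \<union> path_image \<gamma>' \<subseteq> inner_dom s"
    by (rule compact_subset_inner)
  define t where "t = max s r0"
  have t: "r0 \<le> t" "t < 1" "path_image \<gamma> \<subseteq> inner_dom t" "path_image \<gamma>' \<subseteq> inner_dom t"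
    using s r0 inner_dom_mono[of s t] by (auto simp: t_def)
  show ?thesis
    using loop_integral_eventually[OF f \<gamma> t(1,2,3)] loop_integral_eventually[OF f \<gamma>' t(1,2,4)] by simp
qed

lemma calc_element:
  assumes f: "f holomorphic_on \<Omega>" and \<gamma>: "surrounds_in \<gamma> (spectrum A) \<Omega>"
  shows "cinner (calc f x) y =
    contour_integral \<gamma> (\<lambda>z. f z * cinner (resolvent A z x) y) / (2 * of_real pi * \<i>)"
proof -
  define \<beta> where "\<beta> = (SOME \<gamma>. surrounds_in \<gamma> (spectrum A) \<Omega>)"
  have \<beta>: "surrounds_in \<beta> (spectrum A) \<Omega>" unfolding \<beta>_def by (rule someI[where P = "\<lambda>\<gamma>. surrounds_in \<gamma> (spectrum A) \<Omega>", OF \<gamma>])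
  have "op_holomorphic (\<lambda>z. scaleC_op (f z) (resolvent A z)) (\<Omega> - spectrum A)"
    by (intro op_holomorphic_scaleC holomorphic_on_subset[OF f]
        op_holomorphic_subset[OF op_holomorphic_resolvent[OF clinear]]) auto
  from op_contour_integral_element[OF open_punctured this, of \<beta> x y]
  have "cinner (op_contour_integral \<beta> (\<lambda>z. scaleC_op (f z) (resolvent A z)) x) y =
      contour_integral \<beta> (\<lambda>z. f z * cinner (resolvent A z x) y)"
    using \<beta> by (simp add: surrounds_in_def cinner_scaleC_left)
  also have "\<dots> = contour_integral \<gamma> (\<lambda>z. f z * cinner (resolvent A z x) y)"
    by (rule loop_integral_independent[OF f \<beta> \<gamma>])
  finally show ?thesis
    by (simp add: hol_calculus_def Let_def cinner_scaleC_left flip: \<beta>_def)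
qed

lemmas calc_element_dil = calc_element[OF _ surrounds_dil[OF order_refl r0(2)]]

lemma dil_integrable:
  assumes "f holomorphic_on \<Omega>" "r0 \<le> r" "r < 1"
  shows "(\<lambda>z. f z * cinner (resolvent A z x) y) contour_integrable_on (dil r \<circ> c)"
  using surrounds_dil[OF assms(2,3)]
  by (intro contour_integrable_holomorphic_simple[OF _ open_punctured] holomorphic_intros
      resolvent_element_holomorphic holomorphic_on_subset[OF assms(1)])
    (auto simp: surrounds_in_def)

lemma calc_cong:
  assumes "f holomorphic_on \<Omega>" "\<And>z. z \<in> \<Omega> \<Longrightarrow> f z = g z"
  shows "calc f = calc g"
proof (rule op_eqI)
  fix x y
  have "g holomorphic_on \<Omega>" using assms holomorphic_cong by blast
  moreover have "contour_integral (dil r0 \<circ> c) (\<lambda>z. f z * cinner (resolvent A z x) y) =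
      contour_integral (dil r0 \<circ> c) (\<lambda>z. g z * cinner (resolvent A z x) y)"
    using assms(2) image_dil_subset[OF r0(1,2)] by (intro contour_integral_cong) auto
  ultimately show "cinner (calc f x) y = cinner (calc g x) y"
    using assms(1) by (simp add: calc_element_dil)
qed

lemma calc_diff:
  assumes "f holomorphic_on \<Omega>" "g holomorphic_on \<Omega>"
  shows "calc (\<lambda>z. f z - g z) = calc f - calc g"
proof (rule op_eqI)
  fix x y
  have "(\<lambda>z. f z - g z) holomorphic_on \<Omega>" by (intro holomorphic_intros assms)
  then show "cinner (calc (\<lambda>z. f z - g z) x) y = cinner ((calc f - calc g) x) y"
    using assms contour_integral_diff[OF dil_integrable[OF assms(1), of r0 x y] dil_integrable[OF assms(2), of r0 x y]] r0
    by (simp add: calc_element_dil blinfun.diff_left cinner_simps left_diff_distrib diff_divide_distrib)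
qed

lemma calc_scale:
  assumes "f holomorphic_on \<Omega>"
  shows "calc (\<lambda>z. a * f z) = scaleC_op a (calc f)"
proof (rule op_eqI)
  fix x y
  have "(\<lambda>z. a * f z) holomorphic_on \<Omega>" by (intro holomorphic_intros assms)
  then show "cinner (calc (\<lambda>z. a * f z) x) y = cinner (scaleC_op a (calc f) x) y"
    using assms contour_integral_lmul[OF dil_integrable[OF assms(1), of r0 x y], of a] r0
    by (simp add: calc_element_dil cinner_simps mult.assoc)
qed

lemma clinear_calc:
  assumes f: "f holomorphic_on \<Omega>"
  shows "clinear_op (calc f)"
  unfolding clinear_op_def
proof (intro allI cinner_eqI)
  fix a v y
  let ?b = "dil r0 \<circ> c"
  have "contour_integral ?b (\<lambda>z. f z * cinner (resolvent A z (a *\<^sub>C v)) y) =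
      contour_integral ?b (\<lambda>z. a * (f z * cinner (resolvent A z v) y))"
  proof (rule contour_integral_cong[OF refl])
    fix z assume "z \<in> path_image ?b"
    then have "clinear_op (resolvent A z)"
      using surrounds_dil[of r0] r0 by (intro clinear_resolvent[OF clinear]) (auto simp: surrounds_in_def)
    then show "f z * cinner (resolvent A z (a *\<^sub>C v)) y = a * (f z * cinner (resolvent A z v) y)"
      by (simp add: clinear_op_def cinner_scaleC_left)
  qed
  also have "\<dots> = a * contour_integral ?b (\<lambda>z. f z * cinner (resolvent A z v) y)"
    by (rule contour_integral_lmul[OF dil_integrable[OF f order_refl r0(2)]])
  finally show "cinner (calc f (a *\<^sub>C v)) y = cinner (a *\<^sub>C calc f v) y"
    by (simp add: calc_element_dil[OF f] cinner_scaleC_left)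
qed

text \<open>The two factors are represented on nested dilated boundaries, \<open>g\<close> on the inner and \<open>f\<close> on the
  outer one; then \<open>g(z) / (w - z)\<close> is holomorphic inside the outer one for \<open>w\<close> on it.\<close>

lemma calc_mult:
  assumes f: "f holomorphic_on \<Omega>" and g: "g holomorphic_on \<Omega>"
  shows "calc (\<lambda>z. f z * g z) = calc f o\<^sub>L calc g"
proof (rule op_eqI)
  fix x y
  define s where "s = (r0 + 1) / 2"
  have s: "r0 < s" "s < 1" "0 < s" using r0 by (auto simp: s_def)
  let ?b = "dil r0 \<circ> c" and ?d = "dil s \<circ> c"
  define J where "J = op_contour_integral ?b (\<lambda>z. scaleC_op (g z) (resolvent A z))"
  have sub: "spectrum A \<subseteq> inner_dom s" using r0 inner_dom_mono[of r0 s] s by auto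
  have imb: "path_image ?b \<subseteq> inner_dom s" by (rule image_dil_inner[OF r0(1) s(1)])
  have in_s: "inner_dom s \<subseteq> \<Omega>" using inner_dom_subset[of s] s by simp
  have imd: "inner_dom s \<inter> path_image ?d = {}" by (rule image_dil_disjoint[OF s(3)])
  have b: "path_image ?b \<subseteq> \<Omega> - spectrum A" using surrounds_dil[of r0] r0 by (auto simp: surrounds_in_def)
  have pi: "2 * of_real pi * \<i> \<noteq> (0 :: complex)" by simp
  have holop: "op_holomorphic (\<lambda>z. scaleC_op (g z) (resolvent A z)) (\<Omega> - spectrum A)"
    by (intro op_holomorphic_scaleC holomorphic_on_subset[OF g]
        op_holomorphic_subset[OF op_holomorphic_resolvent[OF clinear]]) auto
  have J: "J x = (2 * of_real pi * \<i>) *\<^sub>C calc g x"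
  proof (rule cinner_eqI)
    fix y
    have "cinner (J x) y = contour_integral ?b (\<lambda>z. g z * cinner (resolvent A z x) y)"
      unfolding J_def
      using op_contour_integral_element[OF open_punctured holop C1_loop_valid(1)[OF loop_dil(1)] b]
      by (simp add: cinner_scaleC_left)
    then show "cinner (J x) y = cinner ((2 * of_real pi * \<i>) *\<^sub>C calc g x) y"
      using pi by (simp add: calc_element_dil[OF g] cinner_scaleC_left)
  qed
  have "contour_integral ?b (\<lambda>z. g z * contour_integral ?d (\<lambda>w. f w / (w - z)) * cinner (resolvent A z x) y) =
      contour_integral ?d (\<lambda>w. f w * cinner (resolvent A w (J x)) y)"
    unfolding J_def
  proof (rule cauchy_transform_swap[OF clinear loop_dil(1) loop_dil(1) b open_punctured])
    show "g holomorphic_on \<Omega> - spectrum A" by (rule holomorphic_on_subset[OF g]) auto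
    show "continuous_on (path_image ?d) f"
      by (rule continuous_on_subset[OF holomorphic_on_imp_continuous_on[OF f] image_dil_subset[OF s(3,2)]])
    fix w assume w: "w \<in> path_image ?d"
    have "(\<lambda>z. g z / (w - z)) holomorphic_on inner_dom s"
      using w imd by (intro holomorphic_intros holomorphic_on_subset[OF g in_s]) auto
    from Cauchy_theorem_convex_simple[OF this convex_inner_dom C1_loop_valid(1)[OF loop_dil(1)] imb
        C1_loop_valid(2)[OF loop_dil(1)]]
    show "contour_integral ?b (\<lambda>z. g z / (w - z)) = 0" by (rule contour_integral_unique)
  qed (use sub imd imb in auto)
  also have "\<dots> = (2 * of_real pi * \<i>) * cinner (calc f (J x)) y"
    using calc_element[OF f surrounds_dil[of s], of "J x" y] s pi by simp
  also have "\<dots> = (2 * of_real pi * \<i>) * ((2 * of_real pi * \<i>) * cinner (calc f (calc g x)) y)"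
  proof -
    have "cinner (calc f (a *\<^sub>C v)) y = a * cinner (calc f v) y" for a v
      using clinear_calc[OF f] by (simp add: clinear_op_def cinner_scaleC_left)
    then show ?thesis by (simp add: J)
  qed
  finally have 1: "contour_integral ?b (\<lambda>z. g z * contour_integral ?d (\<lambda>w. f w / (w - z)) * cinner (resolvent A z x) y) =
      (2 * of_real pi * \<i>) * ((2 * of_real pi * \<i>) * cinner (calc f (calc g x)) y)" .
  have hol: "(\<lambda>z. f z * g z) holomorphic_on \<Omega>" by (intro holomorphic_intros f g)
  have "contour_integral ?b (\<lambda>z. g z * contour_integral ?d (\<lambda>w. f w / (w - z)) * cinner (resolvent A z x) y) =
      contour_integral ?b (\<lambda>z. (2 * of_real pi * \<i>) * (f z * g z * cinner (resolvent A z x) y))"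
  proof (rule contour_integral_cong[OF refl])
    fix z assume "z \<in> path_image ?b"
    then have "contour_integral ?d (\<lambda>w. f w / (w - z)) = (2 * of_real pi * \<i>) * f z"
      using cauchy_formula_inner[OF f s(3,2), of z] imb by (auto simp: cauchy_transform_def field_simps)
    then show "g z * contour_integral ?d (\<lambda>w. f w / (w - z)) * cinner (resolvent A z x) y =
        (2 * of_real pi * \<i>) * (f z * g z * cinner (resolvent A z x) y)" by simp
  qed
  also have "\<dots> = (2 * of_real pi * \<i>) * contour_integral ?b (\<lambda>z. f z * g z * cinner (resolvent A z x) y)"
    by (rule contour_integral_lmul[OF dil_integrable[OF hol order_refl r0(2)]])
  also have "\<dots> = (2 * of_real pi * \<i>) * ((2 * of_real pi * \<i>) * cinner (calc (\<lambda>z. f z * g z) x) y)"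
    using pi by (simp add: calc_element_dil[OF hol])
  finally show "cinner (calc (\<lambda>z. f z * g z) x) y = cinner ((calc f o\<^sub>L calc g) x) y"
    using 1 pi by simp
qed

lemma calc_bound:
  obtains C where "0 < C" "\<And>f M. f holomorphic_on \<Omega> \<Longrightarrow>
    (\<And>z. z \<in> path_image (dil r0 \<circ> c) \<Longrightarrow> norm (f z) \<le> M) \<Longrightarrow> norm (calc f) \<le> C * M"
proof -
  let ?b = "dil r0 \<circ> c"
  note b = C1_loop_valid[OF loop_dil(1)[of r0]]
  have im: "path_image ?b \<subseteq> \<Omega> - spectrum A" using surrounds_dil[of r0] r0 by (auto simp: surrounds_in_def)
  have "bounded ((\<lambda>t. vector_derivative ?b (at t)) ` {0..1})"
    by (intro compact_imp_bounded compact_continuous_image b) auto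
  then obtain B where B: "B > 0" "\<And>t. t \<in> {0..1} \<Longrightarrow> norm (vector_derivative ?b (at t)) \<le> B"
    by (auto simp: bounded_pos simp del: atLeastAtMost_iff)
  have contR: "continuous_on (path_image ?b) (resolvent A)"
    by (rule continuous_on_subset[OF continuous_on_resolvent[OF clinear]]) (use im in auto)
  then have "bounded (resolvent A ` path_image ?b)"
    by (intro compact_imp_bounded compact_continuous_image compact_valid_path_image b)
  then obtain K where K: "K > 0" "\<And>z. z \<in> path_image ?b \<Longrightarrow> norm (resolvent A z) \<le> K"
    by (auto simp: bounded_pos)
  show thesis
  proof (rule that[of "K * B / (2 * pi)"])
    show "0 < K * B / (2 * pi)" using K B by simp
    fix f M
    assume f: "f holomorphic_on \<Omega>" and M: "\<And>z. z \<in> path_image ?b \<Longrightarrow> norm (f z) \<le> M"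
    obtain z0 where "z0 \<in> path_image ?b" by (metis path_image_nonempty ex_in_conv)
    then have M0: "M \<ge> 0" using order_trans[OF norm_ge_zero M] by blast
    show "norm (calc f) \<le> K * B / (2 * pi) * M"
    proof (rule op_norm_bound)
      fix x y
      have "norm (contour_integral ?b (\<lambda>z. f z * cinner (resolvent A z x) y)) \<le> (M * (K * norm x * norm y)) * B"
      proof (rule C1_loop_contour_bound[OF loop_dil(1) _ _ B(2)])
        show "continuous_on (path_image ?b) (\<lambda>z. f z * cinner (resolvent A z x) y)"
          by (intro continuous_intros continuous_on_subset[OF holomorphic_on_imp_continuous_on[OF f]]
              bounded_linear.continuous_on[OF bounded_linear_matrix_element contR]) (use im in auto)
        show "norm (f z * cinner (resolvent A z x) y) \<le> M * (K * norm x * norm y)"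
          if "z \<in> path_image ?b" for z
          unfolding norm_mult using M[OF that] M0 K(2)[OF that]
          by (intro mult_mono order_trans[OF norm_matrix_element_le] mult_right_mono) auto
      qed (use M0 K in auto)
      then show "norm (cinner (calc f x) y) \<le> K * B / (2 * pi) * M * norm x * norm y"
        by (simp add: calc_element_dil[OF f] norm_divide norm_mult field_simps)
    qed (use K B M0 in simp)
  qed
qed

lemma calc_cauchy_transform:
  assumes \<phi>: "continuous_on (frontier \<Omega>) \<phi>"
  shows "cinner (calc (cauchy_transform c \<phi>) x) y =
    contour_integral c (\<lambda>w. \<phi> w * cinner (resolvent A w x) y) / (2 * of_real pi * \<i>)"
proof -
  have disj: "\<Omega> \<inter> path_image c = {}" using image frontier_not_in by auto
  have cont: "continuous_on (path_image c) \<phi>" using \<phi> image by simp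
  have "cauchy_transform c \<phi> holomorphic_on \<Omega>"
    by (rule cauchy_transform_holomorphic[OF loop cont open_dom disj])
  then show ?thesis
    using surrounds_dil[OF order_refl r0(2)]
    by (simp add: calc_element_dil surrounds_in_def
        calculus_of_cauchy_transform[OF clinear spectrum_ne loop open_dom convex_dom disj spectrum_in _ _ _ _ cont])
qed

lemma calc_boundary:
  assumes f: "f holomorphic_on \<Omega>" "continuous_on (closure \<Omega>) f"
  shows "cinner (calc f x) y =
    contour_integral c (\<lambda>w. f w * cinner (resolvent A w x) y) / (2 * of_real pi * \<i>)"
proof -
  have "calc f = calc (cauchy_transform c f)"
    using cauchy_formula_boundary[OF f] by (intro calc_cong f) auto
  moreover have "continuous_on (frontier \<Omega>) f"
    by (rule continuous_on_subset[OF f(2)]) (auto simp: frontier_def)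
  ultimately show ?thesis by (simp add: calc_cauchy_transform)
qed

lemma resolvent_boundary_integral:
  "contour_integral c (\<lambda>w. cinner (resolvent A w x) y) = 2 * of_real pi * \<i> * cinner x y"
  using image frontier_not_in spectrum_in winding C1_loop_valid[OF loop]
  by (intro resolvent_loop_integral[OF clinear spectrum_ne]) auto

end


section \<open>The Cauchy transform of the conjugate function\<close>

text \<open>If \<open>Re g\<close> were at most \<open>-2e\<close> somewhere, the set where \<open>Re g < -e\<close> would have its closure in \<open>\<Omega>\<close>,
  and the maximum modulus principle for \<open>exp (- g)\<close> on it would give a contradiction.\<close>

lemma positive_boundary_liminf_imp_nonneg:
  fixes g :: "complex \<Rightarrow> complex"
  assumes \<Omega>: "open \<Omega>" "bounded \<Omega>" and g: "g holomorphic_on \<Omega>"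
    and bd: "\<And>\<zeta> e. \<zeta> \<in> frontier \<Omega> \<Longrightarrow> 0 < e \<Longrightarrow>
      \<exists>d>0. \<forall>z\<in>\<Omega>. dist z \<zeta> < d \<longrightarrow> - e \<le> Re (g z)"
    and z: "z \<in> \<Omega>"
  shows "0 \<le> Re (g z)"
proof (rule ccontr)
  assume "\<not> 0 \<le> Re (g z)"
  define e where "e = - Re (g z) / 2"
  have e: "e > 0" "Re (g z) = - 2 * e" using \<open>\<not> 0 \<le> Re (g z)\<close> by (auto simp: e_def)
  define S where "S = {z \<in> \<Omega>. Re (g z) < - e}"
  have cont: "continuous_on \<Omega> g" by (rule holomorphic_on_imp_continuous_on[OF g])
  have openS: "open S"
  proof -
    have "open (\<Omega> \<inter> (\<lambda>z. Re (g z)) -` {..< - e})"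
      by (intro continuous_open_preimage continuous_intros cont \<Omega>)
    also have "\<Omega> \<inter> (\<lambda>z. Re (g z)) -` {..< - e} = S" by (auto simp: S_def)
    finally show ?thesis .
  qed
  have clS: "closure S \<subseteq> \<Omega>"
  proof
    fix x assume x: "x \<in> closure S"
    show "x \<in> \<Omega>"
    proof (rule ccontr)
      assume "x \<notin> \<Omega>"
      moreover have "x \<in> closure \<Omega>" using x closure_mono[of S \<Omega>] by (auto simp: S_def)
      ultimately have "x \<in> frontier \<Omega>" using \<Omega>(1) by (simp add: frontier_def interior_open)
      from bd[OF this e(1)] obtain d where d: "d > 0" "\<And>z. z \<in> \<Omega> \<Longrightarrow> dist z x < d \<Longrightarrow> - e \<le> Re (g z)"
        by blast
      obtain y where "y \<in> S" "dist y x < d" using x d(1) by (auto simp: closure_approachable)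
      then show False using d(2)[of y] by (auto simp: S_def)
    qed
  qed
  have "norm (exp (- g z)) \<le> exp e"
  proof (rule maximum_modulus_frontier[where S = S and f = "\<lambda>z. exp (- g z)"])
    show "(\<lambda>z. exp (- g z)) holomorphic_on interior S"
      by (intro holomorphic_intros holomorphic_on_subset[OF g])
        (use clS closure_subset interior_subset in blast)
    show "continuous_on (closure S) (\<lambda>z. exp (- g z))"
      by (intro continuous_intros continuous_on_subset[OF cont clS])
    show "bounded S" by (rule bounded_subset[OF \<Omega>(2)]) (auto simp: S_def)
    show "z \<in> S" using e z by (simp add: S_def)
    fix x assume "x \<in> frontier S"
    then have "x \<in> \<Omega>" "x \<notin> S" using clS openS by (auto simp: frontier_def interior_open)
    then show "norm (exp (- g x)) \<le> exp e" by (simp add: S_def)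
  qed
  then show False using e by simp
qed

context convex_boundary
begin

text \<open>The density of the double layer potential: up to the factor \<open>1/\<pi>\<close>, the rate at which the
  argument of \<open>c t - z\<close> grows.\<close>

definition kern :: "complex \<Rightarrow> real \<Rightarrow> real" where
  "kern z t = Im (vector_derivative c (at t) / (c t - z)) / pi"

lemma frontier_closure: "z \<in> frontier \<Omega> \<Longrightarrow> z \<in> closure \<Omega>"
  by (simp add: frontier_def)

lemma c_in_frontier: "t \<in> {0..1} \<Longrightarrow> c t \<in> frontier \<Omega>"
  using image by (auto simp: path_image_def)

lemma curve_continuous:
  "continuous_on S c" "continuous_on S (\<lambda>t. vector_derivative c (at t))"
  "continuous_on S f \<Longrightarrow> continuous_on S (\<lambda>x. vector_derivative c (at (f x)))"
proof -
  show "continuous_on S c" by (rule C1_loop_valid(5)[OF loop])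
  have V: "continuous_on UNIV (\<lambda>t. vector_derivative c (at t))" using loop by (simp add: C1_loop_def)
  then show "continuous_on S (\<lambda>t. vector_derivative c (at t))" by (rule continuous_on_subset) simp
  show "continuous_on S f \<Longrightarrow> continuous_on S (\<lambda>x. vector_derivative c (at (f x)))"
    using continuous_on_compose2[OF V] by simp
qed

lemma kern_pos:
  assumes "z \<in> \<Omega>"
  shows "0 < kern z t"
proof -
  let ?V = "vector_derivative c (at t)"
  have "c t - z \<noteq> 0" using turning[OF assms, of t] by auto
  then have "0 < (Re (c t - z))\<^sup>2 + (Im (c t - z))\<^sup>2"
    by (metis cmod_power2 zero_less_norm_iff zero_less_power)
  moreover have "Im (?V / (c t - z)) = Im (?V * cnj (c t - z)) / ((Re (c t - z))\<^sup>2 + (Im (c t - z))\<^sup>2)"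
    unfolding Im_divide by (simp add: algebra_simps)
  ultimately show ?thesis
    unfolding kern_def using turning[OF assms, of t] by (simp only: divide_pos_pos pi_gt_zero)
qed

text \<open>Cauchy's formula for \<open>f\<close> and the conjugate of the formula defining the transform add up, since
  \<open>q - cnj q = 2i Im q\<close>.\<close>

lemma double_layer:
  assumes f: "f holomorphic_on \<Omega>" "continuous_on (closure \<Omega>) f" and z: "z \<in> \<Omega>"
  shows "((\<lambda>t. f (c t) * of_real (kern z t)) has_integral
    (cnj (cauchy_transform c (\<lambda>w. cnj (f w)) z) + f z)) {0..1}"
proof -
  let ?V = "\<lambda>t. vector_derivative c (at t)"
  have nz: "w - z \<noteq> 0" if "w \<in> path_image c" for w using that z image frontier_not_in by auto
  have cf: "continuous_on (path_image c) f"
    using image by (intro continuous_on_subset[OF f(2)]) (auto simp: frontier_def)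
  have "(\<lambda>w. f w / (w - z)) contour_integrable_on c"
    using nz by (intro C1_loop_contour_integrable[OF loop] continuous_intros cf) auto
  from has_contour_integral_integral[OF this]
  have 1: "((\<lambda>t. f (c t) / (c t - z) * ?V t) has_integral (2 * of_real pi * \<i> * f z)) {0..1}"
    using cauchy_formula_boundary[OF f z] by (simp add: has_contour_integral cauchy_transform_def field_simps)
  have "(\<lambda>w. cnj (f w) / (w - z)) contour_integrable_on c"
    using nz by (intro C1_loop_contour_integrable[OF loop] continuous_intros cf) auto
  from has_contour_integral_integral[OF this]
  have "((\<lambda>t. cnj (f (c t)) / (c t - z) * ?V t) has_integral
      (2 * of_real pi * \<i> * cauchy_transform c (\<lambda>w. cnj (f w)) z)) {0..1}"
    by (simp add: has_contour_integral cauchy_transform_def)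
  from has_integral_linear[OF this bounded_linear_cnj]
  have 2: "((\<lambda>t. f (c t) / cnj (c t - z) * cnj (?V t)) has_integral
      (- 2 * of_real pi * \<i> * cnj (cauchy_transform c (\<lambda>w. cnj (f w)) z))) {0..1}"
    by (simp add: o_def)
  have val: "1 / (2 * of_real pi * \<i>) * (2 * of_real pi * \<i> * f z -
      - 2 * of_real pi * \<i> * cnj (cauchy_transform c (\<lambda>w. cnj (f w)) z)) =
      cnj (cauchy_transform c (\<lambda>w. cnj (f w)) z) + f z"
    by (simp add: divide_simps) (simp only: algebra_simps)
  from has_integral_mult_right[OF has_integral_diff[OF 1 2], of "1 / (2 * of_real pi * \<i>)"]
  have "((\<lambda>t. 1 / (2 * of_real pi * \<i>) * (f (c t) / (c t - z) * ?V t - f (c t) / cnj (c t - z) * cnj (?V t)))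
      has_integral (cnj (cauchy_transform c (\<lambda>w. cnj (f w)) z) + f z)) {0..1}"
    unfolding val .
  moreover have "1 / (2 * of_real pi * \<i>) * (f (c t) / (c t - z) * ?V t - f (c t) / cnj (c t - z) * cnj (?V t)) =
      f (c t) * of_real (kern z t)" for t
  proof -
    let ?q = "?V t / (c t - z)"
    have "?q - cnj ?q = of_real (2 * Im ?q) * \<i>" by (simp only: complex_diff_cnj)
    moreover have "f (c t) / (c t - z) * ?V t - f (c t) / cnj (c t - z) * cnj (?V t) =
        f (c t) * (?q - cnj ?q)"
      by (simp only: complex_cnj_divide right_diff_distrib times_divide_eq_right times_divide_eq_left)
    moreover have "1 / (2 * of_real pi * \<i>) * (a * (of_real (2 * r) * \<i>)) = a * of_real (r / pi)"
      for a and r :: real by simp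
    ultimately show ?thesis by (simp only: kern_def)
  qed
  ultimately show ?thesis by simp
qed

lemma kern_integral:
  assumes "z \<in> \<Omega>"
  shows "(kern z has_integral 2) {0..1}"
proof -
  have "((\<lambda>t. 1 * complex_of_real (kern z t)) has_integral (cnj (cauchy_transform c (\<lambda>w. cnj 1) z) + 1)) {0..1}"
    by (rule double_layer) (use assms in auto)
  moreover have "cauchy_transform c (\<lambda>w. cnj 1) z = 1"
    using cauchy_formula_boundary[of "\<lambda>w. 1" z] assms by simp
  ultimately have "((\<lambda>t. complex_of_real (kern z t)) has_integral 2) {0..1}" by simp
  from has_integral_linear[OF this bounded_linear_Re] show ?thesis by (simp add: o_def)
qed

lemma conj_transform_bound:
  assumes f: "f holomorphic_on \<Omega>" "continuous_on (closure \<Omega>) f" and z: "z \<in> \<Omega>"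
    and M: "\<And>w. w \<in> closure \<Omega> \<Longrightarrow> norm (f w) \<le> M"
  shows "norm (cauchy_transform c (\<lambda>w. cnj (f w)) z) \<le> 3 * M"
proof -
  let ?g = "cauchy_transform c (\<lambda>w. cnj (f w)) z"
  have "norm (integral {0..1} (\<lambda>t. f (c t) * of_real (kern z t))) \<le> integral {0..1} (\<lambda>t. M * kern z t)"
  proof (rule integral_norm_bound_integral)
    show "(\<lambda>t. f (c t) * of_real (kern z t)) integrable_on {0..1}" using double_layer[OF f z] by blast
    show "(\<lambda>t. M * kern z t) integrable_on {0..1}"
      using has_integral_mult_right[OF kern_integral[OF z], of M] by blast
    fix t :: real assume "t \<in> {0..1}"
    then have "norm (f (c t)) \<le> M" by (intro M frontier_closure c_in_frontier)
    then show "norm (f (c t) * of_real (kern z t)) \<le> M * kern z t"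
      using kern_pos[OF z, of t] by (simp add: norm_mult)
  qed
  then have "norm (cnj ?g + f z) \<le> M * 2"
    using integral_unique[OF double_layer[OF f z]] integral_unique[OF kern_integral[OF z]] by simp
  moreover have "norm (f z) \<le> M" using z closure_subset by (intro M) auto
  moreover have "norm (cnj ?g) \<le> norm (cnj ?g + f z) + norm (f z)"
    using norm_triangle_ineq4[of "cnj ?g + f z" "f z"] by simp
  ultimately show ?thesis by simp
qed

lemma tangent_half_plane:
  assumes "z \<in> closure \<Omega>"
  shows "0 \<le> Im (vector_derivative c (at t) * cnj (c t - z))"
proof (rule continuous_ge_on_closure[OF _ assms])
  show "continuous_on (closure \<Omega>) (\<lambda>z. Im (vector_derivative c (at t) * cnj (c t - z)))"
    by (intro continuous_intros)
qed (rule less_imp_le[OF turning])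

lemma curve_start_injective:
  assumes "0 < t" "t < 1"
  shows "c t \<noteq> c 0"
  using inj assms unfolding inj_on_def by force

text \<open>Seen from the boundary point \<open>c 0\<close>, the rest of the curve stays in the half plane bounded by the
  tangent, so the argument of \<open>c t - c 0\<close> varies by at most \<open>\<pi>\<close>.\<close>

lemma far_kern_integral_start:
  assumes d: "0 < d" "d < 1 / 2"
  shows "integral {d..1 - d} (kern (c 0)) \<le> 1"
proof -
  define V0 where "V0 = vector_derivative c (at 0)"
  have V0: "V0 \<noteq> 0" using turning[OF p_in, of 0] by (auto simp: V0_def)
  (* the factor turns the half plane left of the tangent into the right half plane,
     on which Ln is holomorphic except at 0 *)
  define W where "W t = - \<i> * cnj V0 * (c t - c 0)" for t
  have ne: "c t \<noteq> c 0" if "t \<in> {d..1 - d}" for t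
    using that d by (intro curve_start_injective) auto
  have W: "W t \<noteq> 0" "0 \<le> Re (W t)" if "t \<in> {d..1 - d}" for t
  proof -
    show "W t \<noteq> 0" using ne[OF that] V0 by (simp add: W_def)
    have "0 \<le> Im (V0 * cnj (c 0 - c t))"
      unfolding V0_def using that d by (intro tangent_half_plane frontier_closure c_in_frontier) auto
    then show "0 \<le> Re (W t)" by (simp add: W_def algebra_simps)
  qed
  have WR: "W t \<notin> \<real>\<^sub>\<le>\<^sub>0" if "t \<in> {d..1 - d}" for t
    using W[OF that] by (auto simp: complex_nonpos_Reals_iff complex_eq_iff)
  have "((\<lambda>t. vector_derivative c (at t) / (c t - c 0)) has_integral (Ln (W (1 - d)) - Ln (W d))) {d..1 - d}"
  proof (rule fundamental_theorem_of_calculus)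
    fix t assume t: "t \<in> {d..1 - d}"
    have "(c has_vector_derivative vector_derivative c (at t)) (at t)"
      using loop by (simp add: C1_loop_def vector_derivative_works)
    then have "(W has_vector_derivative (- \<i> * cnj V0 * vector_derivative c (at t))) (at t)"
      unfolding W_def by (auto intro!: derivative_eq_intros)
    from field_vector_diff_chain_at[OF this, of Ln "inverse (W t)"] has_field_derivative_Ln[OF WR[OF t]]
    have "((\<lambda>t. Ln (W t)) has_vector_derivative (- \<i> * cnj V0 * vector_derivative c (at t)) * inverse (W t)) (at t)"
      by (simp add: o_def)
    moreover have "(- \<i> * cnj V0 * vector_derivative c (at t)) * inverse (W t) =
        vector_derivative c (at t) / (c t - c 0)"
      using V0 ne[OF t] by (simp add: W_def field_simps)
    ultimately show "((\<lambda>t. Ln (W t)) has_vector_derivative vector_derivative c (at t) / (c t - c 0)) (at t within {d..1 - d})"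
      by (simp add: has_vector_derivative_at_within)
  qed (use d in auto)
  from has_integral_divide[OF has_integral_linear[OF this bounded_linear_Im], of pi]
  have "(kern (c 0) has_integral ((Im (Ln (W (1 - d))) - Im (Ln (W d))) / pi)) {d..1 - d}"
    by (simp add: o_def kern_def[abs_def])
  then have "integral {d..1 - d} (kern (c 0)) = (Im (Ln (W (1 - d))) - Im (Ln (W d))) / pi"
    by (rule integral_unique)
  moreover have "\<bar>Im (Ln (W t))\<bar> \<le> pi / 2" if "t \<in> {d..1 - d}" for t
    using Re_Ln_pos_le[OF W(1)[OF that]] W(2)[OF that] by simp
  from this[of "1 - d"] this[of d] have "\<bar>Im (Ln (W (1 - d)))\<bar> \<le> pi / 2" "\<bar>Im (Ln (W d))\<bar> \<le> pi / 2"
    using d by simp_all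
  ultimately show ?thesis
    using divide_right_mono[of "Im (Ln (W (1 - d))) - Im (Ln (W d))" pi pi] by simp
qed

lemma far_kern_integral_near_start:
  assumes d: "0 < d" "d < 1 / 2" and e: "0 < e"
  shows "\<exists>r>0. \<forall>z\<in>\<Omega>. dist z (c 0) < r \<longrightarrow> integral {d..1 - d} (kern z) \<le> 1 + e"
proof -
  define U where "U = - (c ` {d..1 - d})"
  have "open U"
    unfolding U_def by (intro open_Compl compact_imp_closed compact_continuous_image curve_continuous) auto
  have "c t \<noteq> c 0" if "t \<in> {d..1 - d}" for t
    using that d by (intro curve_start_injective) auto
  then have c0: "c 0 \<in> U" unfolding U_def by (metis ComplI imageE)
  have neU: "c t - z \<noteq> 0" if "z \<in> U" "t \<in> {d..1 - d}" for t z
    using that by (auto simp: U_def)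
  have snd: "continuous_on X (\<lambda>q :: complex \<times> real. c (snd q))"
    "continuous_on X (\<lambda>q :: complex \<times> real. vector_derivative c (at (snd q)))" for X
    using continuous_on_compose2[OF curve_continuous(1)[of UNIV] continuous_on_snd[OF continuous_on_id]]
      continuous_on_compose2[OF curve_continuous(2)[of UNIV] continuous_on_snd[OF continuous_on_id]] by simp_all
  have "continuous_on U (\<lambda>z. integral (cbox d (1 - d)) (kern z))"
  proof (rule integral_continuous_on_param)
    show "continuous_on (U \<times> cbox d (1 - d)) (\<lambda>(z, t). kern z t)"
      unfolding kern_def case_prod_beta using neU
      by (intro continuous_intros snd) auto
  qed
  then have "isCont (\<lambda>z. integral {d..1 - d} (kern z)) (c 0)"
    using \<open>open U\<close> c0 by (simp add: continuous_on_eq_continuous_at)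
  then obtain r where r: "r > 0" "\<And>z. dist z (c 0) < r \<Longrightarrow>
      dist (integral {d..1 - d} (kern z)) (integral {d..1 - d} (kern (c 0))) < e"
    using e unfolding continuous_at_eps_delta by blast
  show ?thesis
  proof (intro exI[of _ r] conjI ballI impI r(1))
    fix z assume "dist z (c 0) < r"
    from r(2)[OF this] far_kern_integral_start[OF d]
    show "integral {d..1 - d} (kern z) \<le> 1 + e" by (simp add: dist_real_def)
  qed
qed

text \<open>Let \<open>h = Re (u f)\<close>. The real part in question is the integral of \<open>h\<close> against the kernel minus
  \<open>h z\<close>. Near \<open>c 0\<close> the far part of the curve carries mass at most \<open>1 + o(1)\<close>, hence the near part
  at least \<open>1 - o(1)\<close>, where \<open>h\<close> is close to \<open>h z\<close>; the far part contributes a nonnegative amount.\<close>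

lemma conj_transform_near_start:
  assumes f: "f holomorphic_on \<Omega>" "continuous_on (closure \<Omega>) f"
    and pos: "\<And>w. w \<in> closure \<Omega> \<Longrightarrow> 0 \<le> Re (u * f w)" and e: "0 < e"
  shows "\<exists>r>0. \<forall>z\<in>\<Omega>. dist z (c 0) < r \<longrightarrow> - e \<le> Re (cnj u * cauchy_transform c (\<lambda>w. cnj (f w)) z)"
proof -
  define h where "h w = Re (u * f w)" for w
  define m where "m = h (c 0)"
  have c0: "c 0 \<in> closure \<Omega>" by (intro frontier_closure c_in_frontier) auto
  have m: "m \<ge> 0" unfolding m_def h_def by (rule pos[OF c0])
  have conth: "continuous_on (closure \<Omega>) h" unfolding h_def by (intro continuous_intros f)
  define e1 where "e1 = e / 4"
  define e2 where "e2 = e / (4 * (m + 1))"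
  have e12: "e1 > 0" "e2 > 0" using e m by (auto simp: e1_def e2_def)
  have "m * e2 \<le> e / 4" using e m by (simp add: e2_def field_simps)
  obtain r1 where r1: "r1 > 0" "\<And>w. w \<in> closure \<Omega> \<Longrightarrow> dist w (c 0) < r1 \<Longrightarrow> \<bar>h w - m\<bar> < e1"
    using conth c0 e12(1) unfolding continuous_on_iff m_def dist_real_def by meson
  have "isCont c 0" "isCont c 1"
    using curve_continuous(1)[of UNIV] by (auto simp: continuous_on_eq_continuous_at)
  then obtain d1 d2 where d1: "d1 > 0" "\<And>t. dist t 0 < d1 \<Longrightarrow> dist (c t) (c 0) < r1"
    and d2: "d2 > 0" "\<And>t. dist t 1 < d2 \<Longrightarrow> dist (c t) (c 1) < r1"
    using r1(1) unfolding continuous_at_eps_delta by metis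
  have c1: "c 1 = c 0" using periodic[of 0] by simp
  define d where "d = min (min d1 d2) (1 / 2) / 2"
  have d: "0 < d" "d < 1 / 2" "d < d1" "d < d2" using d1 d2 by (auto simp: d_def min_def)
  obtain r2 where r2: "r2 > 0" "\<And>z. z \<in> \<Omega> \<Longrightarrow> dist z (c 0) < r2 \<Longrightarrow> integral {d..1 - d} (kern z) \<le> 1 + e2"
    using far_kern_integral_near_start[OF d(1,2) e12(2)] by blast
  show ?thesis
  proof (intro exI[of _ "min r1 r2"] conjI ballI impI)
    show "0 < min r1 r2" using r1 r2 by simp
    fix z assume z: "z \<in> \<Omega>" and near: "dist z (c 0) < min r1 r2"
    let ?I = "integral {0..1} (\<lambda>t. h (c t) * kern z t)"
    have hz: "\<bar>h z - m\<bar> < e1" using r1(2)[of z] z near closure_subset by auto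
    from has_integral_linear[OF has_integral_mult_right[OF double_layer[OF f z], of u] bounded_linear_Re]
    have hI: "((\<lambda>t. h (c t) * kern z t) has_integral
        (Re (u * (cnj (cauchy_transform c (\<lambda>w. cnj (f w)) z) + f z)))) {0..1}"
      by (simp add: o_def h_def algebra_simps)
    have "Re (u * (cnj (cauchy_transform c (\<lambda>w. cnj (f w)) z) + f z)) =
        Re (cnj u * cauchy_transform c (\<lambda>w. cnj (f w)) z) + h z"
      by (simp add: h_def algebra_simps)
    with hI have I: "Re (cnj u * cauchy_transform c (\<lambda>w. cnj (f w)) z) = ?I - h z"
      by (simp add: integral_unique)
    have hk_int: "(\<lambda>t. h (c t) * kern z t) integrable_on {a..b}" if "{a..b} \<subseteq> {0..1}" for a b
      using integrable_on_subinterval[OF _ that] hI by blast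
    have k_int: "kern z integrable_on {a..b}" if "{a..b} \<subseteq> {0..1}" for a b
      using integrable_on_subinterval[OF _ that] kern_integral[OF z] by blast
    have hpos: "0 \<le> h (c t)" if "t \<in> {0..1}" for t
      unfolding h_def using that by (intro pos frontier_closure c_in_frontier)
    have kpos: "0 \<le> kern z t" for t using kern_pos[OF z, of t] by simp
    have split: "integral {0..1} F = integral {0..d} F + integral {d..1 - d} F + integral {1 - d..1} F"
      if "F integrable_on {0..1}" for F :: "real \<Rightarrow> real"
    proof -
      have "F integrable_on {0..1 - d}" by (rule integrable_on_subinterval[OF that]) (use d in auto)
      from Henstock_Kurzweil_Integration.integral_combine[OF _ _ this, of d]
        Henstock_Kurzweil_Integration.integral_combine[OF _ _ that, of "1 - d"] d
      show ?thesis by simp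
    qed
    show "- e \<le> Re (cnj u * cauchy_transform c (\<lambda>w. cnj (f w)) z)"
    proof (cases "m \<le> e1")
      case True
      have "0 \<le> ?I" using hpos kpos by (intro integral_nonneg hk_int) auto
      then show ?thesis using I hz True e1_def e by linarith
    next
      case False
      have lower: "(m - e1) * integral {a..b} (kern z) \<le> integral {a..b} (\<lambda>t. h (c t) * kern z t)"
        if ab: "{a..b} \<subseteq> {0..1}" and near: "\<And>t. t \<in> {a..b} \<Longrightarrow> dist (c t) (c 0) < r1" for a b
      proof -
        have "integral {a..b} (\<lambda>t. (m - e1) * kern z t) \<le> integral {a..b} (\<lambda>t. h (c t) * kern z t)"
        proof (rule integral_le)
          show "(\<lambda>t. (m - e1) * kern z t) integrable_on {a..b}"
            by (intro integrable_on_mult_right k_int ab)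
          show "(\<lambda>t. h (c t) * kern z t) integrable_on {a..b}" by (rule hk_int[OF ab])
          fix t assume t: "t \<in> {a..b}"
          then have "c t \<in> closure \<Omega>" using ab by (intro frontier_closure c_in_frontier) auto
          then have "m - e1 \<le> h (c t)" using r1(2)[of "c t"] near[OF t] by force
          then show "(m - e1) * kern z t \<le> h (c t) * kern z t" using kpos by (rule mult_right_mono)
        qed
        then show ?thesis by simp
      qed
      have "(m - e1) * integral {0..d} (kern z) \<le> integral {0..d} (\<lambda>t. h (c t) * kern z t)"
        by (rule lower) (use d d1 in \<open>auto simp: dist_real_def\<close>)
      moreover have "(m - e1) * integral {1 - d..1} (kern z) \<le> integral {1 - d..1} (\<lambda>t. h (c t) * kern z t)"
        by (rule lower) (use d d2 c1 in \<open>auto simp: dist_real_def\<close>)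
      moreover have "0 \<le> integral {d..1 - d} (\<lambda>t. h (c t) * kern z t)"
        using hpos kpos d by (intro integral_nonneg hk_int) auto
      moreover have "?I = integral {0..d} (\<lambda>t. h (c t) * kern z t) + integral {d..1 - d} (\<lambda>t. h (c t) * kern z t)
          + integral {1 - d..1} (\<lambda>t. h (c t) * kern z t)"
        by (rule split) (rule hk_int, simp)
      moreover have "2 = integral {0..d} (kern z) + integral {d..1 - d} (kern z) + integral {1 - d..1} (kern z)"
        using split[of "kern z"] kern_integral[OF z] by (auto simp: integral_unique)
      moreover from this have "(m - e1) * (2 - integral {d..1 - d} (kern z)) =
          (m - e1) * integral {0..d} (kern z) + (m - e1) * integral {1 - d..1} (kern z)"
        by (subst distrib_left[symmetric]) simp
      ultimately have "(m - e1) * (2 - integral {d..1 - d} (kern z)) \<le> ?I"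
        by linarith
      moreover have "(m - e1) * (1 - e2) \<le> (m - e1) * (2 - integral {d..1 - d} (kern z))"
        using False r2(2)[OF z] near by (intro mult_left_mono) auto
      moreover have "(m - e1) * (1 - e2) = m - e1 - m * e2 + e1 * e2" by (simp add: algebra_simps)
      moreover have "0 \<le> e1 * e2" using e12 by simp
      ultimately show ?thesis using I hz \<open>m * e2 \<le> e / 4\<close> e unfolding e1_def by linarith
    qed
  qed
qed

lemma shiftpath_eq: "shiftpath a c = (\<lambda>t. c (t + a))"
proof
  fix t
  show "shiftpath a c t = c (t + a)"
    using periodic[of "a + t - 1"] by (simp add: shiftpath_def add.commute)
qed

text \<open>Reparametrising the curve moves any boundary point to the starting point.\<close>

lemma shifted_boundary:
  assumes a: "0 \<le> a" "a < 1"
  shows "convex_boundary \<Omega> (\<lambda>t. c (t + a)) p"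
proof -
  have der: "(c has_vector_derivative vector_derivative c (at t)) (at t)" for t
    using loop by (simp add: C1_loop_def vector_derivative_works)
  have sder: "((\<lambda>t. c (t + a)) has_vector_derivative vector_derivative c (at (t + a))) (at t)" for t
  proof -
    have "((\<lambda>t. t + a) has_vector_derivative 1) (at t)" by (auto intro!: derivative_eq_intros)
    from vector_diff_chain_at[OF this der] show ?thesis by (simp add: o_def)
  qed
  then have vd: "vector_derivative (\<lambda>t. c (t + a)) (at t) = vector_derivative c (at (t + a))" for t
    by (rule vector_derivative_at)
  have pf: "pathfinish c = pathstart c" by (rule C1_loop_valid(2)[OF loop])
  show ?thesis
  proof
    show "C1_loop (\<lambda>t. c (t + a))"
      unfolding C1_loop_def vd
    proof (intro conjI allI)
      show "(\<lambda>t. c (t + a)) differentiable at t" for t using sder by (rule differentiableI_vector)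
      show "continuous_on UNIV (\<lambda>t. vector_derivative c (at (t + a)))"
        by (intro curve_continuous continuous_intros)
      show "pathfinish (\<lambda>t. c (t + a)) = pathstart (\<lambda>t. c (t + a))"
        using periodic[of a] by (simp add: pathfinish_def pathstart_def add.commute)
    qed
    show "c (t + 1 + a) = c (t + a)" for t using periodic[of "t + a"] by (simp add: add_ac)
    show "inj_on (\<lambda>t. c (t + a)) {0..<1}"
    proof (rule inj_onI)
      fix s t :: real assume st: "s \<in> {0..<1}" "t \<in> {0..<1}" "c (s + a) = c (t + a)"
      define red where "red x = (if x < 1 then x else x - 1)" for x :: real
      have "c x = c (red x)" for x using periodic[of "x - 1"] by (simp add: red_def)
      then have "c (red (s + a)) = c (red (t + a))" using st(3) by metis
      moreover have "red (s + a) \<in> {0..<1}" "red (t + a) \<in> {0..<1}" using st a by (auto simp: red_def)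
      ultimately have "red (s + a) = red (t + a)" using inj by (auto dest: inj_onD)
      then show "s = t" using st a by (auto simp: red_def split: if_splits)
    qed
    show "path_image (\<lambda>t. c (t + a)) = frontier \<Omega>"
      using path_image_shiftpath[of a c] a pf image by (simp add: shiftpath_eq)
    show "winding_number (\<lambda>t. c (t + a)) z = 1" if "z \<in> \<Omega>" for z
    proof -
      have "winding_number (shiftpath a c) z = winding_number c z"
        by (rule winding_number_shiftpath[OF C1_loop_valid(3)[OF loop]])
          (use that image frontier_not_in pf a in auto)
      then show ?thesis using winding[OF that] by (simp add: shiftpath_eq)
    qed
    show "0 < Im (vector_derivative (\<lambda>t. c (t + a)) (at t) * cnj (c (t + a) - z))" if "z \<in> \<Omega>" for z t
      unfolding vd by (rule turning[OF that])
  qed (use open_dom convex_dom bounded_dom p_in in auto)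
qed

lemma cauchy_transform_shift:
  assumes a: "0 \<le> a" "a < 1" and \<phi>: "continuous_on (frontier \<Omega>) \<phi>" and z: "z \<in> \<Omega>"
  shows "cauchy_transform (\<lambda>t. c (t + a)) \<phi> z = cauchy_transform c \<phi> z"
proof -
  have "(\<lambda>w. \<phi> w / (w - z)) contour_integrable_on c"
    using z image frontier_not_in \<phi> by (intro C1_loop_contour_integrable[OF loop] continuous_intros) auto
  from has_contour_integral_shiftpath[OF has_contour_integral_integral[OF this] C1_loop_valid(1)[OF loop], of a]
  have "contour_integral (shiftpath a c) (\<lambda>w. \<phi> w / (w - z)) = contour_integral c (\<lambda>w. \<phi> w / (w - z))"
    using a by (auto intro: contour_integral_unique)
  then show ?thesis by (simp add: cauchy_transform_def shiftpath_eq)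
qed

lemma conj_transform_half_plane:
  assumes f: "f holomorphic_on \<Omega>" "continuous_on (closure \<Omega>) f"
    and pos: "\<And>w. w \<in> closure \<Omega> \<Longrightarrow> 0 \<le> Re (u * f w)" and z: "z \<in> \<Omega>"
  shows "0 \<le> Re (cnj u * cauchy_transform c (\<lambda>w. cnj (f w)) z)"
proof (rule positive_boundary_liminf_imp_nonneg[OF open_dom bounded_dom _ _ z])
  have cf: "continuous_on (frontier \<Omega>) (\<lambda>w. cnj (f w))"
    by (intro continuous_intros continuous_on_subset[OF f(2)]) (auto simp: frontier_def)
  show "(\<lambda>z. cnj u * cauchy_transform c (\<lambda>w. cnj (f w)) z) holomorphic_on \<Omega>"
    using cf image frontier_not_in
    by (intro holomorphic_intros cauchy_transform_holomorphic[OF loop _ open_dom]) auto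
  fix \<zeta> e assume \<zeta>: "\<zeta> \<in> frontier \<Omega>" and e: "(0 :: real) < e"
  then obtain b where b: "b \<in> {0..1}" "\<zeta> = c b" using image unfolding path_image_def by (metis imageE)
  define a where "a = (if b = 1 then 0 else b)"
  have a: "0 \<le> a" "a < 1" "\<zeta> = c a" using b periodic[of 0] by (auto simp: a_def)
  interpret sh: convex_boundary \<Omega> "\<lambda>t. c (t + a)" p by (rule shifted_boundary[OF a(1,2)])
  from sh.conj_transform_near_start[OF f pos e]
  show "\<exists>d>0. \<forall>z\<in>\<Omega>. dist z \<zeta> < d \<longrightarrow> - e \<le> Re (cnj u * cauchy_transform c (\<lambda>w. cnj (f w)) z)"
    using a cauchy_transform_shift[OF a(1,2) cf] by auto
qed

end

section \<open>A lower bound for a perturbed operator\<close>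

text \<open>With an adjoint one would argue: \<open>F F\<^sup>* F = F S\<^sup>* F - F G F\<close> for \<open>S = F + G\<^sup>*\<close>, \<open>\<parallel>S\<parallel> \<le> 2\<close>, so
  \<open>F - e F G F = F + e F F\<^sup>* F - e F S\<^sup>* F\<close>. Here the operator is tested on a unit vector
  \<open>x\<close> at which \<open>F\<close> nearly attains its norm \<open>k\<close>; there \<open>\<langle>Fz, Fx\<rangle>\<close> is close to \<open>k\<^sup>2 \<langle>z, x\<rangle>\<close> by the
  Cauchy-Schwarz inequality for the positive form \<open>k\<^sup>2 \<langle>u, v\<rangle> - \<langle>Fu, Fv\<rangle>\<close>. The function \<open>lb\<close> is the
  resulting lower bound in terms of \<open>\<parallel>Fx\<parallel>\<close>.\<close>

lemma norm_perturbed_lower_bound: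
  fixes F G :: "'a :: complex_inner \<Rightarrow>\<^sub>L 'a"
  assumes cl: "clinear_op F" and e: "0 \<le> e"
    and pair: "\<And>x y. norm (cinner (F x) y + cinner x (G y)) \<le> 2 * norm x * norm y"
  shows "norm F + e * (norm F)\<^sup>2 * (norm F - 2) \<le> norm (F - e *\<^sub>R (F o\<^sub>L G o\<^sub>L F))"
proof (cases "norm F = 0")
  case False
  define k where "k = norm F"
  have k: "k > 0" using False by (simp add: k_def)
  define N where "N = F - e *\<^sub>R (F o\<^sub>L G o\<^sub>L F)"
  define lb where "lb b = b - e * (k\<^sup>2 * (2 - b) + k * norm G * sqrt (k\<^sup>2 - b\<^sup>2))" for b
  have pf: "positive_form (\<lambda>u v. of_real (k\<^sup>2) * cinner u v - cinner (F u) (F v))"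
    unfolding positive_form_def
  proof (intro conjI allI)
    show "of_real (k\<^sup>2) * cinner (x + y) z - cinner (F (x + y)) (F z) =
        of_real (k\<^sup>2) * cinner x z - cinner (F x) (F z) + (of_real (k\<^sup>2) * cinner y z - cinner (F y) (F z))" for x y z
      by (simp add: cinner_simps blinfun.add_right algebra_simps)
    show "of_real (k\<^sup>2) * cinner (a *\<^sub>C x) y - cinner (F (a *\<^sub>C x)) (F y) =
        a * (of_real (k\<^sup>2) * cinner x y - cinner (F x) (F y))" for a x y
      using cl by (simp add: clinear_op_def cinner_simps algebra_simps)
    show "of_real (k\<^sup>2) * cinner y x - cinner (F y) (F x) =
        cnj (of_real (k\<^sup>2) * cinner x y - cinner (F x) (F y))" for x y
      using cinner_commute[of y x] cinner_commute[of "F y" "F x"] by simp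
    have "(norm (F x))\<^sup>2 \<le> (k * norm x)\<^sup>2" for x
      unfolding k_def by (intro power_mono norm_blinfun norm_ge_zero)
    then show "0 \<le> Re (of_real (k\<^sup>2) * cinner x x - cinner (F x) (F x))" for x
      by (simp add: cinner_self power_mult_distrib flip: of_real_power)
  qed
  have step: "lb (norm (F x)) \<le> norm N" if x: "norm x = 1" and Fx: "F x \<noteq> 0" for x
  proof -
    define b where "b = F x"
    define z where "z = G b"
    have bk: "norm b \<le> k" using norm_blinfun[of F x] x by (simp add: b_def k_def)
    have "(norm (of_real (k\<^sup>2) * cinner z x - cinner (F z) b))\<^sup>2 \<le>
        Re (of_real (k\<^sup>2) * cinner z z - cinner (F z) (F z)) * Re (of_real (k\<^sup>2) * cinner x x - cinner b b)"
      using positive_form_cauchy_schwarz[OF pf, of z x] by (simp add: b_def)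
    also have "\<dots> \<le> (k\<^sup>2 * (norm z)\<^sup>2) * (k\<^sup>2 - (norm b)\<^sup>2)"
    proof -
      have "Re (of_real (k\<^sup>2) * cinner z z - cinner (F z) (F z)) \<le> k\<^sup>2 * (norm z)\<^sup>2"
        by (simp add: cinner_self flip: of_real_power)
      moreover have "Re (of_real (k\<^sup>2) * cinner x x - cinner b b) = k\<^sup>2 - (norm b)\<^sup>2"
        using x by (simp add: cinner_self flip: of_real_power)
      moreover have "(norm b)\<^sup>2 \<le> k\<^sup>2" by (intro power_mono bk norm_ge_zero)
      ultimately show ?thesis by (simp add: mult_right_mono)
    qed
    also have "\<dots> = (k * norm z * sqrt (k\<^sup>2 - (norm b)\<^sup>2))\<^sup>2"
      using power_mono[OF bk norm_ge_zero, of 2] by (simp add: power_mult_distrib)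
    finally have cs: "norm (of_real (k\<^sup>2) * cinner z x - cinner (F z) b) \<le> k * norm z * sqrt (k\<^sup>2 - (norm b)\<^sup>2)"
      by (rule power2_le_imp_le) (use k power_mono[OF bk norm_ge_zero, of 2] in simp)
    also have "\<dots> \<le> k * (norm G * norm b) * sqrt (k\<^sup>2 - (norm b)\<^sup>2)"
      unfolding z_def using k power_mono[OF bk norm_ge_zero, of 2]
      by (intro mult_right_mono mult_left_mono norm_blinfun) auto
    finally have "Re (cinner (F z) b) \<le> Re (of_real (k\<^sup>2) * cinner z x) + k * (norm G * norm b) * sqrt (k\<^sup>2 - (norm b)\<^sup>2)"
      using abs_Re_le_cmod[of "of_real (k\<^sup>2) * cinner z x - cinner (F z) b"] by simp
    moreover have "Re (cinner z x) \<le> 2 * norm b - (norm b)\<^sup>2"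
    proof -
      have "Re (cinner b b + cinner x z) \<le> 2 * norm b"
        using pair[of x b] x complex_Re_le_cmod[of "cinner b b + cinner x z"] by (simp add: b_def z_def)
      moreover have "Re (cinner x z) = Re (cinner z x)" using cinner_commute[of x z] by simp
      ultimately show ?thesis by (simp add: cinner_self flip: of_real_power)
    qed
    then have "Re (of_real (k\<^sup>2) * cinner z x) \<le> k\<^sup>2 * (2 * norm b - (norm b)\<^sup>2)"
      by (simp add: mult_left_mono flip: of_real_power)
    ultimately have "Re (cinner (F z) b) \<le> k\<^sup>2 * (2 * norm b - (norm b)\<^sup>2) + k * (norm G * norm b) * sqrt (k\<^sup>2 - (norm b)\<^sup>2)"
      by simp
    then have "e * Re (cinner (F z) b) \<le>
        e * (k\<^sup>2 * (2 * norm b - (norm b)\<^sup>2) + k * (norm G * norm b) * sqrt (k\<^sup>2 - (norm b)\<^sup>2))"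
      using e by (rule mult_left_mono)
    moreover have "Re (cinner (N x) b) = (norm b)\<^sup>2 - e * Re (cinner (F z) b)"
      by (simp add: N_def blinfun.diff_left blinfun.scaleR_left cinner_simps cinner_scaleR_left cinner_self
          z_def b_def flip: of_real_power)
    moreover have "Re (cinner (N x) b) \<le> norm N * norm b"
      using complex_Re_le_cmod[of "cinner (N x) b"] norm_matrix_element_le[of N x b] x by simp
    ultimately have "(norm b)\<^sup>2 - e * (k\<^sup>2 * (2 * norm b - (norm b)\<^sup>2) + k * (norm G * norm b) * sqrt (k\<^sup>2 - (norm b)\<^sup>2))
        \<le> norm N * norm b" by linarith
    moreover have "(norm b)\<^sup>2 - e * (k\<^sup>2 * (2 * norm b - (norm b)\<^sup>2) + k * (norm G * norm b) * sqrt (k\<^sup>2 - (norm b)\<^sup>2)) =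
        lb (norm b) * norm b"
      unfolding lb_def power2_eq_square[of "norm b"] by (simp add: algebra_simps)
    ultimately have "lb (norm b) * norm b \<le> norm N * norm b" by simp
    moreover have "norm b > 0" using Fx by (simp add: b_def)
    ultimately show ?thesis unfolding b_def by simp
  qed
  have "lb k \<le> norm N"
  proof (rule ccontr)
    assume "\<not> lb k \<le> norm N"
    have "isCont lb k" unfolding lb_def by (intro continuous_intros)
    then obtain d where d: "d > 0" "\<And>b. dist b k < d \<Longrightarrow> dist (lb b) (lb k) < lb k - norm N"
      using \<open>\<not> lb k \<le> norm N\<close> unfolding continuous_at_eps_delta by (metis not_le diff_gt_0_iff_gt)
    define m where "m = max (k - d) 0"
    have m: "0 \<le> m" "m < k" using d k by (auto simp: m_def)
    have "\<exists>x. m * norm x < norm (F x)"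
    proof (rule ccontr)
      assume "\<not> ?thesis"
      then have "norm F \<le> m" by (intro norm_blinfun_bound m) (auto simp: not_less)
      then show False using m by (simp add: k_def)
    qed
    then obtain x where x: "m * norm x < norm (F x)" ..
    then have nx: "norm x > 0" using m by (cases "x = 0") auto
    define v where "v = (1 / norm x) *\<^sub>R x"
    have v: "norm v = 1" using nx by (simp add: v_def)
    have "norm (F v) = norm (F x) / norm x" by (simp add: v_def blinfun.scaleR_right)
    then have Fv: "m < norm (F v)" using x nx by (simp add: pos_less_divide_eq)
    moreover have "norm (F v) \<le> k" using norm_blinfun[of F v] v by (simp add: k_def)
    ultimately have "dist (norm (F v)) k < d" by (auto simp: m_def dist_real_def)
    from d(2)[OF this] have "norm N < lb (norm (F v))" by (auto simp: dist_real_def)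
    moreover have "F v \<noteq> 0" using Fv m by auto
    ultimately show False using step[OF v] by simp
  qed
  then show ?thesis by (simp add: lb_def N_def k_def algebra_simps)
qed simp


section \<open>Positivity of the operator-valued double layer potential\<close>

context operator_in_domain
begin

text \<open>The density, with respect to the parameter \<open>t\<close>, of the form \<open>\<langle>Fx, y\<rangle> + \<langle>x, Gy\<rangle>\<close>; it is
  \<open>(2\<pi>i)\<^sup>-\<^sup>1 (c' R - (c' R)\<^sup>*)\<close> with \<open>R = (c t - A)\<^sup>-\<^sup>1\<close>, written without the adjoint.\<close>

definition bform :: "real \<Rightarrow> 'a \<Rightarrow> 'a \<Rightarrow> complex" where
  "bform t x y = (vector_derivative c (at t) * cinner (resolvent A (c t) x) y -
     cnj (vector_derivative c (at t) * cinner (resolvent A (c t) y) x)) / (2 * of_real pi * \<i>)"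

text \<open>For \<open>v = R x\<close> one has \<open>\<langle>R x, x\<rangle> = \<langle>v, (c t - A) v\<rangle> = \<parallel>v\<parallel>\<^sup>2 cnj (c t - w)\<close> with \<open>w\<close> in the numerical
  range, hence in \<open>\<Omega>\<close>, on the left of the tangent at \<open>c t\<close>.\<close>

lemma positive_form_bform:
  assumes t: "t \<in> {0..1}"
  shows "positive_form (bform t)"
proof -
  let ?V = "vector_derivative c (at t)" and ?R = "resolvent A (c t)"
  have ct: "c t \<notin> spectrum A"
    using frontier_not_in[OF c_in_frontier[OF t]] spectrum_in by auto
  have clR: "clinear_op ?R" by (rule clinear_resolvent[OF clinear ct])
  have pos: "0 \<le> Im (?V * cinner (?R x) x)" for x
  proof (cases "?R x = 0")
    case False
    define v where "v = ?R x"
    have nv: "norm v > 0" using False by (simp add: v_def)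
    define w where "w = cinner (A ((1 / norm v) *\<^sub>R v)) ((1 / norm v) *\<^sub>R v)"
    have "norm ((1 / norm v) *\<^sub>R v) = 1" using nv by simp
    then have "w \<in> numerical_range A" unfolding numerical_range_def w_def by blast
    then have w: "w \<in> \<Omega>" using numrange_in by auto
    have "cinner (r *\<^sub>R a) (r *\<^sub>R b) = of_real (r\<^sup>2) * cinner a b" for r and a b :: 'a
      by (simp add: cinner_simps power2_eq_square flip: scaleC_of_real)
    then have "w = of_real (1 / (norm v)\<^sup>2) * cinner (A v) v"
      by (simp add: w_def blinfun.scaleR_right power_one_over)
    then have Av: "cinner (A v) v = of_real ((norm v)\<^sup>2) * w" using nv by simp
    have "x = c t *\<^sub>C v - A v" using resolvent_apply(1)[OF ct, of x] by (simp add: v_def)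
    from arg_cong[OF this, of "\<lambda>x. cinner x v"]
    have "cinner x v = of_real ((norm v)\<^sup>2) * (c t - w)"
      by (simp add: cinner_simps cinner_self Av algebra_simps)
    then have "cinner v x = of_real ((norm v)\<^sup>2) * cnj (c t - w)"
      using cinner_commute[of v x] by (simp del: of_real_power)
    then have "?V * cinner (?R x) x = of_real ((norm v)\<^sup>2) * (?V * cnj (c t - w))"
      by (simp add: v_def mult_ac)
    then have "Im (?V * cinner (?R x) x) = (norm v)\<^sup>2 * Im (?V * cnj (c t - w))"
      by (simp only: Im_complex_of_real Re_complex_of_real times_complex.sel mult_zero_left add_0_right)
    then show ?thesis using turning[OF w, of t] by (simp only: mult_nonneg_nonneg zero_le_power2 less_imp_le)
  qed simp
  show ?thesis
    unfolding positive_form_def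
  proof (intro conjI allI)
    show "bform t (x + y) z = bform t x z + bform t y z" for x y z
      by (simp add: bform_def blinfun.add_right cinner_simps algebra_simps add_divide_distrib diff_divide_distrib)
    show "bform t (a *\<^sub>C x) y = a * bform t x y" for a x y
      using clR by (simp add: bform_def clinear_op_def cinner_simps right_diff_distrib mult_ac)
    show "bform t y x = cnj (bform t x y)" for x y
      by (simp add: bform_def field_simps)
    fix x
    have "bform t x x = of_real (Im (?V * cinner (?R x) x) / pi)"
    proof -
      have "(q - cnj q) / (2 * of_real pi * \<i>) = of_real (Im q / pi)" for q
        by (simp add: complex_diff_cnj)
      then show ?thesis unfolding bform_def .
    qed
    then show "0 \<le> Re (bform t x x)" using pos[of x] by simp
  qed
qed

lemma bform_integral:
  assumes f: "continuous_on (frontier \<Omega>) f"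
  shows "((\<lambda>t. f (c t) * bform t x y) has_integral
    (contour_integral c (\<lambda>w. f w * cinner (resolvent A w x) y) / (2 * of_real pi * \<i>) +
     cnj (contour_integral c (\<lambda>w. cnj (f w) * cinner (resolvent A w y) x) / (2 * of_real pi * \<i>)))) {0..1}"
proof -
  let ?V = "\<lambda>t. vector_derivative c (at t)"
  let ?I1 = "contour_integral c (\<lambda>w. f w * cinner (resolvent A w x) y)"
  let ?I2 = "contour_integral c (\<lambda>w. cnj (f w) * cinner (resolvent A w y) x)"
  have contR: "continuous_on (frontier \<Omega>) (\<lambda>w. cinner (resolvent A w x) y)" for x y
    by (rule continuous_on_subset[OF holomorphic_on_imp_continuous_on[OF
        resolvent_matrix_element_holomorphic[OF clinear]]]) (use frontier_not_in spectrum_in in auto)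
  have "(\<lambda>w. f w * cinner (resolvent A w x) y) contour_integrable_on c"
    unfolding image[symmetric] using f contR image
    by (intro C1_loop_contour_integrable[OF loop] continuous_intros) auto
  from has_contour_integral_integral[OF this]
  have 1: "((\<lambda>t. f (c t) * cinner (resolvent A (c t) x) y * ?V t) has_integral ?I1) {0..1}"
    by (simp add: has_contour_integral)
  have "(\<lambda>w. cnj (f w) * cinner (resolvent A w y) x) contour_integrable_on c"
    unfolding image[symmetric] using f contR image
    by (intro C1_loop_contour_integrable[OF loop] continuous_intros) auto
  from has_contour_integral_integral[OF this]
  have "((\<lambda>t. cnj (f (c t)) * cinner (resolvent A (c t) y) x * ?V t) has_integral ?I2) {0..1}"
    by (simp add: has_contour_integral)
  from has_integral_linear[OF this bounded_linear_cnj]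
  have 2: "((\<lambda>t. f (c t) * cnj (cinner (resolvent A (c t) y) x) * cnj (?V t)) has_integral cnj ?I2) {0..1}"
    by (simp add: o_def)
  have val: "(?I1 - cnj ?I2) / (2 * of_real pi * \<i>) =
      ?I1 / (2 * of_real pi * \<i>) + cnj (?I2 / (2 * of_real pi * \<i>))"
    by (simp add: diff_divide_distrib)
  from has_integral_divide[OF has_integral_diff[OF 1 2], of "2 * of_real pi * \<i>"]
  show ?thesis
    unfolding val by (simp add: bform_def right_diff_distrib mult_ac)
qed

lemma bform_mass: "((\<lambda>t. Re (bform t x x)) has_integral 2 * (norm x)\<^sup>2) {0..1}"
proof -
  have "((\<lambda>t. 1 * bform t x x) has_integral
      (contour_integral c (\<lambda>w. 1 * cinner (resolvent A w x) x) / (2 * of_real pi * \<i>) +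
       cnj (contour_integral c (\<lambda>w. cnj 1 * cinner (resolvent A w x) x) / (2 * of_real pi * \<i>)))) {0..1}"
    by (rule bform_integral) simp
  then have "((\<lambda>t. bform t x x) has_integral of_real (2 * (norm x)\<^sup>2)) {0..1}"
    by (simp add: resolvent_boundary_integral cinner_self)
  from has_integral_linear[OF this bounded_linear_Re] show ?thesis by (simp add: o_def)
qed

lemma calc_pair_bound:
  assumes f: "f holomorphic_on \<Omega>" "continuous_on (closure \<Omega>) f"
    and f1: "\<And>z. z \<in> closure \<Omega> \<Longrightarrow> norm (f z) \<le> 1"
  shows "norm (cinner (calc f x) y + cinner x (calc (cauchy_transform c (\<lambda>w. cnj (f w))) y)) \<le> 2 * norm x * norm y"
proof -
  let ?G = "calc (cauchy_transform c (\<lambda>w. cnj (f w)))"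
  have cf: "continuous_on (frontier \<Omega>) f"
    by (rule continuous_on_subset[OF f(2)]) (auto simp: frontier_def)
  have unit: "norm (cinner (calc f x) y + cinner x (?G y)) \<le> (norm x)\<^sup>2 + (norm y)\<^sup>2" for x y
  proof -
    have "cinner x (?G y) = cnj (cinner (?G y) x)" by (rule cinner_commute)
    then have I: "((\<lambda>t. f (c t) * bform t x y) has_integral (cinner (calc f x) y + cinner x (?G y))) {0..1}"
      using bform_integral[OF cf, of x y] calc_boundary[OF f, of x y] calc_cauchy_transform[of "\<lambda>w. cnj (f w)" y x] cf
      by (simp add: continuous_on_cnj)
    have J: "((\<lambda>t. (Re (bform t x x) + Re (bform t y y)) / 2) has_integral
        ((2 * (norm x)\<^sup>2 + 2 * (norm y)\<^sup>2) / 2)) {0..1}"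
      by (intro has_integral_divide has_integral_add bform_mass)
    have "norm (integral {0..1} (\<lambda>t. f (c t) * bform t x y)) \<le>
        integral {0..1} (\<lambda>t. (Re (bform t x x) + Re (bform t y y)) / 2)"
    proof (rule integral_norm_bound_integral)
      fix t :: real assume t: "t \<in> {0..1}"
      have "norm (f (c t)) * norm (bform t x y) \<le> 1 * ((Re (bform t x x) + Re (bform t y y)) / 2)"
        by (intro mult_mono f1 frontier_closure c_in_frontier t positive_form_norm_le positive_form_bform) auto
      then show "norm (f (c t) * bform t x y) \<le> (Re (bform t x x) + Re (bform t y y)) / 2"
        by (simp add: norm_mult)
    qed (use I J in blast)+
    then show ?thesis using integral_unique[OF I] integral_unique[OF J] by simp
  qed
  show ?thesis
  proof (cases "x = 0 \<or> y = 0")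
    case False
    then have n: "norm x > 0" "norm y > 0" by auto
    let ?x = "(1 / norm x) *\<^sub>R x" and ?y = "(1 / norm y) *\<^sub>R y"
    have sc: "cinner a (r *\<^sub>R b) = r *\<^sub>R cinner a b" for r and a b :: 'a
      by (simp add: cinner_simps scaleR_conv_of_real flip: scaleC_of_real)
    have "cinner (calc f ?x) ?y + cinner ?x (?G ?y) =
        (1 / (norm x * norm y)) *\<^sub>R (cinner (calc f x) y + cinner x (?G y))"
      by (simp add: blinfun.scaleR_right cinner_scaleR_left sc scaleR_add_right mult.commute)
    then have "norm (cinner (calc f ?x) ?y + cinner ?x (?G ?y)) =
        norm (cinner (calc f x) y + cinner x (?G y)) / (norm x * norm y)"
      using n by simp
    moreover have "norm (cinner (calc f ?x) ?y + cinner ?x (?G ?y)) \<le> 2"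
      using unit[of ?x ?y] n by simp
    ultimately show ?thesis using n by (simp add: field_simps)
  qed (auto simp: blinfun.zero_right)
qed


section \<open>The extremal argument\<close>

definition quarter_class :: "(complex \<Rightarrow> complex) set" where
  "quarter_class = {f. f holomorphic_on \<Omega> \<and>
     (\<forall>z\<in>\<Omega>. norm (f z) \<le> 1 \<and> 0 \<le> Re (f z) \<and> 0 \<le> Im (f z))}"

lemma quarter_class_closure:
  assumes "f \<in> quarter_class" "continuous_on (closure \<Omega>) f" "z \<in> closure \<Omega>"
  shows "norm (f z) \<le> 1" "0 \<le> Re (f z)" "0 \<le> Im (f z)"
proof -
  have c: "continuous_on (closure \<Omega>) (\<lambda>z. norm (f z))" "continuous_on (closure \<Omega>) (\<lambda>z. Re (f z))"
    "continuous_on (closure \<Omega>) (\<lambda>z. Im (f z))"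
    by (intro continuous_intros assms)+
  show "norm (f z) \<le> 1"
    by (rule continuous_le_on_closure[OF c(1) assms(3)]) (use assms(1) in \<open>auto simp: quarter_class_def\<close>)
  show "0 \<le> Re (f z)"
    by (rule continuous_ge_on_closure[OF c(2) assms(3)]) (use assms(1) in \<open>auto simp: quarter_class_def\<close>)
  show "0 \<le> Im (f z)"
    by (rule continuous_ge_on_closure[OF c(3) assms(3)]) (use assms(1) in \<open>auto simp: quarter_class_def\<close>)
qed

lemma quarter_flow:
  fixes a b :: complex and e :: real
  assumes a: "0 \<le> Re a" "0 \<le> Im a" and b: "0 \<le> Re b" "Im b \<le> 0" and e: "0 \<le> e"
  defines "q \<equiv> a / (1 + of_real e * a * b)"
  shows "1 + of_real e * a * b \<noteq> 0" "norm q \<le> norm a" "0 \<le> Re q" "0 \<le> Im q"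
proof -
  let ?d = "1 + of_real e * a * b"
  have "0 \<le> Re a * Re b" "Im a * Im b \<le> 0" using a b by (auto simp: mult_nonneg_nonpos)
  then have "0 \<le> Re (a * b)" by simp
  then have "0 \<le> e * Re (a * b)" using e by simp
  moreover have "Re ?d = 1 + e * Re (a * b)" by (simp add: algebra_simps)
  ultimately have d: "1 \<le> Re ?d" by simp
  then have nd: "1 \<le> norm ?d" using complex_Re_le_cmod[of ?d] by linarith
  then show nz: "?d \<noteq> 0" by auto
  have "norm a * 1 \<le> norm a * norm ?d" by (rule mult_left_mono[OF nd]) simp
  then show "norm q \<le> norm a"
    unfolding q_def norm_divide using nd by (simp add: divide_le_eq)
  have eq: "a * cnj ?d = a + of_real (e * (norm a)\<^sup>2) * cnj b"
  proof -
    have "a * cnj ?d = a + of_real e * (a * cnj a) * cnj b" by (simp add: algebra_simps)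
    then show ?thesis by (simp only: complex_norm_square[symmetric] of_real_mult)
  qed
  have w: "0 \<le> e * (norm a)\<^sup>2" using e by simp
  have "0 \<le> Re (a * cnj ?d)" unfolding eq using a b w by simp
  moreover have "0 \<le> Im (a * cnj ?d)" unfolding eq using a mult_nonneg_nonpos[OF w b(2)] by simp
  moreover have "q = a * cnj ?d / of_real ((norm ?d)\<^sup>2)"
    unfolding q_def complex_div_cnj[of a] by simp
  ultimately show "0 \<le> Re q" "0 \<le> Im q" by (simp_all only: Re_divide_of_real Im_divide_of_real zero_le_power2 divide_nonneg_nonneg)
qed

text \<open>The function \<open>q = f / (1 + e f g)\<close> satisfies \<open>q = f - e f g q\<close>; substituting this into itself gives
  the second order expansion of \<open>q(A)\<close> without inverting \<open>1 + e F G\<close>.\<close>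

lemma quarter_class_step:
  assumes f: "f \<in> quarter_class" "continuous_on (closure \<Omega>) f"
    and C: "0 < C" "\<And>f M. f holomorphic_on \<Omega> \<Longrightarrow>
      (\<And>z. z \<in> path_image (dil r0 \<circ> c) \<Longrightarrow> norm (f z) \<le> M) \<Longrightarrow> norm (calc f) \<le> C * M"
    and K: "\<And>h. h \<in> quarter_class \<Longrightarrow> norm (calc h) \<le> K" and e: "0 \<le> e"
  shows "norm (calc f) + e * (norm (calc f))\<^sup>2 * (norm (calc f) - 2) \<le> K + e\<^sup>2 * (9 * C ^ 5)"
proof -
  have hf: "f holomorphic_on \<Omega>" using f by (simp add: quarter_class_def)
  note cl = quarter_class_closure[OF f]
  define g where "g = cauchy_transform c (\<lambda>w. cnj (f w))"
  have hg: "g holomorphic_on \<Omega>"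
    unfolding g_def using f(2) image frontier_not_in
    by (intro cauchy_transform_holomorphic[OF loop _ open_dom])
      (auto intro!: continuous_on_cnj elim: continuous_on_subset simp: frontier_def)
  have g3: "norm (g z) \<le> 3" if "z \<in> \<Omega>" for z
    using conj_transform_bound[OF hf f(2) that cl(1)] by (simp add: g_def)
  have gre: "0 \<le> Re (g z)" if "z \<in> \<Omega>" for z
    using conj_transform_half_plane[OF hf f(2), of 1 z] cl(2) that by (simp add: g_def)
  have gim: "Im (g z) \<le> 0" if "z \<in> \<Omega>" for z
    using conj_transform_half_plane[OF hf f(2), of "- \<i>" z] cl(3) that by (simp add: g_def)
  have ab: "0 \<le> Re (f z)" "0 \<le> Im (f z)" "norm (f z) \<le> 1" if "z \<in> \<Omega>" for z
    using f that by (auto simp: quarter_class_def)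
  define q where "q z = f z / (1 + of_real e * f z * g z)" for z
  have nz: "1 + of_real e * f z * g z \<noteq> 0" if "z \<in> \<Omega>" for z
    by (rule quarter_flow(1)) (use ab gre gim e that in auto)
  have hq: "q holomorphic_on \<Omega>"
    unfolding q_def using nz by (intro holomorphic_intros hf hg) auto
  have q: "q \<in> quarter_class"
    unfolding quarter_class_def
  proof (intro CollectI conjI ballI hq)
    fix z assume z: "z \<in> \<Omega>"
    note qf = quarter_flow[OF ab(1,2)[OF z] gre[OF z] gim[OF z] e]
    show "norm (q z) \<le> 1" using qf(2) ab(3)[OF z] unfolding q_def by linarith
    show "0 \<le> Re (q z)" "0 \<le> Im (q z)" unfolding q_def by (rule qf(3), rule qf(4))
  qed
  define F where "F = calc f"
  define G where "G = calc g"
  define P where "P = calc q"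
  have "calc q = calc (\<lambda>z. f z - of_real e * (f z * (g z * q z)))"
  proof (rule calc_cong[OF hq])
    fix z assume "z \<in> \<Omega>"
    then have d: "1 + of_real e * f z * g z \<noteq> 0" by (rule nz)
    have "q z * (1 + of_real e * f z * g z) = f z" unfolding q_def using d by simp
    then show "q z = f z - of_real e * (f z * (g z * q z))" by (simp add: algebra_simps)
  qed
  also have "\<dots> = calc f - scaleC_op (of_real e) (calc f o\<^sub>L (calc g o\<^sub>L calc q))"
    by (simp add: calc_diff calc_scale calc_mult holomorphic_intros hf hg hq)
  finally have "P = F - scaleC_op (of_real e) (F o\<^sub>L (G o\<^sub>L P))"
    unfolding P_def F_def G_def .
  from arg_cong[OF this, of blinfun_apply]
  have P: "P x = F x - e *\<^sub>R F (G (P x))" for x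
    by (metis blinfun.diff_left scaleC_op_apply scaleC_of_real blinfun_apply_blinfun_compose)
  have expand: "P x = F x - e *\<^sub>R F (G (F x)) + e\<^sup>2 *\<^sub>R F (G (F (G (P x))))" for x
    by (subst (1) P, subst (1) P)
      (simp add: blinfun.diff_right blinfun.scaleR_right scaleR_diff_right power2_eq_square)
  have "F - e *\<^sub>R (F o\<^sub>L G o\<^sub>L F) = P - e\<^sup>2 *\<^sub>R (F o\<^sub>L (G o\<^sub>L (F o\<^sub>L (G o\<^sub>L P))))"
    unfolding eq_diff_eq
    by (intro blinfun_eqI) (simp only: blinfun.diff_left blinfun.add_left blinfun.scaleR_left
        blinfun_apply_blinfun_compose expand[symmetric])
  then have "norm (F - e *\<^sub>R (F o\<^sub>L G o\<^sub>L F)) \<le> norm P + e\<^sup>2 * norm (F o\<^sub>L (G o\<^sub>L (F o\<^sub>L (G o\<^sub>L P))))"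
    using norm_triangle_ineq4[of P "e\<^sup>2 *\<^sub>R (F o\<^sub>L (G o\<^sub>L (F o\<^sub>L (G o\<^sub>L P))))"] by simp
  also have "\<dots> \<le> K + e\<^sup>2 * (9 * C ^ 5)"
  proof -
    have im: "path_image (dil r0 \<circ> c) \<subseteq> \<Omega>" by (rule image_dil_subset[OF r0(1,2)])
    have nF: "norm F \<le> C" unfolding F_def using C(2)[OF hf, of 1] ab(3) im by auto
    have nP: "norm P \<le> C" unfolding P_def using C(2)[OF hq, of 1] q im by (auto simp: quarter_class_def)
    (* the factor 3 is the bound for the transform g *)
    have nG: "norm G \<le> C * 3" unfolding G_def using g3 im by (intro C(2)[OF hg]) auto
    have comp: "norm (S o\<^sub>L T) \<le> s * t" if "norm S \<le> s" "norm T \<le> t" for S T :: "'a \<Rightarrow>\<^sub>L 'a" and s t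
      using that order_trans[OF norm_ge_zero that(1)]
      by (intro order_trans[OF norm_blinfun_compose] mult_mono) auto
    have "norm (F o\<^sub>L (G o\<^sub>L (F o\<^sub>L (G o\<^sub>L P)))) \<le> C * (C * 3 * (C * (C * 3 * C)))"
      by (intro comp nF nG nP)
    also have "\<dots> = 9 * C ^ 5" by (simp add: power_numeral_reduce)
    finally show ?thesis unfolding P_def by (intro add_mono K q mult_left_mono) auto
  qed
  finally have "norm (F - e *\<^sub>R (F o\<^sub>L G o\<^sub>L F)) \<le> K + e\<^sup>2 * (9 * C ^ 5)" .
  moreover have "norm F + e * (norm F)\<^sup>2 * (norm F - 2) \<le> norm (F - e *\<^sub>R (F o\<^sub>L G o\<^sub>L F))"
    unfolding F_def G_def g_def
    by (rule norm_perturbed_lower_bound[OF clinear_calc[OF hf] e calc_pair_bound[OF hf f(2) cl(1)]])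
  ultimately show ?thesis by (simp add: F_def)
qed

text \<open>The flow leads out of the functions continuous up to the boundary, while the transform \<open>g\<close> is
  only available for these. Dilation returns to them at arbitrarily small cost.\<close>

lemma quarter_class_dilation:
  assumes f: "f \<in> quarter_class" and e: "0 < e"
  shows "\<exists>h\<in>quarter_class. continuous_on (closure \<Omega>) h \<and> norm (calc f) - e < norm (calc h)"
proof -
  have hf: "f holomorphic_on \<Omega>" using f by (simp add: quarter_class_def)
  obtain C where C: "0 < C" "\<And>f M. f holomorphic_on \<Omega> \<Longrightarrow>
      (\<And>z. z \<in> path_image (dil r0 \<circ> c) \<Longrightarrow> norm (f z) \<le> M) \<Longrightarrow> norm (calc f) \<le> C * M"
    using calc_bound by metis
  let ?I = "path_image (dil r0 \<circ> c)"
  have cI: "compact ?I" by (rule compact_valid_path_image[OF C1_loop_valid(1)[OF loop_dil(1)]])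
  have im: "?I \<subseteq> \<Omega>" by (rule image_dil_subset[OF r0(1,2)])
  define T where "T = (\<lambda>(s, z). dil s z) ` ({0..1} \<times> ?I)"
  have "continuous_on S (\<lambda>q. dil (fst q) (snd q))" for S
    unfolding dil_def by (intro continuous_intros)
  then have "compact T"
    unfolding T_def case_prod_beta
    by (intro compact_continuous_image compact_Times cI compact_Icc)
  have TO: "T \<subseteq> \<Omega>" using im by (auto simp: T_def intro!: dil_mem)
  have "uniformly_continuous_on T f"
    by (rule compact_uniformly_continuous[OF continuous_on_subset[OF holomorphic_on_imp_continuous_on[OF hf] TO] \<open>compact T\<close>])
  then obtain d where d: "d > 0" "\<And>z w. z \<in> T \<Longrightarrow> w \<in> T \<Longrightarrow> dist z w < d \<Longrightarrow> dist (f z) (f w) < e / (2 * C)"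
    unfolding uniformly_continuous_on_def using e C(1) by (metis divide_pos_pos mult_pos_pos zero_less_numeral)
  obtain B where B: "B > 0" "\<And>z. z \<in> ?I \<Longrightarrow> norm (z - p) \<le> B"
    using compact_imp_bounded[OF compact_translation_subtract[OF cI, of p]]
    by (auto simp: bounded_pos)
  define s where "s = max 0 (1 - d / (2 * B))"
  have s: "0 \<le> s" "s < 1" "(1 - s) * B < d" using d B by (auto simp: s_def max_def field_simps)
  define h where "h z = f (dil s z)" for z
  have ds: "dil s z \<in> \<Omega>" if "z \<in> closure \<Omega>" for z by (rule dil_closure[OF that s(1,2)])
  have ds': "dil s z \<in> \<Omega>" if "z \<in> \<Omega>" for z using ds that closure_subset by auto
  have "(f \<circ> dil s) holomorphic_on \<Omega>"
    by (rule holomorphic_on_compose_gen[OF dil_holomorphic hf]) (use ds' in auto)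
  moreover have "h = f \<circ> dil s" by (auto simp: h_def)
  ultimately have hh: "h holomorphic_on \<Omega>" by simp
  have "h \<in> quarter_class" using f hh ds' by (auto simp: quarter_class_def h_def)
  moreover have "continuous_on (closure \<Omega>) h"
    unfolding h_def
    by (rule continuous_on_compose2[OF holomorphic_on_imp_continuous_on[OF hf]])
      (use ds in \<open>auto intro: continuous_on_dil continuous_on_id\<close>)
  moreover have "norm (calc (\<lambda>z. f z - h z)) \<le> C * (e / (2 * C))"
  proof (rule C(2))
    show "(\<lambda>z. f z - h z) holomorphic_on \<Omega>" by (intro holomorphic_intros hf hh)
    fix z assume z: "z \<in> ?I"
    have "dil r z \<in> T" if "0 \<le> r" "r \<le> 1" for r
      unfolding T_def by (rule image_eqI[of _ _ "(r, z)"]) (use that z in auto)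
    from this[of 1] this[of s] have zT: "z \<in> T" "dil s z \<in> T" using s by simp_all
    have "dist z (dil s z) = (1 - s) * norm (z - p)"
    proof -
      have "z - dil s z = of_real (1 - s) * (z - p)" by (simp add: dil_def algebra_simps)
      then show ?thesis using s by (simp only: dist_norm norm_mult norm_of_real)
    qed
    also have "\<dots> \<le> (1 - s) * B" using B(2)[OF z] s by (intro mult_left_mono) auto
    also have "\<dots> < d" by (rule s)
    finally have "dist (f z) (f (dil s z)) < e / (2 * C)" by (rule d(2)[OF zT])
    then show "norm (f z - h z) \<le> e / (2 * C)" by (simp add: h_def dist_norm)
  qed
  then have "norm (calc f - calc h) \<le> e / 2" using C(1) by (simp add: calc_diff[OF hf hh])
  then have "norm (calc f) - e < norm (calc h)"
    using norm_triangle_ineq2[of "calc f" "calc h"] e by linarith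
  ultimately show ?thesis by blast
qed

lemma quarter_class_norm_le_2:
  assumes "f \<in> quarter_class"
  shows "norm (calc f) \<le> 2"
proof -
  obtain C where C: "0 < C" "\<And>f M. f holomorphic_on \<Omega> \<Longrightarrow>
      (\<And>z. z \<in> path_image (dil r0 \<circ> c) \<Longrightarrow> norm (f z) \<le> M) \<Longrightarrow> norm (calc f) \<le> C * M"
    using calc_bound by metis
  have im: "path_image (dil r0 \<circ> c) \<subseteq> \<Omega>" by (rule image_dil_subset[OF r0(1,2)])
  define X where "X = (\<lambda>h. norm (calc h)) ` quarter_class"
  have bdd: "bdd_above X"
  proof (rule bdd_aboveI)
    fix x assume "x \<in> X"
    then obtain h where h: "h \<in> quarter_class" "x = norm (calc h)" by (auto simp: X_def)
    show "x \<le> C * 1" unfolding h(2) using h(1) im by (intro C(2)) (auto simp: quarter_class_def)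
  qed
  define K where "K = Sup X"
  have K: "norm (calc h) \<le> K" if "h \<in> quarter_class" for h
    unfolding K_def by (rule cSup_upper[OF _ bdd]) (use that in \<open>auto simp: X_def\<close>)
  have "K \<le> 2"
  proof (rule ccontr)
    assume "\<not> K \<le> 2"
    (* e is chosen so that the gain 2 e (K - 2) exceeds the loss e^2 (D + 1) *)
    define D where "D = 9 * C ^ 5"
    have D: "D \<ge> 0" using C by (simp add: D_def)
    define e where "e = (K - 2) / (D + 1)"
    have e: "e > 0" "e * (D + 1) = K - 2" using \<open>\<not> K \<le> 2\<close> D by (auto simp: e_def)
    (* the first bound makes the defect n of order e^2, the second one keeps k - 2 above (K - 2) / 2 *)
    define n where "n = min (e\<^sup>2) ((K - 2) / 2)"
    have n: "n > 0" "n \<le> e\<^sup>2" "n \<le> (K - 2) / 2" 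
      using e \<open>\<not> K \<le> 2\<close> unfolding n_def by (simp, simp, intro min.cobounded2)
    have "X \<noteq> {}" using assms by (auto simp: X_def)
    then obtain h0 where h0: "h0 \<in> quarter_class" "K - n / 2 < norm (calc h0)"
      using less_cSupD[of X "K - n / 2"] n unfolding K_def X_def by auto
    obtain h where h: "h \<in> quarter_class" "continuous_on (closure \<Omega>) h"
      "norm (calc h0) - n / 2 < norm (calc h)"
      using quarter_class_dilation[OF h0(1), of "n / 2"] n by auto
    define k where "k = norm (calc h)"
    have k: "K - n < k" using h h0 by (simp add: k_def)
    have step: "k + e * k\<^sup>2 * (k - 2) \<le> K + e\<^sup>2 * D"
      unfolding k_def D_def by (rule quarter_class_step[OF h(1,2) C K]) (use e in auto)
    have k2: "(K - 2) / 2 \<le> k - 2" "2 \<le> k" using k n \<open>\<not> K \<le> 2\<close> by auto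
    then have "4 \<le> k\<^sup>2" using power_mono[of 2 k 2] by simp
    then have "4 * ((K - 2) / 2) \<le> k\<^sup>2 * (k - 2)"
      using k2 \<open>\<not> K \<le> 2\<close> by (intro mult_mono) auto
    then have "e * (2 * (K - 2)) \<le> e * (k\<^sup>2 * (k - 2))" using e by (intro mult_left_mono) auto
    then have "e * (2 * (K - 2)) \<le> e\<^sup>2 + e\<^sup>2 * D" using step k n by (simp add: mult.assoc)
    also have "\<dots> = e * (e * (D + 1))" by (simp add: power2_eq_square algebra_simps)
    finally have "2 * (K - 2) \<le> K - 2" using e by simp
    then show False using \<open>\<not> K \<le> 2\<close> by simp
  qed
  then show ?thesis using K[OF assms] by simp
qed

end

section \<open>Orientation of the boundary\<close>

lemma periodic_reduce:
  fixes c :: "real \<Rightarrow> 'b"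
  assumes per: "\<And>t. c (t + 1) = c t"
  shows "c t = c (frac t)"
proof -
  have up: "c (s + real n) = c s" for s n
  proof (induction n)
    case (Suc n)
    then show ?case using per[of "s + real n"] by (simp add: add_ac)
  qed simp
  show ?thesis
  proof (cases "0 \<le> \<lfloor>t\<rfloor>")
    case True
    then show ?thesis using up[of "frac t" "nat \<lfloor>t\<rfloor>"] by (simp add: frac_def)
  next
    case False
    then show ?thesis using up[of t "nat (- \<lfloor>t\<rfloor>)"] by (simp add: frac_def)
  qed
qed

text \<open>The supporting line of \<open>\<Omega>\<close> at \<open>c t\<close> contains the tangent direction, as a linear functional
  attains its minimum over the curve there.\<close>

lemma boundary_tangent_transversal:
  assumes \<Omega>: "open \<Omega>" "convex \<Omega>" and z: "z \<in> \<Omega>"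
    and der: "(c has_vector_derivative V) (at t)" and V: "V \<noteq> 0"
    and c: "\<And>s. c s \<in> frontier \<Omega>"
  shows "Im (V * cnj (c t - z)) \<noteq> 0"
proof
  assume 0: "Im (V * cnj (c t - z)) = 0"
  have ri: "rel_interior \<Omega> = \<Omega>" by (rule rel_interior_open[OF \<Omega>(1)])
  have ct: "c t \<in> closure \<Omega>" "c t \<notin> rel_interior \<Omega>"
    using c[of t] \<Omega>(1) by (auto simp: frontier_def ri interior_open)
  obtain a where a: "a \<noteq> 0" "\<And>y. y \<in> closure \<Omega> \<Longrightarrow> a \<bullet> c t \<le> a \<bullet> y"
    "\<And>y. y \<in> rel_interior \<Omega> \<Longrightarrow> a \<bullet> c t < a \<bullet> y"
    using supporting_hyperplane_relative_frontier[OF \<Omega>(2) ct] by metis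
  have "((\<lambda>s. a \<bullet> c s) has_vector_derivative a \<bullet> V) (at t)"
    by (rule bounded_linear.has_vector_derivative[OF bounded_linear_inner_right der])
  then have "((\<lambda>s. a \<bullet> c s) has_real_derivative a \<bullet> V) (at t)"
    by (simp add: has_real_derivative_iff_has_vector_derivative)
  then have aV: "a \<bullet> V = 0"
    by (rule DERIV_local_min[of _ _ _ 1]) (use a(2) c in \<open>auto simp: frontier_def\<close>)
  have "a \<bullet> c t < a \<bullet> z" using a(3)[of z] z by (simp add: ri)
  then have neg: "a \<bullet> (c t - z) < 0" by (simp add: inner_diff_right)
  (* Lagrange's identity for two pairs of plane vectors *)
  have "(V \<bullet> V) * (a \<bullet> (c t - z)) =
      (a \<bullet> V) * ((c t - z) \<bullet> V) + (Im a * Re V - Re a * Im V) * (- Im (V * cnj (c t - z)))"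
    by (simp add: inner_complex_def algebra_simps)
  then have "(V \<bullet> V) * (a \<bullet> (c t - z)) = 0" using aV 0 by simp
  then show False using V neg by simp
qed

text \<open>The expression is continuous in \<open>t\<close> and never vanishes, so its sign is constant; a negative sign
  would make the winding number negative.\<close>

lemma boundary_turning:
  assumes \<Omega>: "open \<Omega>" "convex \<Omega>" and z: "z \<in> \<Omega>" and loop: "C1_loop c"
    and V: "\<And>t. vector_derivative c (at t) \<noteq> 0"
    and c: "\<And>s. c s \<in> frontier \<Omega>" and wn: "winding_number c z = 1"
  shows "0 < Im (vector_derivative c (at t) * cnj (c t - z))"
proof (rule ccontr)
  let ?D = "\<lambda>t. Im (vector_derivative c (at t) * cnj (c t - z))"
  assume "\<not> 0 < ?D t"
  have nz: "?D s \<noteq> 0" for s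
    using loop by (intro boundary_tangent_transversal[OF \<Omega> z _ V c])
      (simp add: C1_loop_def vector_derivative_works)
  have contD: "continuous_on UNIV ?D"
    using loop by (intro continuous_intros C1_loop_valid(5)[OF loop]) (simp add: C1_loop_def)
  have neg: "?D s < 0" for s
  proof (rule ccontr)
    assume "\<not> ?D s < 0"
    moreover have "connected (range ?D)" by (rule connected_continuous_image[OF contD]) simp
    ultimately have "0 \<in> range ?D"
      using connectedD_interval[of "range ?D" "?D t" "?D s" 0] \<open>\<not> 0 < ?D t\<close> by auto
    then show False using nz by auto
  qed
  have zc: "z \<notin> path_image c"
    using c z \<Omega>(1) by (auto simp: path_image_def frontier_def interior_open)
  have "((\<lambda>w. 1 / (w - z)) has_contour_integral 2 * of_real pi * \<i>) c"
    using has_contour_integral_winding_number[OF C1_loop_valid(1)[OF loop] zc] wn by simp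
  then have "((\<lambda>s. 1 / (c s - z) * vector_derivative c (at s)) has_integral 2 * of_real pi * \<i>) {0..1}"
    by (simp add: has_contour_integral)
  from has_integral_linear[OF this bounded_linear_Im]
  have "((\<lambda>s. Im (1 / (c s - z) * vector_derivative c (at s))) has_integral 2 * pi) {0..1}"
    by (simp add: o_def)
  from has_integral_neg[OF this]
  have I: "((\<lambda>s. - Im (1 / (c s - z) * vector_derivative c (at s))) has_integral - (2 * pi)) {0..1}" .
  have "0 \<le> - (2 * pi)"
  proof (rule has_integral_nonneg[OF I])
    fix s
    have "Im (1 / (c s - z) * vector_derivative c (at s)) =
        ?D s / ((Re (c s - z))\<^sup>2 + (Im (c s - z))\<^sup>2)"
      unfolding times_divide_eq_left mult_1_left Im_divide by (simp add: algebra_simps)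
    moreover have "\<dots> \<le> 0" using neg[of s] by (intro divide_nonpos_nonneg) auto
    ultimately show "0 \<le> - Im (1 / (c s - z) * vector_derivative c (at s))" by simp
  qed
  then show False using pi_gt_zero by linarith
qed

text \<open>A simple closed curve winds around its inside \<open>\<Omega>\<close> once, in one direction or the other; in the
  second case it is reversed.\<close>

lemma convex_boundary_exists:
  assumes \<Omega>: "open \<Omega>" "convex \<Omega>" "bounded \<Omega>" and p: "p \<in> \<Omega>" and smooth: "smooth_boundary \<Omega>"
  obtains c where "convex_boundary \<Omega> c p"
proof -
  obtain b where b: "smooth_curve b" "\<And>t. b (t + 1) = b t" "inj_on b {0..<1}"
    "\<And>t. vector_derivative b (at t) \<noteq> 0" "b ` {0..<1} = frontier \<Omega>"
    using smooth unfolding smooth_boundary_def by blast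
  have db: "b differentiable_on UNIV" "(\<lambda>t. vector_derivative b (at t)) differentiable_on UNIV"
    using spec[OF b(1)[unfolded smooth_curve_def], of 0] spec[OF b(1)[unfolded smooth_curve_def], of 1]
    by simp_all
  have bper: "b 1 = b 0" using b(2)[of 0] by simp
  have lb: "C1_loop b"
    using db bper unfolding C1_loop_def differentiable_on_def
    by (simp add: pathfinish_def pathstart_def differentiable_imp_continuous_on differentiable_on_def)
  have bf: "b t \<in> frontier \<Omega>" for t
    using periodic_reduce[of b t] b(2,5) frac_ge_0[of t] frac_lt_1[of t] by (metis atLeastLessThan_iff image_eqI)
  have simple_image: "path_image b = frontier \<Omega>"
  proof
    show "path_image b \<subseteq> frontier \<Omega>" using bf by (auto simp: path_image_def)
    show "frontier \<Omega> \<subseteq> path_image b" unfolding b(5)[symmetric] path_image_def by auto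
  qed
  have "loop_free b"
    unfolding loop_free_def
  proof (intro ballI impI)
    fix x y :: real assume xy: "x \<in> {0..1}" "y \<in> {0..1}" "b x = b y"
    define red where "red x = (if x < 1 then x else 0)" for x :: real
    have "b (red x) = b x" if "x \<in> {0..1}" for x
      using bper that by (cases "x = 1") (auto simp: red_def)
    then have "b (red x) = b (red y)" using xy by simp
    moreover have "red x \<in> {0..<1}" "red y \<in> {0..<1}" using xy by (auto simp: red_def)
    ultimately have "red x = red y" using b(3) by (auto dest: inj_onD)
    then show "x = y \<or> x = 0 \<and> y = 1 \<or> x = 1 \<and> y = 0" using xy by (auto simp: red_def split: if_splits)
  qed
  then have sb: "simple_path b" by (simp add: simple_path_def C1_loop_valid(3)[OF lb])
  have ins: "inside (path_image b) = \<Omega>"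
    using inside_frontier_eq_interior[OF \<Omega>(3,2)] \<Omega>(1) by (simp add: simple_image interior_open)
  have build: "convex_boundary \<Omega> c p"
    if "C1_loop c" "\<And>t. c (t + 1) = c t" "simple_path c" "path_image c = frontier \<Omega>"
      "\<And>z. z \<in> \<Omega> \<Longrightarrow> winding_number c z = 1" "\<And>t. vector_derivative c (at t) \<noteq> 0" for c
  proof -
    have cf: "c t \<in> frontier \<Omega>" for t
      unfolding that(4)[symmetric] path_image_def
      by (subst periodic_reduce[where c = c, OF that(2)]) (use frac_ge_0[of t] frac_lt_1[of t] in \<open>auto intro!: imageI\<close>)
    show ?thesis
    proof
      show "inj_on c {0..<1}"
      proof (rule inj_onI)
        fix s t :: real assume st: "s \<in> {0..<1}" "t \<in> {0..<1}" "c s = c t"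
        then have "s \<in> {0..1}" "t \<in> {0..1}" by auto
        then have "s = t \<or> s = 0 \<and> t = 1 \<or> s = 1 \<and> t = 0"
          using that(3) st(3) unfolding simple_path_def loop_free_def by blast
        then show "s = t" using st by auto
      qed
      show "0 < Im (vector_derivative c (at t) * cnj (c t - z))" if "z \<in> \<Omega>" for z t
        by (rule boundary_turning[OF \<Omega>(1,2) that \<open>C1_loop c\<close> \<open>\<And>t. vector_derivative c (at t) \<noteq> 0\<close> cf])
          (rule \<open>\<And>z. z \<in> \<Omega> \<Longrightarrow> winding_number c z = 1\<close>[OF that])
    qed (use that \<Omega> p in auto)
  qed
  show thesis
  proof (rule simple_closed_path_winding_number_inside[OF sb])
    assume "\<And>z. z \<in> inside (path_image b) \<Longrightarrow> winding_number b z = 1"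
    then have "convex_boundary \<Omega> b p"
      by (intro build lb b(2) sb simple_image b(4)) (simp add: ins)
    then show thesis by (rule that)
  next
    assume wb: "\<And>z. z \<in> inside (path_image b) \<Longrightarrow> winding_number b z = - 1"
    have rev: "reversepath b = (\<lambda>t. b (1 - t))" by (auto simp: reversepath_def)
    have "(b has_vector_derivative vector_derivative b (at t)) (at t)" for t
      using lb by (simp add: C1_loop_def vector_derivative_works)
    then have "((b \<circ> (\<lambda>t. 1 - t)) has_vector_derivative (- 1) *\<^sub>R vector_derivative b (at (1 - t))) (at t)" for t
      by (intro vector_diff_chain_at) (auto intro!: derivative_eq_intros)
    then have dr: "(reversepath b has_vector_derivative - vector_derivative b (at (1 - t))) (at t)" for t
      by (simp add: rev o_def)
    then have vr: "vector_derivative (reversepath b) (at t) = - vector_derivative b (at (1 - t))" for t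
      by (rule vector_derivative_at)
    have Vb: "continuous_on UNIV (\<lambda>t. vector_derivative b (at t))" using lb by (simp add: C1_loop_def)
    have "convex_boundary \<Omega> (reversepath b) p"
    proof (rule build)
      show "C1_loop (reversepath b)"
        unfolding C1_loop_def vr
      proof (intro conjI allI)
        show "reversepath b differentiable at t" for t using dr by (rule differentiableI_vector)
        show "continuous_on UNIV (\<lambda>t. - vector_derivative b (at (1 - t)))"
          by (intro continuous_intros continuous_on_compose2[OF Vb]) auto
        show "pathfinish (reversepath b) = pathstart (reversepath b)"
          using bper by (simp add: pathfinish_def pathstart_def rev)
      qed
      show "reversepath b (t + 1) = reversepath b t" for t
        using b(2)[of "- t"] by (simp add: rev)
      show "simple_path (reversepath b)" by (simp add: simple_path_reversepath sb)
      show "path_image (reversepath b) = frontier \<Omega>" by (simp add: simple_image)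
      show "vector_derivative (reversepath b) (at t) \<noteq> 0" for t using b(4) by (simp add: vr)
      show "winding_number (reversepath b) z = 1" if "z \<in> \<Omega>" for z
      proof -
        have "z \<notin> path_image b" using that \<Omega>(1) by (simp add: simple_image frontier_def interior_open)
        then show ?thesis
          using winding_number_reversepath[OF C1_loop_valid(3)[OF lb]] wb that by (simp add: ins)
      qed
    qed
    then show thesis by (rule that)
  qed
qed


section \<open>Functions with values in a right-angled sector\<close>

lemma right_angle_sector_rotate:
  assumes "w \<in> right_angle_sector \<theta>"
  shows "0 \<le> Re (exp (\<i> * of_real (pi / 4 - \<theta>)) * w)" "0 \<le> Im (exp (\<i> * of_real (pi / 4 - \<theta>)) * w)"
proof -
  obtain r t where w: "w = of_real r * exp (\<i> * of_real (\<theta> + t))" "0 \<le> r" "\<bar>t\<bar> \<le> pi / 4"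
    using assms by (auto simp: right_angle_sector_def)
  have "exp (\<i> * of_real (pi / 4 - \<theta>)) * w = of_real r * cis (pi / 4 + t)"
    by (simp add: w(1) cis_conv_exp flip: exp_add) (simp add: algebra_simps)
  moreover have "0 \<le> cos (pi / 4 + t)" "0 \<le> sin (pi / 4 + t)"
    using w(3) by (auto intro!: cos_ge_zero sin_ge_zero)
  ultimately show "0 \<le> Re (exp (\<i> * of_real (pi / 4 - \<theta>)) * w)" "0 \<le> Im (exp (\<i> * of_real (pi / 4 - \<theta>)) * w)"
    using w(2) by simp_all
qed

lemma sup_norm_on_upper:
  assumes "bounded \<Omega>" "continuous_on (closure \<Omega>) f" "z \<in> closure \<Omega>"
  shows "norm (f z) \<le> sup_norm_on \<Omega> f"
  unfolding sup_norm_on_def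
proof (rule cSUP_upper[OF assms(3)])
  have "compact ((\<lambda>z. norm (f z)) ` closure \<Omega>)"
    using assms(1) by (intro compact_continuous_image continuous_on_norm assms(2)) (simp add: compact_closure)
  then show "bdd_above ((\<lambda>z. norm (f z)) ` closure \<Omega>)"
    by (intro bounded_imp_bdd_above compact_imp_bounded)
qed

theorem mainTheorem4:
  fixes \<Omega> :: "complex set"
    and A :: "'a :: chilbert_space \<Rightarrow>\<^sub>L 'a"
    and \<theta> :: real
  assumes "open \<Omega>" and "\<Omega> \<noteq> {}" and "convex \<Omega>" and "bounded \<Omega>" and "smooth_boundary \<Omega>"
    and "clinear_op A"
    and "closure (numerical_range A) \<subseteq> \<Omega>"
  shows "\<forall>f \<in> hol_algebra \<Omega>. f ` \<Omega> \<subseteq> right_angle_sector \<theta> \<longrightarrow>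
           norm (hol_calculus \<Omega> f A) \<le> 2 * sup_norm_on \<Omega> f"
proof (intro ballI impI)
  fix f assume f: "f \<in> hol_algebra \<Omega>" and sector: "f ` \<Omega> \<subseteq> right_angle_sector \<theta>"
  have hf: "f holomorphic_on \<Omega>" and cf: "continuous_on (closure \<Omega>) f"
    using f by (auto simp: hol_algebra_def)
  obtain p where p: "p \<in> \<Omega>" using assms(2) by blast
  have up: "norm (f z) \<le> sup_norm_on \<Omega> f" if "z \<in> \<Omega>" for z
    using sup_norm_on_upper[OF assms(4) cf] that closure_subset by auto
  have M0: "0 \<le> sup_norm_on \<Omega> f" using order_trans[OF norm_ge_zero up[OF p]] .
  show "norm (hol_calculus \<Omega> f A) \<le> 2 * sup_norm_on \<Omega> f"
  (* on the zero space the spectrum is empty and the contour of the calculus is arbitrary *)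
  proof (cases "\<forall>x :: 'a. x = 0")
    case True
    then have "hol_calculus \<Omega> f A = 0" by (intro blinfun_eqI) simp
    then show ?thesis using M0 by simp
  next
    case False
    then obtain x :: 'a where x: "x \<noteq> 0" by blast
    have spec_ne: "spectrum A \<noteq> {}" by (rule spectrum_nonempty[OF assms(6) x])
    let ?W = "closure (numerical_range A)"
    have "bounded ?W" using assms(4,7) bounded_subset by blast
    then have "compact ?W" by (simp add: compact_eq_bounded_closed)
    then have K: "compact (convex hull ?W)" by (rule compact_convex_hull)
    have W: "numerical_range A \<subseteq> ?W" by (rule closure_subset)
    have "numerical_range A \<noteq> {}"
    proof -
      have "norm ((1 / norm x) *\<^sub>R x) = 1" using x by simp
      then show ?thesis unfolding numerical_range_def by blast
    qed
    then have "spectrum A \<subseteq> convex hull ?W"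
      using W hull_subset[of ?W convex]
      by (intro spectrum_subset_closed_convex[OF assms(6) convex_convex_hull compact_imp_closed[OF K]]) auto
    also have "\<dots> \<subseteq> \<Omega>" by (rule hull_minimal[of _ _ convex, OF assms(7,3)])
    finally have spec: "spectrum A \<subseteq> \<Omega>" .
    obtain c where "convex_boundary \<Omega> c p"
      using convex_boundary_exists[OF assms(1,3,4) p assms(5)] by blast
    then interpret convex_boundary \<Omega> c p .
    interpret operator_in_domain \<Omega> c p A
      by unfold_locales (use assms(6,7) spec spec_ne W in auto)
    show ?thesis
    proof (rule field_le_epsilon)
      fix e :: real assume e: "0 < e"
      (* the summand keeps M positive when f vanishes identically *)
      define M where "M = sup_norm_on \<Omega> f + e / 2"
      have M: "M > 0" "sup_norm_on \<Omega> f \<le> M" using M0 e by (auto simp: M_def)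
      define u where "u = exp (\<i> * of_real (pi / 4 - \<theta>))"
      have u: "norm u = 1" "u \<noteq> 0" by (simp_all add: u_def)
      define h where "h z = of_real (1 / M) * (u * f z)" for z
      have hh: "h holomorphic_on \<Omega>" unfolding h_def by (intro holomorphic_intros hf)
      have "h \<in> quarter_class"
        unfolding quarter_class_def
      proof (intro CollectI conjI ballI hh)
        fix z assume z: "z \<in> \<Omega>"
        have "f z \<in> right_angle_sector \<theta>" using sector z by auto
        note rot = right_angle_sector_rotate[OF this, folded u_def]
        have "norm (f z) \<le> M" using up[OF z] M by simp
        then show "norm (h z) \<le> 1" using M u by (simp add: h_def norm_mult norm_divide)
        show "0 \<le> Re (h z)" "0 \<le> Im (h z)"
          using rot M unfolding h_def by (simp_all only: Re_complex_of_real Im_complex_of_real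
            times_complex.sel mult_zero_left diff_zero add_0_right) simp_all
      qed
      then have "norm (calc h) \<le> 2" by (rule quarter_class_norm_le_2)
      have "calc f = calc (\<lambda>z. (of_real M / u) * h z)"
        by (rule calc_cong[OF hf]) (use M u in \<open>simp add: h_def\<close>)
      also have "\<dots> = scaleC_op (of_real M / u) (calc h)" by (rule calc_scale[OF hh])
      finally have "norm (calc f) \<le> norm (of_real M / u) * norm (calc h)"
        by (simp add: norm_scaleC_op)
      also have "\<dots> \<le> M * 2" using M u \<open>norm (calc h) \<le> 2\<close> by (simp add: norm_divide)
      finally show "norm (hol_calculus \<Omega> f A) \<le> 2 * sup_norm_on \<Omega> f + e" by (simp add: M_def)
    qed
  qed
qed

end
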